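(* Let $(M,g_L)$ be a Lorentzian manifold, $E$ a timelike unitary Killing vector field on $M$ and $\overline{M}$ a compact lightlike hypersurface of $M$. Take a lightlike vector field $\xi\in\mathfrak{X}(\overline{M})$ with $g_L(\xi,E)=\frac{1}{\sqrt2}$ and let $N$ be the symmetric of $-\xi$ with respect to $E$. If (i) $H_L$ has sign on $\overline{M}$ (i.e. it is everywhere $\ge0$ or everywhere $\le0$), and (ii) $0\leq Ric_L(N,\xi)+2K_L(\mathrm{span}(\xi,N))$ on $\overline{M}$, then $\overline{M}$ is totally geodesic.
   Context: Lorentzian metrics have signature $(-,+,\dots,+)$; timelike unitary means $g_L(E,E)=-1$. $\nabla^L$ is the Levi-Civita connection of $g_L$ and $R_{UV}W=\nabla^L_U\nabla^L_VW-\nabla^L_V\nabla^L_UW-\nabla^L_{[U,V]}W$. $Ric_L$ is the Ricci tensor, $Ric_L(V,V)=\sum_i\epsilon_i g_L(R_{e_iV}V,e_i)$ for an orthonormal frame with $\epsilon_i=g_L(e_i,e_i)$; $K_L(\mathrm{span}(u,v))=g_L(R_{uv}v,u)/\big(g_L(u,u)g_L(v,v)-g_L(u,v)^2\big)$. The symmetric with respect to $E$ of $v=\alpha E+Y$, $Y\perp E$, is $\alpha E-Y$; hence $N=\sqrt2E+\xi$. A lightlike hypersurface is a hypersurface on which the induced metric is degenerate. Its second fundamental form (with respect to $\xi$) is $B(V,W)=-g_L(\nabla^L_V\xi,W)$ for $V,W\in\mathfrak{X}(\overline{M})$; $\overline{M}$ is totally geodesic if $B=0$. The screen distribution is $\mathcal{S}=T\overline{M}\cap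 E^\perp$, and the lightlike mean curvature is $H_L=\sum_{i=1}^{n-2}B(e_i,e_i)$, where $n=\dim M$ and $\{e_1,\dots,e_{n-2}\}$ is an orthonormal basis of $\mathcal{S}$. *)

theory Defs
  imports "HOL-Analysis.Analysis" "HOL-Library.Function_Algebras"
begin

section \<open>Smooth manifolds\<close>

text \<open>\<open>Ck_on k U f\<close> is meant for open \<open>U\<close> only.\<close>

primrec Ck_on ::
  "nat \<Rightarrow> 'a::real_normed_vector set \<Rightarrow> ('a \<Rightarrow> 'b::real_normed_vector) \<Rightarrow> bool" where
  "Ck_on 0 U f \<longleftrightarrow> continuous_on U f"
| "Ck_on (Suc k) U f \<longleftrightarrow> (\<forall>x\<in>U. f differentiable (at x)) \<and>
     (\<forall>v. Ck_on k U (\<lambda>x. frechet_derivative f (at x) v))"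

definition smooth_on ::
  "'a::real_normed_vector set \<Rightarrow> ('a \<Rightarrow> 'b::real_normed_vector) \<Rightarrow> bool" where
  "smooth_on U f \<longleftrightarrow> (\<forall>k. Ck_on k U f)"

text \<open>
  The underlying set of the manifold \<open>M\<close> is a whole type \<open>'m\<close>, Hausdorff and second countable
  by its type classes. The smooth structure is given by an atlas of charts into the Euclidean
  space \<open>'e\<close>, so that \<open>dim M = DIM('e)\<close>. A chart is a pair of its domain and its coordinate map;
  the coordinate map has no meaning outside the domain.
\<close>

type_synonym ('m, 'e) chart = "'m set \<times> ('m \<Rightarrow> 'e)"

abbreviation dom_chart :: "('m, 'e) chart \<Rightarrow> 'm set" where
  "dom_chart c \<equiv> fst c"

abbreviation map_chart :: "('m, 'e) chart \<Rightarrow> 'm \<Rightarrow> 'e" where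
  "map_chart c \<equiv> snd c"

definition inv_chart :: "('m, 'e) chart \<Rightarrow> 'e \<Rightarrow> 'm" where
  "inv_chart c = inv_into (dom_chart c) (map_chart c)"

definition is_chart ::
  "('m::{t2_space, second_countable_topology}, 'e::euclidean_space) chart \<Rightarrow> bool" where
  "is_chart c \<longleftrightarrow> open (dom_chart c) \<and> open (map_chart c ` dom_chart c) \<and>
     homeomorphism (dom_chart c) (map_chart c ` dom_chart c) (map_chart c) (inv_chart c)"

definition compatible :: 
  "('m, 'e::euclidean_space) chart \<Rightarrow> ('m, 'e) chart \<Rightarrow> bool" where
  "compatible c d \<longleftrightarrow>
     smooth_on (map_chart c ` (dom_chart c \<inter> dom_chart d)) (map_chart d \<circ> inv_chart c) \<and>
     smooth_on (map_chart d ` (dom_chart c \<inter> dom_chart d)) (map_chart c \<circ> inv_chart d)"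

definition smooth_atlas ::
  "('m::{t2_space, second_countable_topology}, 'e::euclidean_space) chart set \<Rightarrow> bool" where
  "smooth_atlas A \<longleftrightarrow> (\<forall>c\<in>A. is_chart c) \<and> (\<Union>c\<in>A. dom_chart c) = UNIV \<and>
     (\<forall>c\<in>A. \<forall>d\<in>A. compatible c d)"

definition max_atlas ::
  "('m::{t2_space, second_countable_topology}, 'e::euclidean_space) chart set
    \<Rightarrow> ('m, 'e) chart set" where
  "max_atlas A = {c. is_chart c \<and> (\<forall>d\<in>A. compatible c d)}"

definition Cinf :: "('m, 'e::euclidean_space) chart set \<Rightarrow> ('m \<Rightarrow> real) set" where
  "Cinf A = {f. \<forall>c\<in>A. smooth_on (map_chart c ` dom_chart c) (f \<circ> inv_chart c)}"


section \<open>Tangent vectors and vector fields\<close>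

text \<open>
  Tangent vectors at \<open>p\<close> are the derivations at \<open>p\<close> of the algebra of smooth functions. They are
  set to \<open>0\<close> on non-smooth functions, so that equality in the tangent space is equality of
  HOL functions. The vector space operations are the pointwise ones.
\<close>

type_synonym 'm tvec = "('m \<Rightarrow> real) \<Rightarrow> real"

type_synonym 'm vfield = "'m \<Rightarrow> 'm tvec"

definition vscale :: "real \<Rightarrow> 'm tvec \<Rightarrow> 'm tvec" (infixr "\<cdot>\<^sub>v" 75) where
  "a \<cdot>\<^sub>v v = (\<lambda>f. a * v f)"

definition fscale :: "('m \<Rightarrow> real) \<Rightarrow> 'm vfield \<Rightarrow> 'm vfield" (infixr "\<cdot>\<^sub>f" 75) where
  "f \<cdot>\<^sub>f X = (\<lambda>p. f p \<cdot>\<^sub>v X p)"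

definition tangent_space :: "('m, 'e::euclidean_space) chart set \<Rightarrow> 'm \<Rightarrow> 'm tvec set" where
  "tangent_space A p = {v.
     (\<forall>f\<in>Cinf A. \<forall>h\<in>Cinf A. v (f + h) = v f + v h) \<and>
     (\<forall>a. \<forall>f\<in>Cinf A. v (\<lambda>x. a * f x) = a * v f) \<and>
     (\<forall>f\<in>Cinf A. \<forall>h\<in>Cinf A. v (f * h) = v f * h p + f p * v h) \<and>
     (\<forall>f. f \<notin> Cinf A \<longrightarrow> v f = 0)}"

definition act :: "'m vfield \<Rightarrow> ('m \<Rightarrow> real) \<Rightarrow> 'm \<Rightarrow> real" where
  "act X f = (\<lambda>p. X p f)"

definition vector_fields :: "('m, 'e::euclidean_space) chart set \<Rightarrow> 'm vfield set" where
  "vector_fields A = {X. (\<forall>p. X p \<in> tangent_space A p) \<and> (\<forall>f\<in>Cinf A. act X f \<in> Cinf A)}"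

definition lie_bracket :: "'m vfield \<Rightarrow> 'm vfield \<Rightarrow> 'm vfield" where
  "lie_bracket X Y = (\<lambda>p f. X p (act Y f) - Y p (act X f))"


section \<open>Lorentzian metrics, Levi-Civita connection, curvature\<close>

text \<open>
  \<open>orthonormal_basis b W k e\<close>: \<open>e 0, \<dots>, e (k - 1)\<close> is an orthonormal basis of the subspace \<open>W\<close>
  with respect to the possibly indefinite bilinear form \<open>b\<close> (linear independence follows from
  the orthonormality relations).
\<close>

definition orthonormal_basis ::
  "('m tvec \<Rightarrow> 'm tvec \<Rightarrow> real) \<Rightarrow> 'm tvec set \<Rightarrow> nat \<Rightarrow> (nat \<Rightarrow> 'm tvec) \<Rightarrow> bool" where
  "orthonormal_basis b W k e \<longleftrightarrow>
     (\<forall>i<k. e i \<in> W) \<and>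
     (\<forall>i<k. b (e i) (e i) = 1 \<or> b (e i) (e i) = -1) \<and>
     (\<forall>i<k. \<forall>j<k. i \<noteq> j \<longrightarrow> b (e i) (e j) = 0) \<and>
     (\<forall>v\<in>W. \<exists>a. v = (\<Sum>i<k. a i \<cdot>\<^sub>v e i))"

type_synonym 'm metric = "'m \<Rightarrow> 'm tvec \<Rightarrow> 'm tvec \<Rightarrow> real"

definition lorentzian_metric ::
  "('m, 'e::euclidean_space) chart set \<Rightarrow> 'm metric \<Rightarrow> bool" where
  "lorentzian_metric A g \<longleftrightarrow>
     (\<forall>p. \<forall>u\<in>tangent_space A p. \<forall>v\<in>tangent_space A p. g p u v = g p v u) \<and>
     (\<forall>p. \<forall>u\<in>tangent_space A p. \<forall>v\<in>tangent_space A p. \<forall>w\<in>tangent_space A p. \<forall>a.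
        g p (a \<cdot>\<^sub>v u + v) w = a * g p u w + g p v w) \<and>
     (\<forall>p. \<exists>e. orthonormal_basis (g p) (tangent_space A p) DIM('e) e \<and>
        g p (e 0) (e 0) = -1 \<and> (\<forall>i. 0 < i \<and> i < DIM('e) \<longrightarrow> g p (e i) (e i) = 1)) \<and>
     (\<forall>X\<in>vector_fields A. \<forall>Y\<in>vector_fields A. (\<lambda>p. g p (X p) (Y p)) \<in> Cinf A)"

definition affine_connection ::
  "('m, 'e::euclidean_space) chart set \<Rightarrow> ('m vfield \<Rightarrow> 'm vfield \<Rightarrow> 'm vfield) \<Rightarrow> bool" where
  "affine_connection A D \<longleftrightarrow>
     (\<forall>X\<in>vector_fields A. \<forall>Y\<in>vector_fields A. D X Y \<in> vector_fields A) \<and>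
     (\<forall>X\<in>vector_fields A. \<forall>Y\<in>vector_fields A. \<forall>Z\<in>vector_fields A. \<forall>f\<in>Cinf A.
        D (f \<cdot>\<^sub>f X + Y) Z = f \<cdot>\<^sub>f D X Z + D Y Z) \<and>
     (\<forall>X\<in>vector_fields A. \<forall>Y\<in>vector_fields A. \<forall>Z\<in>vector_fields A.
        D X (Y + Z) = D X Y + D X Z) \<and>
     (\<forall>X\<in>vector_fields A. \<forall>Y\<in>vector_fields A. \<forall>f\<in>Cinf A.
        D X (f \<cdot>\<^sub>f Y) = act X f \<cdot>\<^sub>f Y + f \<cdot>\<^sub>f D X Y)"

text \<open>This determines \<open>D\<close> uniquely on smooth vector fields; nothing is said about other arguments.\<close>

definition levi_civita ::
  "('m, 'e::euclidean_space) chart set \<Rightarrow> 'm metric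
    \<Rightarrow> ('m vfield \<Rightarrow> 'm vfield \<Rightarrow> 'm vfield) \<Rightarrow> bool" where
  "levi_civita A g D \<longleftrightarrow> affine_connection A D \<and>
     (\<forall>X\<in>vector_fields A. \<forall>Y\<in>vector_fields A. D X Y - D Y X = lie_bracket X Y) \<and>
     (\<forall>X\<in>vector_fields A. \<forall>Y\<in>vector_fields A. \<forall>Z\<in>vector_fields A. \<forall>p.
        X p (\<lambda>q. g q (Y q) (Z q)) = g p (D X Y p) (Z p) + g p (Y p) (D X Z p))"

text \<open>Vanishing of the Lie derivative of the metric along \<open>E\<close>.\<close>

definition killing ::
  "('m, 'e::euclidean_space) chart set \<Rightarrow> 'm metric \<Rightarrow> 'm vfield \<Rightarrow> bool" where
  "killing A g E \<longleftrightarrow> E \<in> vector_fields A \<and>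
     (\<forall>X\<in>vector_fields A. \<forall>Y\<in>vector_fields A. \<forall>p.
        E p (\<lambda>q. g q (X q) (Y q)) =
          g p (lie_bracket E X p) (Y p) + g p (X p) (lie_bracket E Y p))"

definition timelike_unitary ::
  "('m, 'e::euclidean_space) chart set \<Rightarrow> 'm metric \<Rightarrow> 'm vfield \<Rightarrow> bool" where
  "timelike_unitary A g E \<longleftrightarrow> E \<in> vector_fields A \<and> (\<forall>p. g p (E p) (E p) = -1)"

definition curvature_field ::
  "('m vfield \<Rightarrow> 'm vfield \<Rightarrow> 'm vfield) \<Rightarrow> 'm vfield \<Rightarrow> 'm vfield \<Rightarrow> 'm vfield \<Rightarrow> 'm vfield" where
  "curvature_field D U V W = D U (D V W) - D V (D U W) - D (lie_bracket U V) W"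

text \<open>
  The curvature is tensorial, so its value at tangent vectors at \<open>p\<close> is computed with arbitrary
  global smooth extensions of these vectors.
\<close>

definition extend_vec ::
  "('m, 'e::euclidean_space) chart set \<Rightarrow> 'm \<Rightarrow> 'm tvec \<Rightarrow> 'm vfield" where
  "extend_vec A p v = (SOME X. X \<in> vector_fields A \<and> X p = v)"

definition curvature ::
  "('m, 'e::euclidean_space) chart set \<Rightarrow> ('m vfield \<Rightarrow> 'm vfield \<Rightarrow> 'm vfield)
    \<Rightarrow> 'm \<Rightarrow> 'm tvec \<Rightarrow> 'm tvec \<Rightarrow> 'm tvec \<Rightarrow> 'm tvec" where
  "curvature A D p u v w =
     curvature_field D (extend_vec A p u) (extend_vec A p v) (extend_vec A p w) p"

text \<open>
  The Ricci tensor as a bilinear form; it is symmetric for the Levi-Civita connection, hence the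
  polarization of \<open>v \<mapsto> ricci A g D p v v\<close>. The value does not depend on the orthonormal basis.
\<close>

definition ricci ::
  "('m, 'e::euclidean_space) chart set \<Rightarrow> 'm metric \<Rightarrow> ('m vfield \<Rightarrow> 'm vfield \<Rightarrow> 'm vfield)
    \<Rightarrow> 'm \<Rightarrow> 'm tvec \<Rightarrow> 'm tvec \<Rightarrow> real" where
  "ricci A g D p v w =
     (let e = (SOME e. orthonormal_basis (g p) (tangent_space A p) DIM('e) e)
      in \<Sum>i<DIM('e). g p (e i) (e i) * g p (curvature A D p (e i) v w) (e i))"

text \<open>The sectional curvature of \<open>span(u, v)\<close>, for \<open>u, v\<close> spanning a nondegenerate plane.\<close>

definition sectional ::
  "('m, 'e::euclidean_space) chart set \<Rightarrow> 'm metric \<Rightarrow> ('m vfield \<Rightarrow> 'm vfield \<Rightarrow> 'm vfield)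
    \<Rightarrow> 'm \<Rightarrow> 'm tvec \<Rightarrow> 'm tvec \<Rightarrow> real" where
  "sectional A g D p u v =
     g p (curvature A D p u v v) u / (g p u u * g p v v - (g p u v)\<^sup>2)"

definition symmetric_wrt ::
  "('m, 'e::euclidean_space) chart set \<Rightarrow> 'm metric \<Rightarrow> 'm vfield \<Rightarrow> 'm \<Rightarrow> 'm tvec \<Rightarrow> 'm tvec" where
  "symmetric_wrt A g E p v =
     (THE w. \<exists>a. \<exists>y\<in>tangent_space A p.
        g p y (E p) = 0 \<and> v = a \<cdot>\<^sub>v E p + y \<and> w = a \<cdot>\<^sub>v E p - y)"


section \<open>Lightlike hypersurfaces\<close>

text \<open>Embedded hypersurfaces without boundary, described by slice charts of the smooth structure.\<close>

definition hypersurface ::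
  "('m::{t2_space, second_countable_topology}, 'e::euclidean_space) chart set
    \<Rightarrow> 'm set \<Rightarrow> bool" where
  "hypersurface A S \<longleftrightarrow>
     (\<forall>p\<in>S. \<exists>c\<in>max_atlas A. p \<in> dom_chart c \<and>
        (\<exists>b\<in>Basis. map_chart c ` (dom_chart c \<inter> S) =
           map_chart c ` dom_chart c \<inter> {x. x \<bullet> b = 0}))"

text \<open>
  The tangent space of \<open>S\<close> inside that of \<open>M\<close>: the derivations at \<open>p\<close> that annihilate every
  smooth function vanishing on \<open>S\<close>, that is, those that act on restrictions to \<open>S\<close>.
\<close>

definition tangent_sub ::
  "('m, 'e::euclidean_space) chart set \<Rightarrow> 'm set \<Rightarrow> 'm \<Rightarrow> 'm tvec set" where
  "tangent_sub A S p =
     {v \<in> tangent_space A p. \<forall>f\<in>Cinf A. (\<forall>q\<in>S. f q = 0) \<longrightarrow> v f = 0}"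

definition smooth_along ::
  "('m::topological_space, 'e::euclidean_space) chart set \<Rightarrow> 'm set \<Rightarrow> ('m \<Rightarrow> real) \<Rightarrow> bool" where
  "smooth_along A S h \<longleftrightarrow>
     (\<forall>p\<in>S. \<exists>U. open U \<and> p \<in> U \<and> (\<exists>f\<in>Cinf A. \<forall>q\<in>U \<inter> S. h q = f q))"

text \<open>Smooth tangent vector fields on \<open>S\<close>; their values outside \<open>S\<close> are irrelevant.\<close>

definition vector_fields_sub ::
  "('m::topological_space, 'e::euclidean_space) chart set \<Rightarrow> 'm set \<Rightarrow> 'm vfield set" where
  "vector_fields_sub A S =
     {X. (\<forall>p\<in>S. X p \<in> tangent_sub A S p) \<and> (\<forall>f\<in>Cinf A. smooth_along A S (act X f))}"

definition lightlike_hypersurface ::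
  "('m::{t2_space, second_countable_topology}, 'e::euclidean_space) chart set
    \<Rightarrow> 'm metric \<Rightarrow> 'm set \<Rightarrow> bool" where
  "lightlike_hypersurface A g S \<longleftrightarrow> hypersurface A S \<and>
     (\<forall>p\<in>S. \<exists>v\<in>tangent_sub A S p. v \<noteq> 0 \<and> (\<forall>w\<in>tangent_sub A S p. g p v w = 0))"

definition lightlike_field_sub ::
  "('m::topological_space, 'e::euclidean_space) chart set
    \<Rightarrow> 'm metric \<Rightarrow> 'm set \<Rightarrow> 'm vfield \<Rightarrow> bool" where
  "lightlike_field_sub A g S \<xi> \<longleftrightarrow> \<xi> \<in> vector_fields_sub A S \<and>
     (\<forall>p\<in>S. \<xi> p \<noteq> 0 \<and> g p (\<xi> p) (\<xi> p) = 0)"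

text \<open>
  The derivative of a field \<open>\<xi>\<close> given along \<open>S\<close> in a direction \<open>v\<close> tangent to \<open>S\<close>; it does not
  depend on the chosen extensions to vector fields on \<open>M\<close>.
\<close>

definition nabla_along ::
  "('m::topological_space, 'e::euclidean_space) chart set
    \<Rightarrow> ('m vfield \<Rightarrow> 'm vfield \<Rightarrow> 'm vfield) \<Rightarrow> 'm set \<Rightarrow> 'm \<Rightarrow> 'm tvec \<Rightarrow> 'm vfield \<Rightarrow> 'm tvec" where
  "nabla_along A D S p v \<xi> =
     D (extend_vec A p v)
       (SOME X. X \<in> vector_fields A \<and> (\<exists>U. open U \<and> p \<in> U \<and> (\<forall>q\<in>U \<inter> S. X q = \<xi> q))) p"

definition second_fund ::
  "('m::topological_space, 'e::euclidean_space) chart set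
    \<Rightarrow> 'm metric \<Rightarrow> ('m vfield \<Rightarrow> 'm vfield \<Rightarrow> 'm vfield) \<Rightarrow> 'm set \<Rightarrow> 'm vfield
    \<Rightarrow> 'm \<Rightarrow> 'm tvec \<Rightarrow> 'm tvec \<Rightarrow> real" where
  "second_fund A g D S \<xi> p v w = - g p (nabla_along A D S p v \<xi>) w"

definition totally_geodesic ::
  "('m::topological_space, 'e::euclidean_space) chart set
    \<Rightarrow> 'm metric \<Rightarrow> ('m vfield \<Rightarrow> 'm vfield \<Rightarrow> 'm vfield) \<Rightarrow> 'm set \<Rightarrow> 'm vfield \<Rightarrow> bool" where
  "totally_geodesic A g D S \<xi> \<longleftrightarrow>
     (\<forall>p\<in>S. \<forall>v\<in>tangent_sub A S p. \<forall>w\<in>tangent_sub A S p. second_fund A g D S \<xi> p v w = 0)"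

definition screen ::
  "('m, 'e::euclidean_space) chart set
    \<Rightarrow> 'm metric \<Rightarrow> 'm vfield \<Rightarrow> 'm set \<Rightarrow> 'm \<Rightarrow> 'm tvec set" where
  "screen A g E S p = {v \<in> tangent_sub A S p. g p v (E p) = 0}"

text \<open>
  The value does not depend on the orthonormal basis. The screen is spacelike, so no signs occur.
\<close>

definition mean_curvature ::
  "('m::topological_space, 'e::euclidean_space) chart set
    \<Rightarrow> 'm metric \<Rightarrow> ('m vfield \<Rightarrow> 'm vfield \<Rightarrow> 'm vfield) \<Rightarrow> 'm vfield \<Rightarrow> 'm set \<Rightarrow> 'm vfield
    \<Rightarrow> 'm \<Rightarrow> real" where
  "mean_curvature A g D E S \<xi> p =
     (let e = (SOME e. orthonormal_basis (g p) (screen A g E S p) (DIM('e) - 2) e)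
      in \<Sum>i<DIM('e) - 2. second_fund A g D S \<xi> p (e i) (e i))"

end

theory Submission
  imports Defs
begin

text \<open>Put \<open>A' X = \<nabla>\<^sub>X E\<close>; as \<open>E\<close> is a unit Killing field, \<open>A'\<close> is skew, kills
\<open>E\<close> and takes values orthogonal to \<open>E\<close>. Let \<open>W = A' \<xi>\<close>. It is tangent to the hypersurface \<open>S\<close> and lies in
the screen, and \<open>N = sqrt 2 E + \<xi>\<close> with \<open>g(\<xi>, N) = 1\<close>. The normalisation \<open>g(\<xi>, E) = 1 / sqrt 2\<close> makes
\<open>\<xi>\<close> geodesic, so that \<open>B(\<xi>, \<cdot>) = 0\<close>.

Let \<open>S\<close> carry the density \<open>|vol(E, \<cdot>, \<dots>, \<cdot>)|\<close>, and let \<open>div\<close> be the divergence with respect to it. There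
are two pointwise computations. First, \<open>div \<xi> = - H\<close> (\<open>divS_\<Xi>\<close>). Secondly, the Killing equation in the form
\<open>R(X, E) Y = (\<nabla>\<^sub>X A') Y\<close> (\<open>curvature_killing\<close>) and Raychaudhuri's equation
\<open>\<xi>(H) = Ric(\<xi>, \<xi>) + |B|\<^sup>2\<close> (\<open>tr_curvature_\<Xi>\<close>) give, if \<open>H\<close> vanishes identically on \<open>S\<close>,
\<open>Ric(N, \<xi>) + 2 K(\<xi>, N) = sqrt 2 div W - |B|\<^sup>2 - 4 |W|\<^sup>2\<close> (\<open>curvature_condition\<close>).

On a compact hypersurface a divergence that does not change sign vanishes (\<open>divergence_theorem\<close>). Applied to
\<open>\<xi>\<close>, with the sign of \<open>H\<close>, it gives \<open>H = 0\<close>. Then the curvature hypothesis says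
\<open>sqrt 2 div W \<ge> |B|\<^sup>2 + 4 |W|\<^sup>2 \<ge> 0\<close>, so \<open>div W = 0\<close> by the same theorem, and hence \<open>B = 0\<close>.

Tangent vectors are derivations of the algebra of global smooth functions and the connection acts on global
fields, so bump functions are needed to localise everything. Two devices replace a good part of the usual
machinery. The trace of an endomorphism is computed from any way of writing
\<open>v = \<Sum>\<^sub>j \<theta>\<^sub>j(v) b\<^sub>j\<close> (\<open>tr_eq\<close>): this compares the orthonormal bases in the definitions of the Ricci
tensor and of \<open>H\<close> with the coordinate frames used in the differentiations, and the trace of the identity counts
dimensions. The divergence theorem is reduced by a partition of unity to slice charts, where the hyperplane is
thickened to a slab, so that all integrals are Lebesgue integrals over the full coordinate space; there a
directional derivative integrates to zero, and Jacobi's formula for the derivative of the Gram determinant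
identifies the divergence.\<close>

section \<open>Calculus of smooth maps\<close>

lemma has_derivative_frechet: "f differentiable (at x) \<Longrightarrow> (f has_derivative frechet_derivative f (at x)) (at x)"
  by (simp add: frechet_derivative_works)

lemma frechet_derivative_cong_open:
  assumes "open U" "x \<in> U" "\<And>y. y \<in> U \<Longrightarrow> f y = g y"
  shows "f differentiable (at x) \<longleftrightarrow> g differentiable (at x)"
    and "frechet_derivative f (at x) = frechet_derivative g (at x)"
proof -
  have *: "(f has_derivative h) (at x) \<longleftrightarrow> (g has_derivative h) (at x)" for h
    using has_derivative_transform_within_open[of f h x UNIV U g]
      has_derivative_transform_within_open[of g h x UNIV U f] assms by auto
  show "f differentiable (at x) \<longleftrightarrow> g differentiable (at x)" by (simp add: differentiable_def *)
  show "frechet_derivative f (at x) = frechet_derivative g (at x)" by (simp add: frechet_derivative_def *)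
qed

lemma Ck_on_cong:
  "open U \<Longrightarrow> (\<And>x. x \<in> U \<Longrightarrow> f x = g x) \<Longrightarrow> Ck_on k U f \<longleftrightarrow> Ck_on k U g"
proof (induction k arbitrary: f g)
  case 0 then show ?case by (simp cong: continuous_on_cong)
next
  case (Suc k)
  have "Ck_on k U (\<lambda>x. frechet_derivative f (at x) v) \<longleftrightarrow> Ck_on k U (\<lambda>x. frechet_derivative g (at x) v)" for v
    using frechet_derivative_cong_open(2)[of U _ f g] Suc.prems by (intro Suc.IH) auto
  moreover have "f differentiable (at x) \<longleftrightarrow> g differentiable (at x)" if "x \<in> U" for x
    using frechet_derivative_cong_open(1)[of U x f g] Suc.prems that by auto
  ultimately show ?case by auto
qed

text \<open>In the definition of \<open>Ck_on\<close> the derivative is a choice term; any derivative serves as well.\<close>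

lemma Ck_on_SucI:
  assumes "open U" "\<And>x. x \<in> U \<Longrightarrow> (f has_derivative f' x) (at x)" "\<And>v. Ck_on k U (\<lambda>x. f' x v)"
  shows "Ck_on (Suc k) U f"
proof -
  have "Ck_on k U (\<lambda>x. frechet_derivative f (at x) v) \<longleftrightarrow> Ck_on k U (\<lambda>x. f' x v)" for v
    by (intro Ck_on_cong assms) (simp add: frechet_derivative_at[OF assms(2), symmetric])
  then show ?thesis using assms by (auto simp: differentiable_def)
qed

lemma Ck_on_SucD:
  "Ck_on (Suc k) U f \<Longrightarrow> x \<in> U \<Longrightarrow> (f has_derivative frechet_derivative f (at x)) (at x)"
  "Ck_on (Suc k) U f \<Longrightarrow> Ck_on k U (\<lambda>x. frechet_derivative f (at x) v)"
  by (auto simp: has_derivative_frechet)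

lemma Ck_on_lower: "Ck_on (Suc k) U f \<Longrightarrow> Ck_on k U f"
proof (induction k arbitrary: f)
  case 0 then show ?case
    by (auto intro!: differentiable_imp_continuous_on differentiable_at_imp_differentiable_on)
next
  case (Suc k) then show ?case by auto
qed

lemma Ck_on_subset: "Ck_on k U f \<Longrightarrow> V \<subseteq> U \<Longrightarrow> Ck_on k V f"
  by (induction k arbitrary: f) (auto intro: continuous_on_subset)

lemma Ck_on_const: "open U \<Longrightarrow> Ck_on k U (\<lambda>x. c)"
proof (induction k arbitrary: c)
  case (Suc k) then show ?case by (intro Ck_on_SucI[where f'="\<lambda>x v. 0"]) auto
qed auto

lemma Ck_on_linear:
  assumes "bounded_linear h" "open U"
  shows "Ck_on k U h"
proof (cases k)
  case 0 then show ?thesis using assms by (simp add: linear_continuous_on)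
next
  case (Suc m) then show ?thesis
    unfolding Suc using assms
    by (intro Ck_on_SucI[where f'="\<lambda>x. h"] Ck_on_const bounded_linear_imp_has_derivative)
qed

lemma Ck_on_add: "open U \<Longrightarrow> Ck_on k U f \<Longrightarrow> Ck_on k U g \<Longrightarrow> Ck_on k U (\<lambda>x. f x + g x)"
proof (induction k arbitrary: f g)
  case 0 then show ?case by (auto intro: continuous_intros)
next
  case (Suc k)
  then show ?case
    by (intro Ck_on_SucI[where f'="\<lambda>x v. frechet_derivative f (at x) v + frechet_derivative g (at x) v"])
      (auto intro!: has_derivative_add Suc.IH dest: Ck_on_SucD simp: has_derivative_frechet)
qed

lemma Ck_on_bilinear:
  assumes "bounded_bilinear pr" "open U"
  shows "Ck_on k U f \<Longrightarrow> Ck_on k U g \<Longrightarrow> Ck_on k U (\<lambda>x. pr (f x) (g x))"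
proof (induction k arbitrary: f g)
  case 0 then show ?case using bounded_bilinear.continuous_on[OF assms(1)] by auto
next
  case (Suc k)
  show ?case
  proof (intro Ck_on_SucI)
    show "((\<lambda>x. pr (f x) (g x)) has_derivative
       (\<lambda>v. pr (f x) (frechet_derivative g (at x) v) + pr (frechet_derivative f (at x) v) (g x))) (at x)"
      if "x \<in> U" for x
      using that Suc.prems by (intro bounded_bilinear.FDERIV[OF assms(1)] Ck_on_SucD) auto
    show "Ck_on k U (\<lambda>x. pr (f x) (frechet_derivative g (at x) v) + pr (frechet_derivative f (at x) v) (g x))" for v
      using Suc.prems[THEN Ck_on_lower] Suc.prems[THEN Ck_on_SucD(2)]
      by (intro Ck_on_add[OF assms(2)] Suc.IH)
  qed (fact assms)
qed

lemma Ck_on_sum: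
  "open U \<Longrightarrow> (\<And>i. i \<in> I \<Longrightarrow> Ck_on k U (f i)) \<Longrightarrow> Ck_on k U (\<lambda>x. \<Sum>i\<in>I. f i x)"
  by (induction I rule: infinite_finite_induct) (auto intro: Ck_on_add Ck_on_const)

text \<open>The inner derivative enters the chain rule as a direction that varies with the point. Writing it in the standard
basis leaves directional derivatives of \<open>f\<close> in constant directions, to which the induction hypothesis applies.\<close>

lemma Ck_on_compose:
  fixes g :: "'a::real_normed_vector \<Rightarrow> 'b::euclidean_space"
  assumes "open U" "open V" 
  shows "Ck_on k V f \<Longrightarrow> Ck_on k U g \<Longrightarrow> g ` U \<subseteq> V \<Longrightarrow> Ck_on k U (\<lambda>x. f (g x))"
proof (induction k arbitrary: f)
  case 0 then show ?case using continuous_on_compose2[of V f U g] by auto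
next
  case (Suc k)
  let ?Df = "\<lambda>y. frechet_derivative f (at y)" and ?Dg = "\<lambda>x. frechet_derivative g (at x)"
  show ?case
  proof (rule Ck_on_SucI[OF assms(1), where f'="\<lambda>x v. \<Sum>b\<in>Basis. (?Dg x v \<bullet> b) *\<^sub>R ?Df (g x) b"])
    fix x assume x: "x \<in> U"
    then have 1: "(f has_derivative ?Df (g x)) (at (g x))" using Suc.prems by (intro Ck_on_SucD(1)) auto
    have 2: "(g has_derivative ?Dg x) (at x)" using x Suc.prems by (intro Ck_on_SucD(1)) auto
    have "((f \<circ> g) has_derivative (?Df (g x) \<circ> ?Dg x)) (at x)" by (rule diff_chain_at[OF 2 1])
    moreover have "(?Df (g x) \<circ> ?Dg x) v = (\<Sum>b\<in>Basis. (?Dg x v \<bullet> b) *\<^sub>R ?Df (g x) b)" for v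
    proof -
      note lin = has_derivative_linear[OF 1]
      have "?Df (g x) (?Dg x v) = ?Df (g x) (\<Sum>b\<in>Basis. (?Dg x v \<bullet> b) *\<^sub>R b)"
        by (simp add: euclidean_representation)
      then show ?thesis by (simp add: linear_sum[OF lin] linear_scale[OF lin])
    qed
    ultimately show "((\<lambda>x. f (g x)) has_derivative (\<lambda>v. \<Sum>b\<in>Basis. (?Dg x v \<bullet> b) *\<^sub>R ?Df (g x) b)) (at x)"
      by (simp add: o_def fun_eq_iff)
  next
    fix v
    have "Ck_on k U (\<lambda>x. ?Df (g x) b)" for b
      using Suc.prems(1)[THEN Ck_on_SucD(2)] Suc.prems(2)[THEN Ck_on_lower] Suc.prems(3) by (intro Suc.IH)
    moreover have "Ck_on k U (\<lambda>x. ?Dg x v \<bullet> b)" for b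
      using Suc.prems(2)[THEN Ck_on_SucD(2)]
      by (intro Ck_on_bilinear[OF bounded_bilinear_inner assms(1)] Ck_on_const assms) 
    ultimately show "Ck_on k U (\<lambda>x. \<Sum>b\<in>Basis. (?Dg x v \<bullet> b) *\<^sub>R ?Df (g x) b)"
      by (intro Ck_on_sum Ck_on_bilinear[OF bounded_bilinear_scaleR assms(1)] assms)
  qed
qed

lemma Ck_on_local:
  assumes "\<And>x. x \<in> U \<Longrightarrow> \<exists>V. open V \<and> x \<in> V \<and> Ck_on k V f"
  shows "Ck_on k U f"
  using assms
proof (induction k arbitrary: f)
  case 0
  then have "\<And>x. x \<in> U \<Longrightarrow> isCont f x" by (metis Ck_on.simps(1) continuous_on_eq_continuous_at)
  then show ?case by (simp add: continuous_at_imp_continuous_on)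
next
  case (Suc k)
  show ?case
  proof (simp, intro conjI allI ballI)
    show "f differentiable at x" if "x \<in> U" for x using Suc.prems[OF that] by auto
    show "Ck_on k U (\<lambda>x. frechet_derivative f (at x) v)" for v
      by (rule Suc.IH) (use Suc.prems in \<open>metis Ck_on_SucD(2)\<close>)
  qed
qed

lemma smooth_on_cong: "open U \<Longrightarrow> (\<And>x. x \<in> U \<Longrightarrow> f x = g x) \<Longrightarrow> smooth_on U f \<longleftrightarrow> smooth_on U g"
  using Ck_on_cong by (metis smooth_on_def)

lemma smooth_on_subset: "smooth_on U f \<Longrightarrow> V \<subseteq> U \<Longrightarrow> smooth_on V f"
  unfolding smooth_on_def using Ck_on_subset by blast

lemma smooth_on_const: "open U \<Longrightarrow> smooth_on U (\<lambda>x. c)"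
  by (simp add: smooth_on_def Ck_on_const)

lemma smooth_on_linear: "bounded_linear h \<Longrightarrow> open U \<Longrightarrow> smooth_on U h"
  by (simp add: smooth_on_def Ck_on_linear)

lemma smooth_on_add: "open U \<Longrightarrow> smooth_on U f \<Longrightarrow> smooth_on U g \<Longrightarrow> smooth_on U (\<lambda>x. f x + g x)"
  by (simp add: smooth_on_def Ck_on_add)

lemma smooth_on_bilinear: "bounded_bilinear pr \<Longrightarrow> open U \<Longrightarrow> smooth_on U f \<Longrightarrow> smooth_on U g
    \<Longrightarrow> smooth_on U (\<lambda>x. pr (f x) (g x))"
  by (simp add: smooth_on_def Ck_on_bilinear)

lemmas smooth_on_mult = smooth_on_bilinear[OF bounded_bilinear_mult]
lemmas smooth_on_inner = smooth_on_bilinear[OF bounded_bilinear_inner]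

lemma smooth_on_compose:
  fixes g :: "'a::real_normed_vector \<Rightarrow> 'b::euclidean_space"
  shows "open U \<Longrightarrow> open V \<Longrightarrow> smooth_on V f \<Longrightarrow> smooth_on U g \<Longrightarrow> g ` U \<subseteq> V
    \<Longrightarrow> smooth_on U (\<lambda>x. f (g x))"
  unfolding smooth_on_def using Ck_on_compose by blast

lemma smooth_on_local: "(\<And>x. x \<in> U \<Longrightarrow> \<exists>V. open V \<and> x \<in> V \<and> smooth_on V f) \<Longrightarrow> smooth_on U f"
  unfolding smooth_on_def by (metis Ck_on_local)

lemma smooth_on_continuous_on: "smooth_on U f \<Longrightarrow> continuous_on U f"
  by (metis Ck_on.simps(1) smooth_on_def)

lemma smooth_on_has_derivative:
  "smooth_on U f \<Longrightarrow> x \<in> U \<Longrightarrow> (f has_derivative frechet_derivative f (at x)) (at x)"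
  unfolding smooth_on_def by (metis Ck_on_SucD(1))

lemma smooth_on_frechet_derivative:
  "smooth_on U f \<Longrightarrow> smooth_on U (\<lambda>x. frechet_derivative f (at x) v)"
  unfolding smooth_on_def by (metis Ck_on_SucD(2))

lemma smooth_on_inverse: "smooth_on {0<..} (inverse :: real \<Rightarrow> real)"
proof -
  have "Ck_on k {0<..} (inverse :: real \<Rightarrow> real)" for k
  proof (induction k)
    case 0 show ?case by (auto intro!: continuous_intros)
  next
    case (Suc k)
    show ?case
    proof (rule Ck_on_SucI[where f'="\<lambda>x v. (inverse x * inverse x) * (- v)"])
      show "Ck_on k {0<..} (\<lambda>x. inverse x * inverse x * - v)" for v :: real
        by (intro Ck_on_bilinear[OF bounded_bilinear_mult] Ck_on_const Suc open_greaterThan)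
    qed (auto intro!: derivative_eq_intros)
  qed
  then show ?thesis by (simp add: smooth_on_def)
qed

subsection \<open>Bump functions\<close>

text \<open>With \<open>s = 1 / t\<close> these are the functions \<open>s\<^sup>m exp(- s)\<close> for \<open>t > 0\<close>. The derivative of a member of this family is a linear combination of two others, so
  all of them are smooth, also at the origin.\<close>

definition flat :: "nat \<Rightarrow> real \<Rightarrow> real" where
  "flat m t = (if t > 0 then inverse t ^ m * exp (- inverse t) else 0)"

lemma flat_tendsto_0: "(flat m \<longlongrightarrow> 0) (at_right 0)"
proof -
  have "((\<lambda>s::real. s ^ m / exp s) \<longlongrightarrow> 0) at_top" by (rule tendsto_power_div_exp_0)
  then have "((\<lambda>t. inverse t ^ m / exp (inverse t)) \<longlongrightarrow> (0::real)) (at_right 0)"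
    by (rule filterlim_compose) (rule filterlim_inverse_at_top_right)
  then show ?thesis
    by (rule Lim_transform_eventually) (auto simp: eventually_at_right_field flat_def exp_minus divide_inverse intro: exI[of _ 1])
qed

lemma flat_DERIV: "(flat m has_real_derivative flat (m + 2) t - m * flat (m + 1) t) (at t)"
proof -
  consider "t > 0" | "t < 0" | "t = 0" by linarith
  then show ?thesis
  proof cases
    case 1
    have m: "inverse t * inverse t * inverse t ^ (m - Suc 0) * real m = inverse t ^ (m+1) * m"
      by (cases m) auto
    have "((\<lambda>t. inverse t ^ m * exp (- inverse t)) has_real_derivative flat (m + 2) t - m * flat (m + 1) t) (at t)"
      using 1 m by (auto intro!: derivative_eq_intros simp: flat_def algebra_simps)
    then show ?thesis
      by (rule has_field_derivative_transform_within_open[where S="{0<..}"]) (use 1 in \<open>auto simp: flat_def\<close>)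
  next
    case 2
    have "((\<lambda>t. 0) has_real_derivative flat (m + 2) t - m * flat (m + 1) t) (at t)"
      using 2 by (simp add: flat_def)
    then show ?thesis
      by (rule has_field_derivative_transform_within_open[where S="{..<0}"]) (use 2 in \<open>auto simp: flat_def\<close>)
  next
    case 3
    have "((\<lambda>y. (flat m y - flat m 0) / (y - 0)) \<longlongrightarrow> 0) (at_right 0)"
      using flat_tendsto_0[of "m+1"]
      by (rule Lim_transform_eventually)
        (auto simp: eventually_at_right_field flat_def divide_inverse mult_ac intro: exI[of _ 1])
    moreover have "((\<lambda>y. (flat m y - flat m 0) / (y - 0)) \<longlongrightarrow> 0) (at_left 0)"
      by (rule Lim_transform_eventually[OF tendsto_const])
        (auto simp: eventually_at_left_field flat_def intro: exI[of _ "-1"])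
    ultimately have "((\<lambda>y. (flat m y - flat m 0) / (y - 0)) \<longlongrightarrow> 0) (at 0)"
      by (rule filterlim_split_at_real[rotated])
    then have "(flat m has_real_derivative 0) (at 0)" unfolding has_field_derivative_iff .
    then show ?thesis using 3 by (simp add: flat_def)
  qed
qed

lemma smooth_on_flat: "smooth_on UNIV (flat m)"
proof -
  have "Ck_on k UNIV (flat m)" for k
  proof (induction k arbitrary: m)
    case 0
    show ?case using DERIV_isCont[OF flat_DERIV] by (simp add: continuous_on_eq_continuous_at)
  next
    case (Suc k)
    have *: "Ck_on k UNIV (\<lambda>x. v * flat (m + 2) x + (- real m * v) * flat (m + 1) x)" for v :: real
      by (intro Ck_on_add Ck_on_bilinear[OF bounded_bilinear_mult] Ck_on_const Suc open_UNIV)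
    show ?case
    proof (rule Ck_on_SucI[where f'="\<lambda>x (v::real). v * flat (m + 2) x + (- real m * v) * flat (m + 1) x"])
      show "(flat m has_derivative (\<lambda>v. v * flat (m + 2) x + (- real m * v) * flat (m + 1) x)) (at x)" if "x \<in> UNIV" for x
        using flat_DERIV[of m x] unfolding has_field_derivative_def
        by (rule has_derivative_eq_rhs) (auto simp: fun_eq_iff algebra_simps)
    qed (use * in auto)
  qed
  then show ?thesis by (simp add: smooth_on_def)
qed

text \<open>The smooth step \<open>f(t) / (f(t) + f(1 - t))\<close> with \<open>f = flat 0\<close> is \<open>0\<close> for \<open>t \<le> 0\<close> and \<open>1\<close> for \<open>t \<ge> 1\<close>; the
bump is the step at \<open>2 - |x - x0|\<^sup>2 / r\<^sup>2\<close>.\<close>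

lemma smooth_bump:
  fixes x0 :: "'e::euclidean_space"
  assumes "r > 0"
  obtains B where "smooth_on UNIV (B :: 'e \<Rightarrow> real)" "\<And>x. 0 \<le> B x" "\<And>x. B x \<le> 1"
    "\<And>x. dist x x0 \<le> r \<Longrightarrow> B x = 1" "\<And>x. dist x x0 \<ge> 2 * r \<Longrightarrow> B x = 0"
proof -
  let ?f = "flat 0"
  have pos: "?f t > 0" if "t > 0" for t using that by (simp add: flat_def)
  have nn: "?f t \<ge> 0" for t by (simp add: flat_def)
  have den: "?f t + ?f (1 - t) > 0" for t
    using pos[of t] pos[of "1 - t"] nn[of t] nn[of "1 - t"] by (cases "t > 0") auto
  define st where "st t = ?f t * inverse (?f t + ?f (1 - t))" for t
  have lin: "smooth_on UNIV (\<lambda>t::real. 1 - t)"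
    using smooth_on_add[OF open_UNIV smooth_on_const[OF open_UNIV, of 1] 
        smooth_on_linear[OF bounded_linear_minus[OF bounded_linear_ident] open_UNIV]] by simp
  have "smooth_on UNIV (\<lambda>t. ?f t + ?f (1 - t))"
    by (intro smooth_on_add smooth_on_flat open_UNIV smooth_on_compose[where V=UNIV and f="?f"] lin) auto
  then have sst: "smooth_on UNIV st" unfolding st_def[abs_def] using den
    by (intro smooth_on_mult smooth_on_flat open_UNIV smooth_on_compose[OF _ _ smooth_on_inverse]) auto
  have st01: "0 \<le> st t" "st t \<le> 1" for t
    using nn[of t] nn[of "1 - t"] den[of t] by (auto simp: st_def field_simps)
  have st1: "st t = 1" if "t \<ge> 1" for t using that pos[of t] by (simp add: st_def flat_def)
  have st0: "st t = 0" if "t \<le> 0" for t using that by (simp add: st_def flat_def)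
  define B where "B x = st (2 + (- (inverse (r^2))) * ((x - x0) \<bullet> (x - x0)))" for x
  have sub: "smooth_on UNIV (\<lambda>x. x - x0)"
    using smooth_on_add[OF open_UNIV smooth_on_linear[OF bounded_linear_ident open_UNIV]
        smooth_on_const[OF open_UNIV, of "-x0"]] by simp
  have "smooth_on UNIV B" unfolding B_def[abs_def]
    by (intro smooth_on_compose[OF open_UNIV open_UNIV sst] smooth_on_add smooth_on_mult smooth_on_inner sub
        smooth_on_const open_UNIV) auto
  moreover have "B x = 1" if "dist x x0 \<le> r" for x
  proof -
    have "(x - x0) \<bullet> (x - x0) \<le> r^2" using that power_mono[of "norm (x - x0)" r 2]
      by (simp add: dist_norm power2_norm_eq_inner)
    then show ?thesis unfolding B_def using assms by (intro st1) (simp add: field_simps)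
  qed
  moreover have "B x = 0" if "dist x x0 \<ge> 2 * r" for x
  proof -
    have "(x - x0) \<bullet> (x - x0) \<ge> (2*r)^2" using that power_mono[of "2*r" "norm (x - x0)" 2] assms
      by (simp add: dist_norm power2_norm_eq_inner)
    then have "(x - x0) \<bullet> (x - x0) \<ge> 4 * r^2" by (simp add: power_mult_distrib)
    moreover have "0 \<le> r^2" by simp
    ultimately have "(x - x0) \<bullet> (x - x0) \<ge> 2 * r^2" by linarith
    then show ?thesis unfolding B_def using assms by (intro st0) (simp add: field_simps)
  qed
  ultimately show ?thesis using st01 by (intro that[of B]) (auto simp: B_def)
qed

section \<open>Smooth functions on a manifold\<close>

locale manifold =
  fixes A :: "('m::{t2_space, second_countable_topology}, 'e::euclidean_space) chart set"
  assumes atlas: "smooth_atlas A"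
begin

lemma atlas_le_max_atlas: "c \<in> A \<Longrightarrow> c \<in> max_atlas A"
  using atlas by (auto simp: smooth_atlas_def max_atlas_def)

lemma atlas_covers: obtains c where "c \<in> A" "p \<in> dom_chart c"
  using atlas unfolding smooth_atlas_def by blast

lemma max_atlas_is_chart: "c \<in> max_atlas A \<Longrightarrow> is_chart c"
  by (simp add: max_atlas_def)

lemma
  assumes "c \<in> max_atlas A"
  shows open_dom_chart: "open (dom_chart c)"
    and open_image_chart: "open (map_chart c ` dom_chart c)"
    and inv_map_chart [simp]: "p \<in> dom_chart c \<Longrightarrow> inv_chart c (map_chart c p) = p"
    and map_inv_chart: "y \<in> map_chart c ` dom_chart c \<Longrightarrow> map_chart c (inv_chart c y) = y"
    and inv_chart_in: "y \<in> map_chart c ` dom_chart c \<Longrightarrow> inv_chart c y \<in> dom_chart c"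
    and continuous_map_chart: "continuous_on (dom_chart c) (map_chart c)"
    and continuous_inv_chart: "continuous_on (map_chart c ` dom_chart c) (inv_chart c)"
  using max_atlas_is_chart[OF assms] by (auto simp: is_chart_def homeomorphism_def)

lemma chart_image_eq:
  assumes "c \<in> max_atlas A"
  shows "map_chart c ` (dom_chart c \<inter> U) = map_chart c ` dom_chart c \<inter> inv_chart c -` U"
  using assms by auto

lemma open_chart_image:
  assumes "c \<in> max_atlas A" "open U"
  shows "open (map_chart c ` (dom_chart c \<inter> U))"
  unfolding chart_image_eq[OF assms(1)]
  by (intro continuous_open_preimage continuous_inv_chart open_image_chart assms)

text \<open>The local version of \<open>Cinf\<close>. Coordinate maps, components of vector fields and transition maps only make sense on
the domain of a chart, and are vector valued.\<close>

definition smooth_in :: "'m set \<Rightarrow> ('m \<Rightarrow> 'b::euclidean_space) \<Rightarrow> bool" where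
  "smooth_in U f \<longleftrightarrow> (\<forall>c\<in>A. smooth_on (map_chart c ` (dom_chart c \<inter> U)) (f \<circ> inv_chart c))"

lemma Cinf_iff_smooth_in: "f \<in> Cinf A \<longleftrightarrow> smooth_in UNIV f"
  by (simp add: Cinf_def smooth_in_def)

lemma smooth_on_change_chart:
  assumes c: "c \<in> max_atlas A" and d: "d \<in> max_atlas A" and "compatible c d" and U: "open U"
    and f: "smooth_on (map_chart d ` (dom_chart d \<inter> U)) (f \<circ> inv_chart d)"
  shows "smooth_on (map_chart c ` (dom_chart c \<inter> dom_chart d \<inter> U)) (f \<circ> inv_chart c)"
proof -
  let ?V = "map_chart c ` (dom_chart c \<inter> dom_chart d \<inter> U)"
  have oV: "open ?V"
    using open_chart_image[OF c, of "dom_chart d \<inter> U"] U open_dom_chart[OF d] by (simp add: Int_assoc open_Int)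
  have "smooth_on ?V (\<lambda>x. (f \<circ> inv_chart d) ((map_chart d \<circ> inv_chart c) x))"
  proof (rule smooth_on_compose[OF oV open_chart_image[OF d U] f])
    show "smooth_on ?V (map_chart d \<circ> inv_chart c)"
      by (rule smooth_on_subset[of "map_chart c ` (dom_chart c \<inter> dom_chart d)"])
        (use assms(3) in \<open>auto simp: compatible_def\<close>)
    show "(map_chart d \<circ> inv_chart c) ` ?V \<subseteq> map_chart d ` (dom_chart d \<inter> U)" using c by auto
  qed
  then show ?thesis
    by (rule iffD1[OF smooth_on_cong[OF oV], rotated]) (use c d in auto)
qed

lemma max_atlas_compatible: "c \<in> max_atlas A \<Longrightarrow> d \<in> A \<Longrightarrow> compatible c d \<and> compatible d c"
  by (auto simp: max_atlas_def compatible_def Int_commute)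

text \<open>Smoothness, defined with the charts of the given atlas, may be used and tested in every chart of the maximal
atlas; the slice charts of a hypersurface are only known to belong to the latter.\<close>

lemma smooth_in_chartD:
  assumes f: "smooth_in U f" and U: "open U" and c: "c \<in> max_atlas A"
  shows "smooth_on (map_chart c ` (dom_chart c \<inter> U)) (f \<circ> inv_chart c)"
proof (rule smooth_on_local)
  fix x assume "x \<in> map_chart c ` (dom_chart c \<inter> U)"
  then obtain p where p: "p \<in> dom_chart c \<inter> U" "x = map_chart c p" by auto
  obtain a where a: "a \<in> A" "p \<in> dom_chart a" using atlas_covers by metis
  note am = atlas_le_max_atlas[OF a(1)]
  have "smooth_on (map_chart c ` (dom_chart c \<inter> dom_chart a \<inter> U)) (f \<circ> inv_chart c)"
    using f a max_atlas_compatible[OF c a(1)] by (intro smooth_on_change_chart c am U) (auto simp: smooth_in_def)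
  moreover have "open (map_chart c ` (dom_chart c \<inter> (dom_chart a \<inter> U)))"
    by (intro open_chart_image c open_Int U open_dom_chart am)
  ultimately show "\<exists>V. open V \<and> x \<in> V \<and> smooth_on V (f \<circ> inv_chart c)"
    using p a by (intro exI[of _ "map_chart c ` (dom_chart c \<inter> dom_chart a \<inter> U)"]) (auto simp: Int_assoc)
qed

lemma smooth_in_chartI:
  assumes c: "c \<in> max_atlas A" and U: "open U" "U \<subseteq> dom_chart c"
    and f: "smooth_on (map_chart c ` U) (f \<circ> inv_chart c)"
  shows "smooth_in U f"
  unfolding smooth_in_def
proof
  fix a assume a: "a \<in> A"
  have "smooth_on (map_chart a ` (dom_chart a \<inter> dom_chart c \<inter> U)) (f \<circ> inv_chart a)"
    using f U max_atlas_compatible[OF c a]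
    by (intro smooth_on_change_chart c atlas_le_max_atlas[OF a]) (auto simp: Int_absorb1)
  moreover have "dom_chart a \<inter> dom_chart c \<inter> U = dom_chart a \<inter> U" using U by auto
  ultimately show "smooth_on (map_chart a ` (dom_chart a \<inter> U)) (f \<circ> inv_chart a)" by simp
qed

lemma smooth_in_local:
  assumes "\<And>p. p \<in> U \<Longrightarrow> \<exists>V. open V \<and> p \<in> V \<and> smooth_in V f"
  shows "smooth_in U f"
  unfolding smooth_in_def
proof (intro ballI smooth_on_local)
  fix a x assume a: "a \<in> A" and "x \<in> map_chart a ` (dom_chart a \<inter> U)"
  then obtain p where p: "p \<in> dom_chart a" "p \<in> U" "x = map_chart a p" by auto
  obtain V where "open V" "p \<in> V" "smooth_in V f" using assms p by blast
  then show "\<exists>W. open W \<and> x \<in> W \<and> smooth_on W (f \<circ> inv_chart a)"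
    using a p open_chart_image[OF atlas_le_max_atlas[OF a], of V]
    by (intro exI[of _ "map_chart a ` (dom_chart a \<inter> V)"]) (auto simp: smooth_in_def)
qed

lemma smooth_in_subset: "smooth_in U f \<Longrightarrow> V \<subseteq> U \<Longrightarrow> smooth_in V f"
  unfolding smooth_in_def by (meson Int_mono image_mono order_refl smooth_on_subset)

lemma smooth_in_cong:
  assumes "open U" "\<And>p. p \<in> U \<Longrightarrow> f p = h p" "smooth_in U f"
  shows "smooth_in U h"
  unfolding smooth_in_def
proof
  fix a assume a: "a \<in> A"
  note m = atlas_le_max_atlas[OF a]
  show "smooth_on (map_chart a ` (dom_chart a \<inter> U)) (h \<circ> inv_chart a)"
    by (rule iffD1[OF smooth_on_cong[OF open_chart_image[OF m assms(1)], of "f \<circ> inv_chart a"]])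
      (use m assms a in \<open>auto simp: smooth_in_def\<close>)
qed

lemma smooth_in_const: "open U \<Longrightarrow> smooth_in U (\<lambda>_. k)"
  unfolding smooth_in_def o_def
  by (intro ballI smooth_on_const open_chart_image atlas_le_max_atlas)

lemma smooth_in_add:
  "open U \<Longrightarrow> smooth_in U f \<Longrightarrow> smooth_in U h \<Longrightarrow> smooth_in U (\<lambda>p. f p + h p)"
  unfolding smooth_in_def o_def by (intro ballI smooth_on_add open_chart_image atlas_le_max_atlas) auto

lemma smooth_in_mult:
  "open U \<Longrightarrow> smooth_in U f \<Longrightarrow> smooth_in U h \<Longrightarrow> smooth_in U (\<lambda>p. f p * h p :: real)"
  unfolding smooth_in_def o_def by (intro ballI smooth_on_mult open_chart_image atlas_le_max_atlas) auto

lemma smooth_in_inner: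
  "open U \<Longrightarrow> smooth_in U f \<Longrightarrow> smooth_in U h \<Longrightarrow> smooth_in U (\<lambda>p. f p \<bullet> h p)"
  unfolding smooth_in_def o_def by (intro ballI smooth_on_inner open_chart_image atlas_le_max_atlas) auto

lemma smooth_in_map_chart:
  assumes "c \<in> max_atlas A" shows "smooth_in (dom_chart c) (map_chart c)"
proof (rule smooth_in_chartI[OF assms open_dom_chart[OF assms] order_refl])
  note o = open_image_chart[OF assms]
  show "smooth_on (map_chart c ` dom_chart c) (map_chart c \<circ> inv_chart c)"
    by (rule iffD1[OF smooth_on_cong[OF o] smooth_on_linear[OF bounded_linear_ident o]])
      (use assms in auto)
qed

lemma smooth_in_continuous_on:
  assumes "smooth_in U f" "open U"
  shows "continuous_on U f"
proof -
  have "isCont f p" if "p \<in> U" for p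
  proof -
    obtain a where a: "a \<in> A" "p \<in> dom_chart a" using atlas_covers by metis
    note m = atlas_le_max_atlas[OF a(1)]
    let ?V = "dom_chart a \<inter> U"
    have 1: "continuous_on (map_chart a ` ?V) (f \<circ> inv_chart a)"
      using assms(1) a(1) by (intro smooth_on_continuous_on) (simp add: smooth_in_def)
    have 2: "continuous_on ?V (map_chart a)"
      by (rule continuous_on_subset[OF continuous_map_chart[OF m]]) auto
    have "continuous_on ?V (\<lambda>q. (f \<circ> inv_chart a) (map_chart a q))"
      by (rule continuous_on_compose2[OF 1 2]) auto
    then have "continuous_on ?V f" by (rule continuous_on_cong[THEN iffD1, rotated 2]) (use m in auto)
    then show ?thesis
      using a that assms open_dom_chart[OF m] by (simp add: continuous_on_eq_continuous_at open_Int)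
  qed
  then show ?thesis by (simp add: continuous_at_imp_continuous_on)
qed

lemma Cinf_const [simp, intro]: "(\<lambda>_. k) \<in> Cinf A"
  unfolding Cinf_iff_smooth_in by (rule smooth_in_const) simp

lemma Cinf_0 [simp, intro]: "0 \<in> Cinf A"
  unfolding zero_fun_def by (rule Cinf_const)

lemma Cinf_add [intro]: "f \<in> Cinf A \<Longrightarrow> h \<in> Cinf A \<Longrightarrow> f + h \<in> Cinf A"
  unfolding Cinf_iff_smooth_in plus_fun_def by (rule smooth_in_add) simp

lemma Cinf_mult [intro]: "f \<in> Cinf A \<Longrightarrow> h \<in> Cinf A \<Longrightarrow> f * h \<in> Cinf A"
  unfolding Cinf_iff_smooth_in times_fun_def by (rule smooth_in_mult) simp

lemma Cinf_scale [intro]: "f \<in> Cinf A \<Longrightarrow> (\<lambda>x. a * f x) \<in> Cinf A"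
  using Cinf_mult[of "\<lambda>_. a" f] by (simp add: times_fun_def)

lemma Cinf_add' [intro]: "f \<in> Cinf A \<Longrightarrow> h \<in> Cinf A \<Longrightarrow> (\<lambda>x. f x + h x) \<in> Cinf A"
  and Cinf_mult' [intro]: "f \<in> Cinf A \<Longrightarrow> h \<in> Cinf A \<Longrightarrow> (\<lambda>x. f x * h x) \<in> Cinf A"
  using Cinf_add[of f h] Cinf_mult[of f h] by (auto simp: plus_fun_def times_fun_def)

lemma Cinf_uminus' [intro]: "f \<in> Cinf A \<Longrightarrow> (\<lambda>x. - f x) \<in> Cinf A"
  using Cinf_scale[of f "-1"] by simp

lemma Cinf_diff' [intro]: "f \<in> Cinf A \<Longrightarrow> h \<in> Cinf A \<Longrightarrow> (\<lambda>x. f x - h x) \<in> Cinf A"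
  using Cinf_add'[OF _ Cinf_uminus'[of h], of f] by simp

lemma Cinf_diff [intro]: "f \<in> Cinf A \<Longrightarrow> h \<in> Cinf A \<Longrightarrow> f - h \<in> Cinf A"
  using Cinf_diff'[of f h] by (simp add: fun_diff_def)

lemma Cinf_sum': "(\<And>i. i \<in> I \<Longrightarrow> f i \<in> Cinf A) \<Longrightarrow> (\<lambda>x. \<Sum>i\<in>I. f i x) \<in> Cinf A"
  by (induction I rule: infinite_finite_induct) auto

lemma Cinf_continuous_on: "f \<in> Cinf A \<Longrightarrow> continuous_on U f"
  using smooth_in_continuous_on[of UNIV f] continuous_on_subset[of UNIV f U] by (auto simp: Cinf_iff_smooth_in)

text \<open>The open sets \<open>U\<close> and \<open>- K\<close> cover the manifold, and \<open>f\<close> is smooth on each of them.\<close>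

lemma Cinf_extend_by_0:
  assumes "open U" "closed K" "K \<subseteq> U" "smooth_in U f" "\<And>q. q \<notin> K \<Longrightarrow> f q = 0"
  shows "f \<in> Cinf A"
  unfolding Cinf_iff_smooth_in
proof (rule smooth_in_local)
  fix p
  have "smooth_in (-K) f"
    by (rule smooth_in_cong[of _ "\<lambda>_. 0"]) (use assms smooth_in_const[of "-K" 0] in auto)
  then show "\<exists>V. open V \<and> p \<in> V \<and> smooth_in V f"
    using assms by (cases "p \<in> K") (blast, intro exI[of _ "-K"], auto)
qed

lemma manifold_bump:
  assumes "open U" "p \<in> U"
  obtains \<beta> V K where "\<beta> \<in> Cinf A" "open V" "p \<in> V" "V \<subseteq> K" "compact K" "K \<subseteq> U" "\<And>q. q \<in> V \<Longrightarrow> \<beta> q = 1"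
    "\<And>q. q \<notin> K \<Longrightarrow> \<beta> q = 0" "\<And>q. 0 \<le> \<beta> q" "\<And>q. \<beta> q \<le> 1"
proof -
  obtain a where a: "a \<in> A" "p \<in> dom_chart a" using atlas_covers by metis
  note m = atlas_le_max_atlas[OF a(1)]
  let ?W = "map_chart a ` (dom_chart a \<inter> U)"
  have "open ?W" "map_chart a p \<in> ?W" using open_chart_image[OF m assms(1)] a assms by auto
  then obtain e where e: "e > 0" "cball (map_chart a p) e \<subseteq> ?W" using open_contains_cball by blast
  define r where "r = e / 2"
  have r: "r > 0" "cball (map_chart a p) (2*r) \<subseteq> ?W" using e by (auto simp: r_def)
  obtain B :: "'e \<Rightarrow> real" where B: "smooth_on UNIV B" "\<And>x. 0 \<le> B x" "\<And>x. B x \<le> 1"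
    "\<And>x. dist x (map_chart a p) \<le> r \<Longrightarrow> B x = 1" "\<And>x. dist x (map_chart a p) \<ge> 2 * r \<Longrightarrow> B x = 0"
    by (rule smooth_bump[OF r(1), of "map_chart a p"]) blast
  define \<beta> where "\<beta> q = (if q \<in> dom_chart a then B (map_chart a q) else 0)" for q
  define K where "K = inv_chart a ` cball (map_chart a p) (2*r)"
  define V where "V = dom_chart a \<inter> map_chart a -` ball (map_chart a p) r"
  have sub: "cball (map_chart a p) (2*r) \<subseteq> map_chart a ` dom_chart a" using r(2) by auto
  have K: "compact K" unfolding K_def
    by (intro compact_continuous_image compact_cball continuous_on_subset[OF continuous_inv_chart[OF m] sub])
  have inK: "q \<in> K" if "q \<in> dom_chart a" "dist (map_chart a q) (map_chart a p) \<le> 2 * r" for q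
    unfolding K_def using that m by (intro image_eqI[of _ _ "map_chart a q"]) (auto simp: dist_commute)
  have "K \<subseteq> inv_chart a ` ?W" unfolding K_def by (rule image_mono[OF r(2)])
  also have "\<dots> \<subseteq> dom_chart a \<inter> U" using m by auto
  finally have "K \<subseteq> dom_chart a \<inter> U" .
  then have KU: "K \<subseteq> dom_chart a" "K \<subseteq> U" by auto
  have \<beta>0: "\<beta> q = 0" if "q \<notin> K" for q
    using that inK[of q] B(5)[of "map_chart a q"] unfolding \<beta>_def by (metis linear)
  have "smooth_in (dom_chart a) \<beta>"
  proof (rule smooth_in_chartI[OF m open_dom_chart[OF m] order_refl])
    show "smooth_on (map_chart a ` dom_chart a) (\<beta> \<circ> inv_chart a)"
      by (rule iffD1[OF smooth_on_cong[OF open_image_chart[OF m]] smooth_on_subset[OF B(1)]])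
        (use m in \<open>auto simp: \<beta>_def\<close>)
  qed
  then have "\<beta> \<in> Cinf A"
    by (rule Cinf_extend_by_0[OF open_dom_chart[OF m] compact_imp_closed[OF K] KU(1)]) (use \<beta>0 in auto)
  moreover have "open V" unfolding V_def
    by (intro continuous_open_preimage continuous_map_chart m open_dom_chart open_ball)
  moreover have "V \<subseteq> K" using inK r(1) by (auto simp: V_def dist_commute)
  moreover have "p \<in> V" using a r by (simp add: V_def)
  moreover have "\<beta> q = 1" if "q \<in> V" for q using that B(4) by (auto simp: \<beta>_def V_def dist_commute)
  ultimately show ?thesis using K KU \<beta>0 B by (intro that[of \<beta> V K]) (auto simp: \<beta>_def)
qed

end

section \<open>Tangent vectors and vector fields in coordinates\<close>

lemma sum_fun_apply: "(\<Sum>i\<in>I. F i) x = (\<Sum>i\<in>I. F i x)"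
  by (induction I rule: infinite_finite_induct) auto

lemma vscale_apply [simp]: "(a \<cdot>\<^sub>v v) f = a * v f" by (simp add: vscale_def)

lemma fscale_apply [simp]: "(f \<cdot>\<^sub>f X) p = f p \<cdot>\<^sub>v X p" by (simp add: fscale_def)

lemma vscale_simps [simp]:
  "0 \<cdot>\<^sub>v v = 0" "1 \<cdot>\<^sub>v v = v" "a \<cdot>\<^sub>v (0 :: 'm tvec) = 0" "a \<cdot>\<^sub>v b \<cdot>\<^sub>v v = (a * b) \<cdot>\<^sub>v v" "(-1) \<cdot>\<^sub>v v = - v"
  by (auto simp: fun_eq_iff)

lemma vscale_algebra:
  "a \<cdot>\<^sub>v (u + v) = a \<cdot>\<^sub>v u + a \<cdot>\<^sub>v v" "(a + b) \<cdot>\<^sub>v v = a \<cdot>\<^sub>v v + b \<cdot>\<^sub>v v"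
  "a \<cdot>\<^sub>v (u - v) = a \<cdot>\<^sub>v u - a \<cdot>\<^sub>v v" "a \<cdot>\<^sub>v (- v) = (-a) \<cdot>\<^sub>v v"
  by (auto simp: fun_eq_iff algebra_simps)

lemma vscale_sum: "a \<cdot>\<^sub>v (\<Sum>i\<in>I. F i) = (\<Sum>i\<in>I. a \<cdot>\<^sub>v F i)"
  by (simp add: fun_eq_iff sum_fun_apply sum_distrib_left)

context manifold begin

abbreviation "T \<equiv> tangent_space A"
abbreviation "VF \<equiv> vector_fields A"

lemma
  assumes "v \<in> T p"
  shows tangent_add: "f \<in> Cinf A \<Longrightarrow> h \<in> Cinf A \<Longrightarrow> v (f + h) = v f + v h"
    and tangent_scale: "f \<in> Cinf A \<Longrightarrow> v (\<lambda>x. a * f x) = a * v f"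
    and tangent_mult: "f \<in> Cinf A \<Longrightarrow> h \<in> Cinf A \<Longrightarrow> v (f * h) = v f * h p + f p * v h"
    and tangent_outside: "f \<notin> Cinf A \<Longrightarrow> v f = 0"
  using assms by (auto simp: tangent_space_def)

lemma tangent_zero_in [simp, intro]: "0 \<in> T p" by (simp add: tangent_space_def)

lemma tangent_add_in [simp, intro]: "u \<in> T p \<Longrightarrow> v \<in> T p \<Longrightarrow> u + v \<in> T p"
  by (simp add: tangent_space_def algebra_simps)

lemma tangent_scale_in [simp, intro]: "v \<in> T p \<Longrightarrow> a \<cdot>\<^sub>v v \<in> T p"
  by (simp add: tangent_space_def algebra_simps)

lemma tangent_uminus_in [simp, intro]: "v \<in> T p \<Longrightarrow> - v \<in> T p"
  using tangent_scale_in[of v p "-1"] by simp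

lemma tangent_diff_in [simp, intro]: "u \<in> T p \<Longrightarrow> v \<in> T p \<Longrightarrow> u - v \<in> T p"
  using tangent_add_in[of u p "- v"] by simp

lemma tangent_sum_in: "(\<And>i. i \<in> I \<Longrightarrow> F i \<in> T p) \<Longrightarrow> (\<Sum>i\<in>I. F i) \<in> T p"
  by (induction I rule: infinite_finite_induct) auto

lemma tangent_of_const [simp]: assumes "v \<in> T p" shows "v (\<lambda>_. k) = 0"
proof -
  have "v ((\<lambda>_. 1) * (\<lambda>_. 1)) = v (\<lambda>_. 1) * 1 + 1 * v (\<lambda>_. 1)"
    using tangent_mult[OF assms, of "\<lambda>_. 1" "\<lambda>_. 1"] by auto
  then have "v (\<lambda>_. 1) = 0" by (simp add: times_fun_def)
  then show ?thesis using tangent_scale[OF assms, of "\<lambda>_. 1" k] by simp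
qed

lemma tangent_of_0 [simp]: "v \<in> T p \<Longrightarrow> v 0 = 0"
  by (simp add: zero_fun_def)

lemma tangent_diff:
  assumes "v \<in> T p" "f \<in> Cinf A" "h \<in> Cinf A" shows "v (f - h) = v f - v h"
proof -
  have eq: "f - h = f + (\<lambda>x. (-1) * h x)" by (auto simp: fun_eq_iff)
  show ?thesis unfolding eq
    using tangent_add[OF assms(1,2) Cinf_scale[OF assms(3), of "-1"]] tangent_scale[OF assms(1,3), of "-1"]
    by linarith
qed

lemma tangent_sum:
  assumes "v \<in> T p" shows "(\<And>i. i \<in> I \<Longrightarrow> f i \<in> Cinf A) \<Longrightarrow> v (\<lambda>x. \<Sum>i\<in>I. f i x) = (\<Sum>i\<in>I. v (f i))"
proof (induction I rule: infinite_finite_induct)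
  case (insert i I)
  have "v (\<lambda>x. \<Sum>i\<in>insert i I. f i x) = v (f i + (\<lambda>x. \<Sum>i\<in>I. f i x))"
    using insert by (simp add: plus_fun_def)
  then show ?case using insert assms by (simp add: tangent_add Cinf_sum')
qed (use assms in auto)

text \<open>Membership in \<open>tangent_sub\<close> speaks of functions that vanish on all of \<open>S\<close>; multiplication by a bump function
extends it to functions that vanish on \<open>S\<close> near \<open>p\<close>.\<close>

lemma tangent_sub_eq_0:
  assumes "v \<in> tangent_sub A S p" "p \<in> S" "f \<in> Cinf A" "open V" "p \<in> V" "\<And>q. q \<in> V \<Longrightarrow> q \<in> S \<Longrightarrow> f q = 0"
  shows "v f = 0"
proof -
  obtain \<beta> W K where b: "\<beta> \<in> Cinf A" "open W" "p \<in> W" "K \<subseteq> V"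
    "\<And>q. q \<in> W \<Longrightarrow> \<beta> q = 1" "\<And>q. q \<notin> K \<Longrightarrow> \<beta> q = 0"
    using manifold_bump[OF assms(4,5)] by metis
  have v: "v \<in> T p" and *: "\<And>f. f \<in> Cinf A \<Longrightarrow> (\<forall>q\<in>S. f q = 0) \<Longrightarrow> v f = 0"
    using assms(1) by (auto simp: tangent_sub_def)
  have "v (\<beta> * f) = 0" using b assms(3,6) by (intro *) auto
  then show ?thesis using tangent_mult[OF v b(1) assms(3)] b assms by auto
qed

text \<open>Statements on locality along \<open>S\<close> thus contain those on locality in the manifold.\<close>

lemma tangent_sub_UNIV: "v \<in> T p \<Longrightarrow> v \<in> tangent_sub A UNIV p"
proof -
  assume v: "v \<in> T p"
  have "v f = 0" if "\<forall>q. f q = 0" for f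
  proof -
    have "f = 0" using that by (auto simp: fun_eq_iff)
    then show ?thesis using v by simp
  qed
  then show ?thesis using v by (simp add: tangent_sub_def)
qed

lemma tangent_sub_cong:
  assumes "v \<in> tangent_sub A S p" "p \<in> S" "f \<in> Cinf A" "h \<in> Cinf A" "open V" "p \<in> V"
    "\<And>q. q \<in> V \<Longrightarrow> q \<in> S \<Longrightarrow> f q = h q"
  shows "v f = v h"
proof -
  have "v (f - h) = 0"
    by (rule tangent_sub_eq_0[OF assms(1,2) _ assms(5,6)]) (use assms in auto)
  moreover have "v \<in> T p" using assms(1) by (simp add: tangent_sub_def)
  ultimately show ?thesis using tangent_diff[of v p f h] assms(3,4) by simp
qed

lemma tangent_local:
  assumes "v \<in> T p" "f \<in> Cinf A" "h \<in> Cinf A" "open V" "p \<in> V" "\<And>q. q \<in> V \<Longrightarrow> f q = h q"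
  shows "v f = v h"
  by (rule tangent_sub_cong[OF tangent_sub_UNIV[OF assms(1)] UNIV_I assms(2-5)]) (rule assms(6))

lemma VF_at: "X \<in> VF \<Longrightarrow> X p \<in> T p" by (simp add: vector_fields_def)

lemma VF_act [simp, intro]: "X \<in> VF \<Longrightarrow> f \<in> Cinf A \<Longrightarrow> act X f \<in> Cinf A" by (simp add: vector_fields_def)

lemma VF_act': "X \<in> VF \<Longrightarrow> f \<in> Cinf A \<Longrightarrow> (\<lambda>q. X q f) \<in> Cinf A"
  using VF_act[of X f] by (simp add: act_def)

lemma VF_I: "(\<And>p. X p \<in> T p) \<Longrightarrow> (\<And>f. f \<in> Cinf A \<Longrightarrow> (\<lambda>q. X q f) \<in> Cinf A) \<Longrightarrow> X \<in> VF"
  by (simp add: vector_fields_def act_def)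

lemma VF_0 [simp, intro]: "0 \<in> VF"
  by (rule VF_I) auto

lemma VF_add [simp, intro]: "X \<in> VF \<Longrightarrow> Y \<in> VF \<Longrightarrow> X + Y \<in> VF"
  by (rule VF_I) (simp_all add: VF_at VF_act' Cinf_add')

lemma VF_fscale [simp, intro]: "f \<in> Cinf A \<Longrightarrow> X \<in> VF \<Longrightarrow> f \<cdot>\<^sub>f X \<in> VF"
  by (rule VF_I) (simp_all add: VF_at VF_act' Cinf_mult')

lemma VF_sum: "(\<And>i. i \<in> I \<Longrightarrow> F i \<in> VF) \<Longrightarrow> (\<Sum>i\<in>I. F i) \<in> VF"
  by (induction I rule: infinite_finite_induct) auto

lemma fscale_const_minus_1: "(\<lambda>_. -1) \<cdot>\<^sub>f X = - X"
  by (auto simp: fun_eq_iff fscale_def)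

lemma VF_uminus [simp, intro]: "X \<in> VF \<Longrightarrow> - X \<in> VF"
  using VF_fscale[of "\<lambda>_. -1" X] by (simp add: fscale_const_minus_1)

lemma VF_diff [simp, intro]: "X \<in> VF \<Longrightarrow> Y \<in> VF \<Longrightarrow> X - Y \<in> VF"
  using VF_add[of X "- Y"] by simp

lemma act_mult: "X \<in> VF \<Longrightarrow> f \<in> Cinf A \<Longrightarrow> h \<in> Cinf A \<Longrightarrow> act X (f * h) = act X f * h + f * act X h"
  by (auto simp: act_def fun_eq_iff tangent_mult[OF VF_at])

lemma act_add: "X \<in> VF \<Longrightarrow> f \<in> Cinf A \<Longrightarrow> h \<in> Cinf A \<Longrightarrow> act X (f + h) = act X f + act X h"
  by (auto simp: act_def fun_eq_iff tangent_add[OF VF_at])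

lemma act_scale: "X \<in> VF \<Longrightarrow> f \<in> Cinf A \<Longrightarrow> act X (\<lambda>x. a * f x) = (\<lambda>x. a * act X f x)"
  by (auto simp: act_def fun_eq_iff tangent_scale[OF VF_at])

text \<open>The second derivatives in the product rule cancel. On functions that are not smooth the bracket is \<open>0\<close>, as required of
tangent vectors, because \<open>act X f\<close> is then the zero function.\<close>

lemma lie_bracket_VF [simp, intro]:
  assumes X: "X \<in> VF" and Y: "Y \<in> VF" shows "lie_bracket X Y \<in> VF"
proof (rule VF_I)
  fix p
  have Tp: "X p \<in> T p" "Y p \<in> T p" using X Y VF_at by auto
  show "lie_bracket X Y p \<in> T p"
    unfolding tangent_space_def lie_bracket_def
  proof (intro CollectI conjI ballI allI impI)
    fix f h assume fh: "f \<in> Cinf A" "h \<in> Cinf A"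
    show "X p (act Y (f + h)) - Y p (act X (f + h)) = X p (act Y f) - Y p (act X f) + (X p (act Y h) - Y p (act X h))"
      using fh X Y Tp by (simp add: act_add tangent_add)
    show "X p (act Y (f * h)) - Y p (act X (f * h)) =
      (X p (act Y f) - Y p (act X f)) * h p + f p * (X p (act Y h) - Y p (act X h))"
      using fh X Y Tp by (simp add: act_mult tangent_add[OF Tp(1)] tangent_add[OF Tp(2)]
          tangent_mult[OF Tp(1)] tangent_mult[OF Tp(2)] Cinf_mult) (simp add: act_def algebra_simps)
  next
    fix a f assume "f \<in> Cinf A"
    then show "X p (act Y (\<lambda>x. a * f x)) - Y p (act X (\<lambda>x. a * f x)) = a * (X p (act Y f) - Y p (act X f))"
      using X Y Tp by (simp add: act_scale tangent_scale[OF Tp(1)] tangent_scale[OF Tp(2)] algebra_simps)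
  next
    fix f assume "f \<notin> Cinf A"
    then have "act Y f = (\<lambda>_. 0)" "act X f = (\<lambda>_. 0)"
      using tangent_outside[OF VF_at[OF X]] tangent_outside[OF VF_at[OF Y]] by (auto simp: act_def fun_eq_iff)
    then show "X p (act Y f) - Y p (act X f) = 0" using Tp by simp
  qed
next
  fix f assume f: "f \<in> Cinf A"
  show "(\<lambda>q. lie_bracket X Y q f) \<in> Cinf A" unfolding lie_bracket_def
    by (rule Cinf_diff'[OF VF_act'[OF X VF_act[OF Y f]] VF_act'[OF Y VF_act[OF X f]]])
qed

lemma lie_bracket_minus: "lie_bracket X Y = - lie_bracket Y X"
  by (auto simp: lie_bracket_def fun_eq_iff)

subsection \<open>Coordinate vectors\<close>

text \<open>The coordinate vector with components \<open>w\<close>, that is \<open>\<Sum>\<^sub>i w\<^sub>i \<partial>\<^sub>i\<close> at \<open>p\<close>.\<close>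

definition pd :: "('m, 'e) chart \<Rightarrow> 'e \<Rightarrow> 'm \<Rightarrow> 'm tvec" where
  "pd c w p = (\<lambda>f. if f \<in> Cinf A then frechet_derivative (f \<circ> inv_chart c) (at (map_chart c p)) w else 0)"

lemma Cinf_chart_smooth: "f \<in> Cinf A \<Longrightarrow> c \<in> max_atlas A \<Longrightarrow> smooth_on (map_chart c ` dom_chart c) (f \<circ> inv_chart c)"
  using smooth_in_chartD[of UNIV f c] by (simp add: Cinf_iff_smooth_in)

lemma pd_has_derivative:
  assumes "f \<in> Cinf A" "c \<in> max_atlas A" "p \<in> dom_chart c"
  shows "((f \<circ> inv_chart c) has_derivative (\<lambda>w. pd c w p f)) (at (map_chart c p))"
  using smooth_on_has_derivative[OF Cinf_chart_smooth[OF assms(1,2)], of "map_chart c p"] assms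
  by (simp add: pd_def)

lemma pd_eqI:
  assumes "f \<in> Cinf A" "c \<in> max_atlas A" "p \<in> dom_chart c"
    and "((f \<circ> inv_chart c) has_derivative L) (at (map_chart c p))"
  shows "pd c w p f = L w"
  using has_derivative_unique[OF pd_has_derivative[OF assms(1-3)] assms(4)] by metis

lemma pd_tangent [intro]:
  assumes c: "c \<in> max_atlas A" and p: "p \<in> dom_chart c"
  shows "pd c w p \<in> T p"
  unfolding tangent_space_def
proof (intro CollectI conjI ballI allI impI)
  fix f h assume fh: "f \<in> Cinf A" "h \<in> Cinf A"
  note d = pd_has_derivative[OF fh(1) c p] pd_has_derivative[OF fh(2) c p]
  show "pd c w p (f + h) = pd c w p f + pd c w p h"
    by (rule pd_eqI[OF _ c p]) (use has_derivative_add[OF d] fh in \<open>auto simp: o_def\<close>)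
  show "pd c w p (f * h) = pd c w p f * h p + f p * pd c w p h"
    by (rule pd_eqI[OF _ c p])
      (use has_derivative_mult[OF d] fh c p in \<open>auto simp: o_def add.commute\<close>)
next
  fix a f assume f: "f \<in> Cinf A"
  show "pd c w p (\<lambda>x. a * f x) = a * pd c w p f"
    by (rule pd_eqI[OF _ c p])
     (use has_derivative_mult_right[OF pd_has_derivative[OF f c p], of a] f in \<open>auto simp: o_def\<close>)
qed (simp add: pd_def)

lemma
  assumes c: "c \<in> max_atlas A" and p: "p \<in> dom_chart c"
  shows pd_add: "pd c (v + w) p = pd c v p + pd c w p"
    and pd_scale: "pd c (a *\<^sub>R w) p = a \<cdot>\<^sub>v pd c w p"
    and pd_0: "pd c 0 p = 0"
proof -
  have lin: "linear (\<lambda>w. pd c w p f)" if "f \<in> Cinf A" for f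
    using has_derivative_linear[OF pd_has_derivative[OF that c p]] .
  have out: "pd c w p f = 0" if "f \<notin> Cinf A" for f w using that by (simp add: pd_def)
  show "pd c (v + w) p = pd c v p + pd c w p"
  proof
    fix f show "pd c (v + w) p f = (pd c v p + pd c w p) f"
      using linear_add[OF lin, of f v w] out[of f] by (cases "f \<in> Cinf A") auto
  qed
  show "pd c (a *\<^sub>R w) p = a \<cdot>\<^sub>v pd c w p"
  proof
    fix f show "pd c (a *\<^sub>R w) p f = (a \<cdot>\<^sub>v pd c w p) f"
      using linear_scale[OF lin, of f a w] out[of f] by (cases "f \<in> Cinf A") auto
  qed
  show "pd c 0 p = 0"
  proof
    fix f show "pd c 0 p f = 0 f"
      using linear_0[OF lin, of f] out[of f] by (cases "f \<in> Cinf A") auto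
  qed
qed

lemma pd_sum:
  assumes c: "c \<in> max_atlas A" and p: "p \<in> dom_chart c"
  shows "pd c (\<Sum>i\<in>I. a i *\<^sub>R w i) p = (\<Sum>i\<in>I. a i \<cdot>\<^sub>v pd c (w i) p)"
  by (induction I rule: infinite_finite_induct) (auto simp: pd_0[OF assms] pd_add[OF assms] pd_scale[OF assms])

lemma pd_smooth_in:
  assumes c: "c \<in> max_atlas A" and f: "f \<in> Cinf A"
  shows "smooth_in (dom_chart c) (\<lambda>p. pd c w p f)"
proof (rule smooth_in_chartI[OF c open_dom_chart[OF c] order_refl])
  show "smooth_on (map_chart c ` dom_chart c) ((\<lambda>p. pd c w p f) \<circ> inv_chart c)"
    by (rule iffD1[OF smooth_on_cong[OF open_image_chart[OF c]]
        smooth_on_frechet_derivative[OF Cinf_chart_smooth[OF f c], of w]])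
      (use c f in \<open>auto simp: pd_def\<close>)
qed

lemma pd_coordinate:
  assumes c: "c \<in> max_atlas A" and x: "x \<in> Cinf A" and V: "open V" "V \<subseteq> dom_chart c" "q \<in> V"
    and eq: "\<And>q. q \<in> V \<Longrightarrow> x q = map_chart c q \<bullet> i"
  shows "pd c w q x = w \<bullet> i"
proof -
  have "((\<lambda>y. y \<bullet> i) has_derivative (\<lambda>w. w \<bullet> i)) (at (map_chart c q))"
    by (auto intro!: derivative_eq_intros)
  moreover have "open (map_chart c ` V)" using open_chart_image[OF c V(1)] V(2) by (simp add: Int_absorb1)
  ultimately have "((x \<circ> inv_chart c) has_derivative (\<lambda>w. w \<bullet> i)) (at (map_chart c q))"
    by (rule has_derivative_transform_within_open[of _ _ _ UNIV "map_chart c ` V"])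
      (use V c eq in \<open>auto simp: subset_iff\<close>)
  then show ?thesis using V by (intro pd_eqI x c) auto
qed

lemma extend_VF_by_0:
  assumes "open U" "compact K" "K \<subseteq> U" "\<And>p. p \<in> U \<Longrightarrow> X p \<in> T p"
    "\<And>f. f \<in> Cinf A \<Longrightarrow> smooth_in U (\<lambda>p. X p f)" "\<beta> \<in> Cinf A" "\<And>q. q \<notin> K \<Longrightarrow> \<beta> q = 0"
  shows "(\<lambda>p. if p \<in> U then \<beta> p \<cdot>\<^sub>v X p else 0) \<in> VF"
proof (rule VF_I)
  fix f assume f: "f \<in> Cinf A"
  have "smooth_in U (\<lambda>p. \<beta> p * X p f)"
    using assms f by (intro smooth_in_mult) (auto simp: Cinf_iff_smooth_in intro: smooth_in_subset[of UNIV])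
  then have "smooth_in U (\<lambda>q. (if q \<in> U then \<beta> q \<cdot>\<^sub>v X q else 0) f)"
    by (rule smooth_in_cong[OF assms(1), rotated]) auto
  then show "(\<lambda>q. (if q \<in> U then \<beta> q \<cdot>\<^sub>v X q else 0) f) \<in> Cinf A"
    using assms by (intro Cinf_extend_by_0[OF assms(1) compact_imp_closed[OF assms(2)] assms(3)]) auto
qed (use assms in auto)

text \<open>Near any point of a chart, coordinates and coordinate fields are restrictions of global ones.\<close>

definition local_frame :: "('m, 'e) chart \<Rightarrow> 'm set \<Rightarrow> ('e \<Rightarrow> 'm \<Rightarrow> real) \<Rightarrow> ('e \<Rightarrow> 'm vfield) \<Rightarrow> bool" where
  "local_frame c V x F \<longleftrightarrow> c \<in> max_atlas A \<and> open V \<and> V \<subseteq> dom_chart c \<and>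
     (\<forall>i. x i \<in> Cinf A \<and> (\<forall>q\<in>V. x i q = map_chart c q \<bullet> i)) \<and>
     (\<forall>w. F w \<in> VF \<and> (\<forall>q\<in>V. F w q = pd c w q))"

lemma local_frame_exists:
  assumes c: "c \<in> max_atlas A" and p: "p \<in> dom_chart c" and U: "open U" "p \<in> U"
  obtains V x F where "local_frame c V x F" "p \<in> V" "V \<subseteq> U"
proof -
  have o: "open (dom_chart c)" using open_dom_chart[OF c] .
  obtain \<beta> V K where b: "\<beta> \<in> Cinf A" "open V" "p \<in> V" "V \<subseteq> K" "compact K" "K \<subseteq> dom_chart c \<inter> U"
    "\<And>q. q \<in> V \<Longrightarrow> \<beta> q = 1" "\<And>q. q \<notin> K \<Longrightarrow> \<beta> q = 0"
    using manifold_bump[of "dom_chart c \<inter> U" p] p o U by (metis IntI open_Int)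
  have K: "K \<subseteq> dom_chart c" using b by auto
  define F where "F w q = (if q \<in> dom_chart c then \<beta> q \<cdot>\<^sub>v pd c w q else 0)" for w q
  define x where "x i q = (\<beta> q * (map_chart c q \<bullet> i))" for i q
  have "F w \<in> VF" for w
    using extend_VF_by_0[OF o b(5) K, of "pd c w" \<beta>] b c pd_smooth_in[OF c] 
    by (auto simp: F_def[abs_def])
  moreover have "x i \<in> Cinf A" for i
  proof (rule Cinf_extend_by_0[OF o compact_imp_closed[OF b(5)] K])
    have "smooth_in (dom_chart c) \<beta>" using b by (auto simp: Cinf_iff_smooth_in intro: smooth_in_subset[of UNIV])
    then show "smooth_in (dom_chart c) (x i)" unfolding x_def[abs_def]
      by (intro smooth_in_mult smooth_in_inner smooth_in_map_chart c smooth_in_const o)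
  qed (use b in \<open>auto simp: x_def\<close>)
  ultimately have "local_frame c V x F"
    using b c by (auto simp: local_frame_def F_def x_def)
  then show ?thesis using that b by blast
qed

lemma
  assumes "local_frame c V x F"
  shows local_frame_chart: "c \<in> max_atlas A" "open V" "V \<subseteq> dom_chart c" "q \<in> V \<Longrightarrow> q \<in> dom_chart c"
    and local_frame_Cinf [simp]: "x i \<in> Cinf A" and local_frame_VF [simp]: "F w \<in> VF"
    and local_frame_x: "q \<in> V \<Longrightarrow> x i q = map_chart c q \<bullet> i"
    and local_frame_F: "q \<in> V \<Longrightarrow> F w q = pd c w q"
  using assms by (auto simp: local_frame_def)

lemma local_frame_pd_x:
  assumes "local_frame c V x F" "q \<in> V" shows "pd c w q (x i) = w \<bullet> i"
  using local_frame_chart[OF assms(1)] local_frame_x[OF assms(1)] assms(2) local_frame_Cinf[OF assms(1)]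
  by (intro pd_coordinate[where V=V])

text \<open>The brackets of coordinate fields annihilate the coordinate functions, since the fields have constant components.\<close>

lemma local_frame_commute:
  assumes lf: "local_frame c V x F" and q: "q \<in> V"
  shows "lie_bracket (F v) (F w) q (x i) = 0"
proof -
  note F = local_frame_F[OF lf] note VF = local_frame_VF[OF lf]
  have "act (F w) (x i) q' = w \<bullet> i" if "q' \<in> V" for w q'
    using F[OF that] local_frame_pd_x[OF lf that] by (simp add: act_def)
  then have "F v q (act (F w) (x i)) = F v q (\<lambda>_. w \<bullet> i)" for v w
    using q by (intro tangent_local[OF VF_at[OF VF] VF_act[OF VF local_frame_Cinf[OF lf]] _
          local_frame_chart(2)[OF lf]]) auto
  then show ?thesis by (simp add: lie_bracket_def tangent_of_const[OF VF_at[OF VF]])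
qed

end

section \<open>Lorentzian linear algebra on tangent spaces\<close>

locale lorentz = manifold A
  for A :: "('m::{t2_space, second_countable_topology}, 'e::euclidean_space) chart set" +
  fixes g :: "'m metric"
  assumes metric: "lorentzian_metric A g"
begin

lemma g_sym: "u \<in> T p \<Longrightarrow> v \<in> T p \<Longrightarrow> g p u v = g p v u"
  using metric[unfolded lorentzian_metric_def, THEN conjunct1] by blast

lemma g_lin: "u \<in> T p \<Longrightarrow> v \<in> T p \<Longrightarrow> w \<in> T p \<Longrightarrow> g p (a \<cdot>\<^sub>v u + v) w = a * g p u w + g p v w"
  using metric[unfolded lorentzian_metric_def, THEN conjunct2, THEN conjunct1] by blast

lemma g_Cinf [simp, intro]: "X \<in> VF \<Longrightarrow> Y \<in> VF \<Longrightarrow> (\<lambda>p. g p (X p) (Y p)) \<in> Cinf A"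
  using metric unfolding lorentzian_metric_def by blast

lemma g_add_left: "u \<in> T p \<Longrightarrow> v \<in> T p \<Longrightarrow> w \<in> T p \<Longrightarrow> g p (u + v) w = g p u w + g p v w"
  using g_lin[of u p v w 1] by simp

lemma g_0_left: "w \<in> T p \<Longrightarrow> g p 0 w = 0"
  using g_lin[of 0 p 0 w 1] by simp

lemma g_scale_left: "u \<in> T p \<Longrightarrow> w \<in> T p \<Longrightarrow> g p (a \<cdot>\<^sub>v u) w = a * g p u w"
  using g_lin[of u p 0 w a] g_0_left by simp

lemma g_uminus_left: "u \<in> T p \<Longrightarrow> w \<in> T p \<Longrightarrow> g p (- u) w = - g p u w"
  using g_scale_left[of u p w "-1"] by simp

lemma g_diff_left: "u \<in> T p \<Longrightarrow> v \<in> T p \<Longrightarrow> w \<in> T p \<Longrightarrow> g p (u - v) w = g p u w - g p v w"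
  using g_add_left[of u p "-v" w] g_uminus_left[of v p w] by simp

lemma g_sum_left: "(\<And>i. i \<in> I \<Longrightarrow> F i \<in> T p) \<Longrightarrow> w \<in> T p \<Longrightarrow> g p (\<Sum>i\<in>I. F i) w = (\<Sum>i\<in>I. g p (F i) w)"
  by (induction I rule: infinite_finite_induct) (auto simp: g_0_left g_add_left tangent_sum_in)

lemma g_add_right: "u \<in> T p \<Longrightarrow> v \<in> T p \<Longrightarrow> w \<in> T p \<Longrightarrow> g p w (u + v) = g p w u + g p w v"
  and g_0_right: "w \<in> T p \<Longrightarrow> g p w 0 = 0"
  and g_scale_right: "u \<in> T p \<Longrightarrow> w \<in> T p \<Longrightarrow> g p w (a \<cdot>\<^sub>v u) = a * g p w u"
  and g_uminus_right: "u \<in> T p \<Longrightarrow> w \<in> T p \<Longrightarrow> g p w (- u) = - g p w u"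
  and g_diff_right: "u \<in> T p \<Longrightarrow> v \<in> T p \<Longrightarrow> w \<in> T p \<Longrightarrow> g p w (u - v) = g p w u - g p w v"
  using g_sym[of w p] g_add_left[of u p v w] g_0_left[of w p] g_scale_left[of u p w a]
    g_uminus_left[of u p w] g_diff_left[of u p v w] by auto

lemmas g_left = g_add_left g_0_left g_scale_left g_uminus_left g_diff_left
lemmas g_right = g_add_right g_0_right g_scale_right g_uminus_right g_diff_right

text \<open>The coefficients are found by pairing with the basis vectors; the squares of the signs are \<open>1\<close>.\<close>

lemma orthonormal_expansion:
  assumes e: "orthonormal_basis (g p) W k e" and W: "W \<subseteq> T p" and v: "v \<in> W"
  shows "v = (\<Sum>i<k. (g p (e i) (e i) * g p v (e i)) \<cdot>\<^sub>v e i)"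
proof -
  obtain a where a: "v = (\<Sum>i<k. a i \<cdot>\<^sub>v e i)" using e v by (auto simp: orthonormal_basis_def)
  have eT: "e i \<in> T p" if "i < k" for i using e W that by (auto simp: orthonormal_basis_def)
  have "g p (e j) (e j) * g p v (e j) = a j" if j: "j < k" for j
  proof -
    have "g p v (e j) = (\<Sum>i<k. a i * g p (e i) (e j))"
      unfolding a using eT j by (subst g_sum_left) (auto simp: g_scale_left)
    also have "\<dots> = (\<Sum>i<k. if i = j then a j * g p (e j) (e j) else 0)"
      using e j by (intro sum.cong) (auto simp: orthonormal_basis_def)
    finally have "g p v (e j) = a j * g p (e j) (e j)" using j by simp
    moreover have "g p (e j) (e j) * g p (e j) (e j) = 1" using e j by (auto simp: orthonormal_basis_def)
    ultimately show ?thesis by (simp add: algebra_simps)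
  qed
  then have "(\<Sum>i<k. (g p (e i) (e i) * g p v (e i)) \<cdot>\<^sub>v e i) = (\<Sum>i<k. a i \<cdot>\<^sub>v e i)"
    by (intro sum.cong) auto
  then show ?thesis using a by simp
qed

text \<open>The basis that is chosen in the definition of the Ricci tensor.\<close>

definition "tangent_onb p = (SOME e. orthonormal_basis (g p) (T p) DIM('e) e)"

lemma lorentz_basis: obtains e where "orthonormal_basis (g p) (T p) DIM('e) e" "g p (e 0) (e 0) = -1"
    "\<And>i. 0 < i \<Longrightarrow> i < DIM('e) \<Longrightarrow> g p (e i) (e i) = 1"
  using metric unfolding lorentzian_metric_def by metis

lemma tangent_onb: "orthonormal_basis (g p) (T p) DIM('e) (tangent_onb p)"
  unfolding tangent_onb_def using lorentz_basis[of p] by (metis someI_ex)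

lemma g_nondegenerate:
  assumes "v \<in> T p" "\<And>w. w \<in> T p \<Longrightarrow> g p v w = 0" shows "v = 0"
proof -
  have "tangent_onb p i \<in> T p" if "i < DIM('e)" for i
    using tangent_onb that by (auto simp: orthonormal_basis_def)
  then have "(\<Sum>i<DIM('e). (g p (tangent_onb p i) (tangent_onb p i) * g p v (tangent_onb p i)) \<cdot>\<^sub>v tangent_onb p i) = 0"
    using assms(2) by (intro sum.neutral) simp
  then show ?thesis using orthonormal_expansion[OF tangent_onb order_refl assms(1)] by simp
qed

text \<open>The metric bounds the dimension of the space of derivations from above, so that no Taylor
  expansion is needed to see that the coordinate vectors span it.\<close>

lemma tangent_eq_pd:
  assumes c: "c \<in> max_atlas A" and p: "p \<in> dom_chart c" and v: "v \<in> T p"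
  shows "\<exists>w. v = pd c w p"
proof -
  obtain V x F where lf: "local_frame c V x F" "p \<in> V"
    using local_frame_exists[OF c p, of UNIV] by auto
  define n where "n = DIM('e)"
  obtain b :: "nat \<Rightarrow> 'e" where b: "bij_betw b {..<n} Basis"
    using ex_bij_betw_nat_finite[OF finite_Basis] by (auto simp: atLeast0LessThan n_def)
  let ?e = "tangent_onb p"
  have e: "orthonormal_basis (g p) (T p) n ?e" using tangent_onb by (simp add: n_def)
  have eT: "?e i \<in> T p" if "i < n" for i using e that by (auto simp: orthonormal_basis_def)
  define \<Psi> where "\<Psi> u = (\<Sum>i<n. g p u (?e i) *\<^sub>R b i)" for u
  have \<Psi>i: "\<Psi> u \<bullet> b i = g p u (?e i)" if "i < n" for i u
  proof -
    have "\<Psi> u \<bullet> b i = (\<Sum>j<n. g p u (?e j) * (b j \<bullet> b i))" by (simp add: \<Psi>_def inner_sum_left)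
    also have "\<dots> = (\<Sum>j<n. if j = i then g p u (?e i) else 0)"
    proof (intro sum.cong refl)
      fix j assume j: "j \<in> {..<n}"
      then have "b j \<in> Basis" "b i \<in> Basis" "b j = b i \<longleftrightarrow> j = i"
        using b that by (auto simp: bij_betw_def inj_on_def)
      then show "g p u (?e j) * (b j \<bullet> b i) = (if j = i then g p u (?e i) else 0)"
        by (auto simp: inner_Basis)
    qed
    finally show ?thesis using that by simp
  qed
  have inj: "u = u'" if "u \<in> T p" "u' \<in> T p" "\<Psi> u = \<Psi> u'" for u u'
  proof -
    have "g p u (?e i) = g p u' (?e i)" if "i < n" for i using \<Psi>i[OF that] \<open>\<Psi> u = \<Psi> u'\<close> by metis
    then have "(\<Sum>i<n. (g p (?e i) (?e i) * g p u (?e i)) \<cdot>\<^sub>v ?e i) = (\<Sum>i<n. (g p (?e i) (?e i) * g p u' (?e i)) \<cdot>\<^sub>v ?e i)"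
      by (intro sum.cong) auto
    then show ?thesis
      using orthonormal_expansion[OF e order_refl that(1)] orthonormal_expansion[OF e order_refl that(2)] by argo
  qed
  note pdT = pd_tangent[OF c p]
  have lin: "linear (\<lambda>w. \<Psi> (pd c w p))"
  proof (rule linearI)
    fix u w
    show "\<Psi> (pd c (u + w) p) = \<Psi> (pd c u p) + \<Psi> (pd c w p)"
      unfolding \<Psi>_def pd_add[OF c p] sum.distrib[symmetric]
      by (intro sum.cong refl) (use g_add_left[OF pdT pdT eT] in \<open>auto simp: scaleR_left.add\<close>)
    fix a
    show "\<Psi> (pd c (a *\<^sub>R w) p) = a *\<^sub>R \<Psi> (pd c w p)"
      unfolding \<Psi>_def pd_scale[OF c p] scaleR_sum_right
      by (intro sum.cong refl) (use g_scale_left[OF pdT eT] in auto)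
  qed
  have "inj (\<lambda>w. \<Psi> (pd c w p))"
  proof (rule injI)
    fix w w' assume "\<Psi> (pd c w p) = \<Psi> (pd c w' p)"
    then have "pd c w p = pd c w' p" using inj pdT by blast
    then have "w \<bullet> i = w' \<bullet> i" for i using local_frame_pd_x[OF lf, of w i] local_frame_pd_x[OF lf, of w' i] by simp
    then show "w = w'" by (metis vector_eq_rdot)
  qed
  then have "surj (\<lambda>w. \<Psi> (pd c w p))" by (rule linear_inj_imp_surj[OF lin])
  then obtain w where "\<Psi> v = \<Psi> (pd c w p)" using surjD[of "\<lambda>w. \<Psi> (pd c w p)" "\<Psi> v"] by blast
  then show ?thesis using inj[OF v pdT] by blast
qed

lemma tangent_expansion:
  assumes lf: "local_frame c V x F" and p: "p \<in> V" and v: "v \<in> T p"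
  shows "v = (\<Sum>i\<in>Basis. v (x i) \<cdot>\<^sub>v pd c i p)"
proof -
  note lc = local_frame_chart(1)[OF lf] local_frame_chart(4)[OF lf p]
  obtain w where w: "v = pd c w p" using tangent_eq_pd[OF lc v] by blast
  have "v (x i) = w \<bullet> i" for i using w local_frame_pd_x[OF lf p] by simp
  moreover have "pd c w p = pd c (\<Sum>i\<in>Basis. (w \<bullet> i) *\<^sub>R i) p" by (simp add: euclidean_representation)
  ultimately show ?thesis using w pd_sum[OF lc] by simp
qed

end

section \<open>Tensoriality, the Levi-Civita connection and its curvature\<close>

lemma fscale_const: "(\<lambda>_. a) \<cdot>\<^sub>f X = (\<lambda>p. a \<cdot>\<^sub>v X p)"
  by (simp add: fscale_def)

context lorentz begin

text \<open>A global identity that localises a field: inside \<open>V\<close> it is a combination of the frame fields, and the second term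
vanishes wherever \<open>\<beta> = 1\<close>.\<close>

lemma VF_decompose:
  assumes lf: "local_frame c V x F" and b: "\<And>q. q \<notin> V \<Longrightarrow> \<beta> q = 0" and Z: "Z \<in> VF"
  shows "Z = (\<Sum>i\<in>Basis. (\<lambda>q. \<beta> q * Z q (x i)) \<cdot>\<^sub>f F i) + (\<lambda>q. 1 - \<beta> q) \<cdot>\<^sub>f Z"
proof
  fix q
  show "Z q = ((\<Sum>i\<in>Basis. (\<lambda>q. \<beta> q * Z q (x i)) \<cdot>\<^sub>f F i) + (\<lambda>q. 1 - \<beta> q) \<cdot>\<^sub>f Z) q"
  proof (cases "q \<in> V")
    case True
    have "(\<Sum>i\<in>Basis. (\<beta> q * Z q (x i)) \<cdot>\<^sub>v F i q) = \<beta> q \<cdot>\<^sub>v (\<Sum>i\<in>Basis. Z q (x i) \<cdot>\<^sub>v pd c i q)"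
      using local_frame_F[OF lf True] by (simp add: vscale_sum)
    also have "\<dots> = \<beta> q \<cdot>\<^sub>v Z q" using tangent_expansion[OF lf True VF_at[OF Z]] by simp
    finally show ?thesis by (simp add: sum_fun_apply[of "\<lambda>i. _ i"] fun_eq_iff) (simp add: sum_fun_apply algebra_simps)
  qed (use b in \<open>simp add: sum_fun_apply\<close>)
qed

text \<open>If \<open>Z = X - X'\<close> vanishes at \<open>p\<close>, then all coefficients in its localisation vanish at \<open>p\<close>, those of the frame fields
as well as \<open>1 - \<beta>\<close>.\<close>

lemma tensorial_eq:
  fixes Q :: "'m vfield \<Rightarrow> 'm tvec"
  assumes add: "\<And>X Y. X \<in> VF \<Longrightarrow> Y \<in> VF \<Longrightarrow> Q (X + Y) = Q X + Q Y"
    and scale: "\<And>f X. f \<in> Cinf A \<Longrightarrow> X \<in> VF \<Longrightarrow> Q (f \<cdot>\<^sub>f X) = f p \<cdot>\<^sub>v Q X"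
    and X: "X \<in> VF" "X' \<in> VF" "X p = X' p"
  shows "Q X = Q X'"
proof -
  define Z where "Z = X - X'"
  have Z: "Z \<in> VF" "Z p = 0" using X by (auto simp: Z_def)
  obtain c where c: "c \<in> max_atlas A" "p \<in> dom_chart c" using atlas_covers[of p] atlas_le_max_atlas by metis
  obtain V x F where lf: "local_frame c V x F" "p \<in> V" using local_frame_exists[OF c, of UNIV] by auto
  obtain \<beta> W K where b: "\<beta> \<in> Cinf A" "open W" "p \<in> W" "K \<subseteq> V"
    "\<And>q. q \<in> W \<Longrightarrow> \<beta> q = 1" "\<And>q. q \<notin> K \<Longrightarrow> \<beta> q = 0"
    using manifold_bump[OF local_frame_chart(2)[OF lf(1)] lf(2)] by metis
  define a where "a i = (\<lambda>q. \<beta> q * Z q (x i))" for i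
  have a: "a i \<in> Cinf A" "a i p = 0" for i
    using Cinf_mult'[OF b(1) VF_act'[OF Z(1) local_frame_Cinf[OF lf(1)]]] Z(2) by (auto simp: a_def)
  have "(\<lambda>_. 0) \<cdot>\<^sub>f (0 :: 'm vfield) = 0" by (simp add: fun_eq_iff)
  then have Q0: "Q 0 = 0" using scale[of "\<lambda>_. 0" 0] by simp
  have Qs: "Q (\<Sum>i\<in>I. a i \<cdot>\<^sub>f F i) = 0" for I
  proof (induction I rule: infinite_finite_induct)
    case (infinite I) show ?case unfolding sum.infinite[OF infinite] by (rule Q0)
  next
    case empty show ?case unfolding sum.empty by (rule Q0)
  next
    case (insert i I)
    have "Q (a i \<cdot>\<^sub>f F i + (\<Sum>i\<in>I. a i \<cdot>\<^sub>f F i)) = Q (a i \<cdot>\<^sub>f F i) + Q (\<Sum>i\<in>I. a i \<cdot>\<^sub>f F i)"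
      by (intro add VF_sum VF_fscale a local_frame_VF[OF lf(1)])
    moreover have "Q (a i \<cdot>\<^sub>f F i) = 0"
      using scale[OF a(1)[of i] local_frame_VF[OF lf(1), of i]] a(2) by simp
    ultimately have "Q (a i \<cdot>\<^sub>f F i + (\<Sum>i\<in>I. a i \<cdot>\<^sub>f F i)) = 0"
      by (simp only: insert(3) add_0_left)
    then show ?case unfolding sum.insert[OF insert(1,2)] .
  qed
  have b1: "(\<lambda>q. 1 - \<beta> q) \<in> Cinf A" by (intro Cinf_diff' b Cinf_const)
  have "Z = (\<Sum>i\<in>Basis. a i \<cdot>\<^sub>f F i) + (\<lambda>q. 1 - \<beta> q) \<cdot>\<^sub>f Z"
    unfolding a_def by (rule VF_decompose[OF lf(1) _ Z(1)]) (use b in auto)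
  then have "Q Z = Q (\<Sum>i\<in>Basis. a i \<cdot>\<^sub>f F i) + Q ((\<lambda>q. 1 - \<beta> q) \<cdot>\<^sub>f Z)"
    using add[OF VF_sum[of Basis "\<lambda>i. a i \<cdot>\<^sub>f F i"] VF_fscale[OF b1 Z(1)]] a local_frame_VF[OF lf(1)] by simp
  also have "\<dots> = 0" using Qs scale[OF b1 Z(1)] b by simp
  finally have "Q Z = 0" .
  moreover have "X = Z + X'" by (simp add: Z_def)
  ultimately show ?thesis using add[OF Z(1) X(2)] by simp
qed

lemma VF_extension_exists: assumes v: "v \<in> T p" shows "\<exists>X. X \<in> VF \<and> X p = v"
proof -
  obtain c where c: "c \<in> max_atlas A" "p \<in> dom_chart c" using atlas_covers[of p] atlas_le_max_atlas by metis
  obtain V x F where lf: "local_frame c V x F" "p \<in> V" using local_frame_exists[OF c, of UNIV] by auto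
  have "(\<Sum>i\<in>Basis. (\<lambda>_. v (x i)) \<cdot>\<^sub>f F i) \<in> VF"
    by (intro VF_sum VF_fscale Cinf_const local_frame_VF[OF lf(1)])
  moreover have "(\<Sum>i\<in>Basis. (\<lambda>_. v (x i)) \<cdot>\<^sub>f F i) p = v"
    using tangent_expansion[OF lf v] local_frame_F[OF lf] by (simp add: sum_fun_apply)
  ultimately show ?thesis by blast
qed

lemma extend_vec: "v \<in> T p \<Longrightarrow> extend_vec A p v \<in> VF" "v \<in> T p \<Longrightarrow> extend_vec A p v p = v"
  using someI_ex[OF VF_extension_exists, of v p] by (auto simp: extend_vec_def)

end

locale connection = lorentz A g
  for A :: "('m::{t2_space, second_countable_topology}, 'e::euclidean_space) chart set" and g :: "'m metric" +
  fixes D :: "'m vfield \<Rightarrow> 'm vfield \<Rightarrow> 'm vfield"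
  assumes lc: "levi_civita A g D"
begin

lemma D_VF [simp, intro]: "X \<in> VF \<Longrightarrow> Y \<in> VF \<Longrightarrow> D X Y \<in> VF"
  using lc by (simp add: levi_civita_def affine_connection_def)

lemma D_lin: "X \<in> VF \<Longrightarrow> Y \<in> VF \<Longrightarrow> Z \<in> VF \<Longrightarrow> f \<in> Cinf A \<Longrightarrow> D (f \<cdot>\<^sub>f X + Y) Z = f \<cdot>\<^sub>f D X Z + D Y Z"
  using lc by (simp add: levi_civita_def affine_connection_def)

lemma D_add_right: "X \<in> VF \<Longrightarrow> Y \<in> VF \<Longrightarrow> Z \<in> VF \<Longrightarrow> D X (Y + Z) = D X Y + D X Z"
  using lc by (simp add: levi_civita_def affine_connection_def)

lemma D_leibniz: "X \<in> VF \<Longrightarrow> Y \<in> VF \<Longrightarrow> f \<in> Cinf A \<Longrightarrow> D X (f \<cdot>\<^sub>f Y) = act X f \<cdot>\<^sub>f Y + f \<cdot>\<^sub>f D X Y"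
  using lc by (simp add: levi_civita_def affine_connection_def)

lemma D_torsion: "X \<in> VF \<Longrightarrow> Y \<in> VF \<Longrightarrow> D X Y - D Y X = lie_bracket X Y"
  using lc by (simp add: levi_civita_def)

lemma D_metric: "X \<in> VF \<Longrightarrow> Y \<in> VF \<Longrightarrow> Z \<in> VF \<Longrightarrow>
    X p (\<lambda>q. g q (Y q) (Z q)) = g p (D X Y p) (Z p) + g p (Y p) (D X Z p)"
  using lc by (simp add: levi_civita_def)

lemma fscale_1: "(\<lambda>_. 1) \<cdot>\<^sub>f X = X" by (simp add: fscale_const)

lemma D_add_left: "X \<in> VF \<Longrightarrow> Y \<in> VF \<Longrightarrow> Z \<in> VF \<Longrightarrow> D (X + Y) Z = D X Z + D Y Z"
  using D_lin[of X Y Z "\<lambda>_. 1"] by (simp add: fscale_1)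

lemma D_0_left: "Z \<in> VF \<Longrightarrow> D 0 Z = 0" using D_add_left[of 0 0 Z] by simp

lemma D_0_right: "X \<in> VF \<Longrightarrow> D X 0 = 0" using D_add_right[of X 0 0] by simp

lemma D_fscale_left: "X \<in> VF \<Longrightarrow> Z \<in> VF \<Longrightarrow> f \<in> Cinf A \<Longrightarrow> D (f \<cdot>\<^sub>f X) Z = f \<cdot>\<^sub>f D X Z"
  using D_lin[of X 0 Z f] by (simp add: D_0_left)

lemma D_diff_left: "X \<in> VF \<Longrightarrow> Y \<in> VF \<Longrightarrow> Z \<in> VF \<Longrightarrow> D (X - Y) Z = D X Z - D Y Z"
  using D_add_left[of "X - Y" Y Z] by (simp add: algebra_simps)

lemma D_uminus_left: "X \<in> VF \<Longrightarrow> Z \<in> VF \<Longrightarrow> D (- X) Z = - D X Z"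
  using D_diff_left[of 0 X Z] by (simp add: D_0_left)

lemma D_diff_right: "X \<in> VF \<Longrightarrow> Y \<in> VF \<Longrightarrow> Z \<in> VF \<Longrightarrow> D X (Y - Z) = D X Y - D X Z"
  using D_add_right[of X "Y - Z" Z] by (simp add: algebra_simps)

lemma D_sum_right: "X \<in> VF \<Longrightarrow> (\<And>i. i \<in> I \<Longrightarrow> F i \<in> VF) \<Longrightarrow> D X (\<Sum>i\<in>I. F i) = (\<Sum>i\<in>I. D X (F i))"
  by (induction I rule: infinite_finite_induct) (auto simp: D_0_right D_add_right VF_sum)

lemma D_cong_left: "X \<in> VF \<Longrightarrow> X' \<in> VF \<Longrightarrow> Y \<in> VF \<Longrightarrow> X p = X' p \<Longrightarrow> D X Y p = D X' Y p"
  by (rule tensorial_eq[where Q="\<lambda>X. D X Y p"]) (auto simp: D_add_left D_fscale_left)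

lemma D_lin_at:
  assumes "X \<in> VF" "Y \<in> VF" "U \<in> VF" "Z \<in> VF" "U p = a \<cdot>\<^sub>v X p + b \<cdot>\<^sub>v Y p"
  shows "D U Z p = a \<cdot>\<^sub>v D X Z p + b \<cdot>\<^sub>v D Y Z p"
proof -
  have "D U Z p = D ((\<lambda>_. a) \<cdot>\<^sub>f X + (\<lambda>_. b) \<cdot>\<^sub>f Y) Z p"
    using assms by (intro D_cong_left) auto
  then show ?thesis using assms by (simp add: D_add_left D_fscale_left)
qed

text \<open>If \<open>Z = Y - Y'\<close> vanishes on \<open>S\<close> near \<open>p\<close>, then so do its components, and the Leibniz rule only
produces their values at \<open>p\<close> and their derivatives in the direction \<open>X\<close>, which is tangent to \<open>S\<close>.\<close>

lemma D_cong_along: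
  assumes X: "X \<in> VF" "X p \<in> tangent_sub A S p" and p: "p \<in> S" and Y: "Y \<in> VF" "Y' \<in> VF"
    and U: "open U" "p \<in> U" "\<And>q. q \<in> U \<Longrightarrow> q \<in> S \<Longrightarrow> Y q = Y' q"
  shows "D X Y p = D X Y' p"
proof -
  define Z where "Z = Y - Y'"
  have Z: "Z \<in> VF" "\<And>q. q \<in> U \<Longrightarrow> q \<in> S \<Longrightarrow> Z q = 0" using Y U by (auto simp: Z_def)
  obtain c where c: "c \<in> max_atlas A" "p \<in> dom_chart c" using atlas_covers[of p] atlas_le_max_atlas by metis
  obtain V x F where lf: "local_frame c V x F" "p \<in> V" "V \<subseteq> U" using local_frame_exists[OF c U(1,2)] by auto
  obtain \<beta> W K where b: "\<beta> \<in> Cinf A" "open W" "p \<in> W" "K \<subseteq> V"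
    "\<And>q. q \<in> W \<Longrightarrow> \<beta> q = 1" "\<And>q. q \<notin> K \<Longrightarrow> \<beta> q = 0"
    using manifold_bump[OF local_frame_chart(2)[OF lf(1)] lf(2)] by metis
  define a where "a i = (\<lambda>q. \<beta> q * Z q (x i))" for i
  have a: "a i \<in> Cinf A" for i
    unfolding a_def by (rule Cinf_mult'[OF b(1) VF_act'[OF Z(1) local_frame_Cinf[OF lf(1)]]])
  have aS: "a i q = 0" if "q \<in> S" for i q
    using that Z(2)[of q] b lf(3) by (cases "q \<in> K") (auto simp: a_def)
  have Xa: "X p (a i) = 0" for i
    using X(2) a aS by (auto simp: tangent_sub_def)
  note Fv = local_frame_VF[OF lf(1)]
  have b1: "(\<lambda>q. 1 - \<beta> q) \<in> Cinf A" by (intro Cinf_diff' b Cinf_const)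
  have "Z = (\<Sum>i\<in>Basis. a i \<cdot>\<^sub>f F i) + (\<lambda>q. 1 - \<beta> q) \<cdot>\<^sub>f Z"
    unfolding a_def by (rule VF_decompose[OF lf(1) _ Z(1)]) (use b in auto)
  then have "D X Z p = D X ((\<Sum>i\<in>Basis. a i \<cdot>\<^sub>f F i) + (\<lambda>q. 1 - \<beta> q) \<cdot>\<^sub>f Z) p" by simp
  also have "\<dots> = (\<Sum>i\<in>Basis. D X (a i \<cdot>\<^sub>f F i) p) + D X ((\<lambda>q. 1 - \<beta> q) \<cdot>\<^sub>f Z) p"
    using X Fv a b1 Z by (simp add: D_add_right VF_sum D_sum_right sum_fun_apply)
  also have "(\<Sum>i\<in>Basis. D X (a i \<cdot>\<^sub>f F i) p) = 0"
    using X Fv a aS[OF p] Xa by (simp add: D_leibniz act_def)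
  also have "D X ((\<lambda>q. 1 - \<beta> q) \<cdot>\<^sub>f Z) p = 0"
    using X Z b1 b Z(2)[OF U(2) p] by (simp add: D_leibniz)
  finally have "D X Z p = 0" by (simp add: zero_fun_def)
  then show ?thesis using X Y by (simp add: Z_def D_diff_right)
qed

abbreviation "R \<equiv> curvature_field D"

lemma R_VF: "U \<in> VF \<Longrightarrow> V \<in> VF \<Longrightarrow> W \<in> VF \<Longrightarrow> R U V W \<in> VF"
  by (simp add: curvature_field_def)

lemma R_skew: "U \<in> VF \<Longrightarrow> V \<in> VF \<Longrightarrow> W \<in> VF \<Longrightarrow> R U V W = - R V U W"
  using lie_bracket_minus[of U V] by (simp add: curvature_field_def D_uminus_left)

lemma lie_bracket_add_left: "U \<in> VF \<Longrightarrow> U' \<in> VF \<Longrightarrow> V \<in> VF \<Longrightarrow> lie_bracket (U + U') V = lie_bracket U V + lie_bracket U' V"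
  by (simp add: D_torsion[symmetric] D_add_left D_add_right)

lemma lie_bracket_scale_left:
  "U \<in> VF \<Longrightarrow> V \<in> VF \<Longrightarrow> f \<in> Cinf A \<Longrightarrow> lie_bracket (f \<cdot>\<^sub>f U) V = f \<cdot>\<^sub>f lie_bracket U V - act V f \<cdot>\<^sub>f U"
  using D_torsion[of "f \<cdot>\<^sub>f U" V] D_torsion[of U V]
  by (simp add: D_fscale_left D_leibniz) (auto simp: fun_eq_iff algebra_simps)

lemma R_add_1: "U \<in> VF \<Longrightarrow> U' \<in> VF \<Longrightarrow> V \<in> VF \<Longrightarrow> W \<in> VF \<Longrightarrow> R (U + U') V W = R U V W + R U' V W"
  by (simp add: curvature_field_def lie_bracket_add_left D_add_left D_add_right)

lemma R_scale_1: "U \<in> VF \<Longrightarrow> V \<in> VF \<Longrightarrow> W \<in> VF \<Longrightarrow> f \<in> Cinf A \<Longrightarrow> R (f \<cdot>\<^sub>f U) V W = f \<cdot>\<^sub>f R U V W"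
  by (simp add: curvature_field_def lie_bracket_scale_left D_diff_left D_fscale_left D_leibniz)
    (simp add: fun_eq_iff fscale_def algebra_simps)

lemma R_add_3: "U \<in> VF \<Longrightarrow> V \<in> VF \<Longrightarrow> W \<in> VF \<Longrightarrow> W' \<in> VF \<Longrightarrow> R U V (W + W') = R U V W + R U V W'"
  by (simp add: curvature_field_def D_add_right)

lemma R_scale_3:
  assumes "U \<in> VF" "V \<in> VF" "W \<in> VF" "f \<in> Cinf A"
  shows "R U V (f \<cdot>\<^sub>f W) = f \<cdot>\<^sub>f R U V W"
proof -
  have "act (lie_bracket U V) f = act U (act V f) - act V (act U f)"
    by (simp add: act_def lie_bracket_def fun_eq_iff)
  then show ?thesis using assms
    by (simp add: curvature_field_def D_leibniz D_add_right) (simp add: fun_eq_iff fscale_def algebra_simps)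
qed

text \<open>Tensoriality in the middle argument follows from that in the first by skew symmetry.\<close>

lemma R_cong:
  assumes "U \<in> VF" "V \<in> VF" "W \<in> VF" "U' \<in> VF" "V' \<in> VF" "W' \<in> VF" "U p = U' p" "V p = V' p" "W p = W' p"
  shows "R U V W p = R U' V' W' p"
proof -
  have 1: "R U V W p = R U' V W p" if "U \<in> VF" "V \<in> VF" "U' \<in> VF" "W \<in> VF" "U p = U' p" for U U' V W
    by (rule tensorial_eq[where Q="\<lambda>U. R U V W p"]) (use that in \<open>auto simp: R_add_1 R_scale_1\<close>)
  have 3: "R U V W p = R U V W' p"  if "U \<in> VF" "V \<in> VF" "W' \<in> VF" "W \<in> VF" "W p = W' p" for U V W W'
    by (rule tensorial_eq[where Q="\<lambda>W. R U V W p"]) (use that in \<open>auto simp: R_add_3 R_scale_3\<close>)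
  have "R U V W p = R U' V W p" using assms by (intro 1)
  also have "\<dots> = - R V U' W p" using assms R_skew[of U' V W] by simp
  also have "R V U' W p = R V' U' W p" using assms by (intro 1)
  also have "- \<dots> = R U' V' W p" using assms R_skew[of U' V' W] by simp
  also have "\<dots> = R U' V' W' p" using assms by (intro 3)
  finally show ?thesis .
qed

lemma curvature_eq:
  assumes "U \<in> VF" "V \<in> VF" "W \<in> VF"
  shows "curvature A D p (U p) (V p) (W p) = R U V W p"
  unfolding curvature_def using assms by (intro R_cong) (simp_all add: extend_vec VF_at)

end

section \<open>Unit timelike Killing fields\<close>

locale unit_killing = connection A g D
  for A :: "('m::{t2_space, second_countable_topology}, 'e::euclidean_space) chart set" and g :: "'m metric"
    and D :: "'m vfield \<Rightarrow> 'm vfield \<Rightarrow> 'm vfield" +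
  fixes E :: "'m vfield"
  assumes unit: "timelike_unitary A g E" and kill: "killing A g E"
begin

lemma E_VF [simp, intro]: "E \<in> VF" using unit by (simp add: timelike_unitary_def)

lemma E_unit [simp]: "g p (E p) (E p) = -1" using unit by (simp add: timelike_unitary_def)

lemma killing_eq: "X \<in> VF \<Longrightarrow> Y \<in> VF \<Longrightarrow>
    E p (\<lambda>q. g q (X q) (Y q)) = g p (lie_bracket E X p) (Y p) + g p (X p) (lie_bracket E Y p)"
  using kill by (simp add: killing_def)

lemma DE_skew: assumes X: "X \<in> VF" and Y: "Y \<in> VF" shows "g p (D X E p) (Y p) = - g p (X p) (D Y E p)"
proof -
  have "lie_bracket E X = D E X - D X E" "lie_bracket E Y = D E Y - D Y E"
    using D_torsion[of E X] D_torsion[of E Y] X Y by auto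
  then show ?thesis using killing_eq[OF X Y, of p] D_metric[OF E_VF X Y, of p] X Y
    by (simp add: g_diff_left g_diff_right VF_at)
qed

lemma DE_E: assumes X: "X \<in> VF" shows "g p (D X E p) (E p) = 0"
proof -
  have "X p (\<lambda>q. g q (E q) (E q)) = 0" using tangent_of_const[OF VF_at[OF X]] by simp
  then show ?thesis using D_metric[OF X E_VF E_VF, of p] g_sym[of "E p" p "D X E p"] X by (simp add: VF_at)
qed

lemma D_E_E: "D E E = 0"
proof
  fix p
  have "g p (D E E p) w = 0" if w: "w \<in> T p" for w
  proof -
    obtain X where X: "X \<in> VF" "X p = w" using VF_extension_exists[OF w] by blast
    show ?thesis using DE_skew[OF E_VF X(1), of p] DE_E[OF X(1), of p] X g_sym[of "E p" p "D X E p"] by (simp add: VF_at)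
  qed
  then show "D E E p = 0 p" using g_nondegenerate[of "D E E p" p] by (simp add: VF_at)
qed

text \<open>The flow of a Killing field preserves the connection: the tensor measuring the failure is symmetric in
  two arguments and skew in another pair, hence zero.\<close>

lemma killing_preserves_connection:
  assumes X: "X \<in> VF" and Y: "Y \<in> VF"
  shows "lie_bracket E (D X Y) = D (lie_bracket E X) Y + D X (lie_bracket E Y)"
proof
  fix p
  define Q where "Q X Y = lie_bracket E (D X Y) - D (lie_bracket E X) Y - D X (lie_bracket E Y)" for X Y
  have QVF: "Q X Y \<in> VF" if "X \<in> VF" "Y \<in> VF" for X Y using that by (simp add: Q_def)
  have jac: "lie_bracket E (lie_bracket X Y) = lie_bracket (lie_bracket E X) Y + lie_bracket X (lie_bracket E Y)"
    if X: "X \<in> VF" and Y: "Y \<in> VF" for X Y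
  proof (intro ext)
    fix p f
    show "lie_bracket E (lie_bracket X Y) p f =
      (lie_bracket (lie_bracket E X) Y + lie_bracket X (lie_bracket E Y)) p f"
    proof (cases "f \<in> Cinf A")
      case True
      have a: "act (lie_bracket U V) f = act U (act V f) - act V (act U f)" for U V
        by (simp add: act_def lie_bracket_def fun_eq_iff)
      have d: "Z p (act U (act V f) - act V (act U f)) = Z p (act U (act V f)) - Z p (act V (act U f))"
        if "Z \<in> VF" "U \<in> VF" "V \<in> VF" for Z U V
        by (rule tangent_diff[OF VF_at[OF that(1)]]) (use that True in auto)
      have l: "lie_bracket U V p h = U p (act V h) - V p (act U h)" for U V h by (simp add: lie_bracket_def)
      show ?thesis using X Y by (simp add: l a d)
    next
      case False
      have "lie_bracket U V p f = 0" if "U \<in> VF" "V \<in> VF" for U V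
        by (rule tangent_outside[OF VF_at[OF lie_bracket_VF[OF that]] False])
      then show ?thesis using X Y by simp
    qed
  qed
  have lie_diff: "lie_bracket E (U - V) = lie_bracket E U - lie_bracket E V" if "U \<in> VF" "V \<in> VF" for U V
    using that by (simp add: D_torsion[symmetric] D_diff_right D_diff_left)
  have symQ: "Q X Y = Q Y X" if X: "X \<in> VF" and Y: "Y \<in> VF" for X Y
  proof -
    have "lie_bracket E (D X Y) - lie_bracket E (D Y X) = lie_bracket E (lie_bracket X Y)"
      using X Y by (simp add: lie_diff[symmetric] D_torsion)
    also have "\<dots> = (D (lie_bracket E X) Y - D Y (lie_bracket E X)) + (D X (lie_bracket E Y) - D (lie_bracket E Y) X)"
      using X Y by (simp add: jac D_torsion)
    finally show ?thesis by (simp add: Q_def algebra_simps)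
  qed
  have skewQ: "g p (Q X Y p) (Z p) = - g p (Q X Z p) (Y p)" if X: "X \<in> VF" and Y: "Y \<in> VF" and Z: "Z \<in> VF" for X Y Z
  proof -
    let ?f = "\<lambda>q. g q (Y q) (Z q)"
    have f: "?f \<in> Cinf A" using Y Z by simp
    have 1: "act X ?f = (\<lambda>q. g q (D X Y q) (Z q)) + (\<lambda>q. g q (Y q) (D X Z q))"
      using X Y Z by (simp add: act_def D_metric fun_eq_iff)
    have 2: "act E ?f = (\<lambda>q. g q (lie_bracket E Y q) (Z q)) + (\<lambda>q. g q (Y q) (lie_bracket E Z q))"
      using X Y Z by (simp add: act_def killing_eq fun_eq_iff)
    have 3: "E p (act X ?f) = g p (lie_bracket E (D X Y) p) (Z p) + g p (D X Y p) (lie_bracket E Z p)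
       + (g p (lie_bracket E Y p) (D X Z p) + g p (Y p) (lie_bracket E (D X Z) p))"
      unfolding 1 using X Y Z by (subst tangent_add[OF VF_at[OF E_VF]]) (simp_all add: killing_eq)
    have 4: "X p (act E ?f) = g p (D X (lie_bracket E Y) p) (Z p) + g p (lie_bracket E Y p) (D X Z p)
       + (g p (D X Y p) (lie_bracket E Z p) + g p (Y p) (D X (lie_bracket E Z) p))"
      unfolding 2 using X Y Z by (subst tangent_add[OF VF_at[OF X]]) (simp_all add: D_metric)
    have 5: "E p (act X ?f) - X p (act E ?f) = g p (D (lie_bracket E X) Y p) (Z p) + g p (Y p) (D (lie_bracket E X) Z p)"
      using D_metric[OF lie_bracket_VF[OF E_VF X] Y Z, of p] by (simp add: lie_bracket_def)
    have "g p (Q X Y p) (Z p) + g p (Y p) (Q X Z p) = 0"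
      using X Y Z 3 4 5 by (simp add: Q_def g_diff_left g_diff_right VF_at)
    then show ?thesis using g_sym[of "Y p" p "Q X Z p"] QVF X Y Z by (simp add: VF_at)
  qed
  have Q0: "g p (Q X Y p) (Z p) = 0" if "Z \<in> VF" for Z
    using skewQ[of X Y Z] skewQ[of Z X Y] skewQ[of Y Z X] symQ[of X Y] symQ[of X Z] symQ[of Y Z] X Y that by simp
  have "Q X Y p = 0"
  proof (rule g_nondegenerate[of _ p])
    show "Q X Y p \<in> T p" using QVF X Y by (simp add: VF_at)
    fix w assume "w \<in> T p"
    then show "g p (Q X Y p) w = 0" using VF_extension_exists[of w p] Q0 by blast
  qed
  then show "lie_bracket E (D X Y) p = (D (lie_bracket E X) Y + D X (lie_bracket E Y)) p"
    by (simp add: Q_def algebra_simps)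
qed

text \<open>The right hand side is \<open>(\<nabla>\<^sub>X A') Y\<close> for \<open>A' = \<nabla>E\<close>. Expanding the brackets with \<open>E\<close> in the invariance of the connection
turns it into this formula for the curvature.\<close>

lemma curvature_killing:
  assumes X: "X \<in> VF" and Y: "Y \<in> VF"
  shows "R X E Y = D X (D Y E) - D (D X Y) E"
proof -
  have 1: "D E Y = lie_bracket E Y + D Y E" "D E (D X Y) = lie_bracket E (D X Y) + D (D X Y) E"
    using D_torsion[of E Y] D_torsion[of E "D X Y"] X Y by (auto simp: algebra_simps)
  have 2: "lie_bracket X E = - lie_bracket E X" by (rule lie_bracket_minus)
  show ?thesis unfolding curvature_field_def 1 2
    using X Y by (simp add: D_add_right D_uminus_left killing_preserves_connection)
qed

text \<open>Differentiate \<open>g(\<nabla>\<^sub>Y E, Y) = 0\<close> in the direction \<open>X\<close>.\<close>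

lemma curvature_killing_skew:
  assumes X: "X \<in> VF" and Y: "Y \<in> VF"
  shows "g p (R X E Y p) (Y p) = 0"
proof -
  have "g q (D Y E q) (Y q) = 0" for q
    using DE_skew[OF Y Y, of q] g_sym[of "D Y E q" q "Y q"] Y by (simp add: VF_at)
  then have "g p (D X (D Y E) p) (Y p) + g p (D Y E p) (D X Y p) = 0"
    using D_metric[OF X D_VF[OF Y E_VF] Y, of p] tangent_of_const[OF VF_at[OF X]] by simp
  moreover have "g p (D (D X Y) E p) (Y p) = - g p (D Y E p) (D X Y p)"
    using DE_skew[of "D X Y" Y p] g_sym[of "D X Y p" p "D Y E p"] X Y by (simp add: VF_at)
  ultimately show ?thesis using X Y by (simp add: curvature_killing g_diff_left VF_at)
qed

end

section \<open>Traces and orthonormal bases\<close>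

context lorentz begin

definition linear_form :: "'m \<Rightarrow> ('m tvec \<Rightarrow> real) \<Rightarrow> bool" where
  "linear_form p \<phi> \<longleftrightarrow> (\<forall>u\<in>T p. \<forall>v\<in>T p. \<forall>a. \<phi> (a \<cdot>\<^sub>v u + v) = a * \<phi> u + \<phi> v)"

definition endomorphism :: "'m \<Rightarrow> ('m tvec \<Rightarrow> 'm tvec) \<Rightarrow> bool" where
  "endomorphism p Q \<longleftrightarrow> (\<forall>u\<in>T p. Q u \<in> T p) \<and>
     (\<forall>u\<in>T p. \<forall>v\<in>T p. \<forall>a. Q (a \<cdot>\<^sub>v u + v) = a \<cdot>\<^sub>v Q u + Q v)"

lemma
  assumes "linear_form p \<phi>"
  shows linear_form_add: "u \<in> T p \<Longrightarrow> v \<in> T p \<Longrightarrow> \<phi> (u + v) = \<phi> u + \<phi> v"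
    and linear_form_0: "\<phi> 0 = 0"
    and linear_form_scale: "u \<in> T p \<Longrightarrow> \<phi> (a \<cdot>\<^sub>v u) = a * \<phi> u"
proof -
  have *: "\<phi> (a \<cdot>\<^sub>v u + v) = a * \<phi> u + \<phi> v" if "u \<in> T p" "v \<in> T p" for u v a
    using assms that by (auto simp: linear_form_def)
  show add: "\<phi> (u + v) = \<phi> u + \<phi> v" if "u \<in> T p" "v \<in> T p" for u v using *[OF that, of 1] by simp
  show 0: "\<phi> 0 = 0" using add[of 0 0] by simp
  show "\<phi> (a \<cdot>\<^sub>v u) = a * \<phi> u" if "u \<in> T p" using *[OF that, of 0 a] 0 by simp
qed

lemma linear_form_sum:
  assumes "linear_form p \<phi>"
  shows "(\<And>i. i \<in> I \<Longrightarrow> u i \<in> T p) \<Longrightarrow> \<phi> (\<Sum>i\<in>I. a i \<cdot>\<^sub>v u i) = (\<Sum>i\<in>I. a i * \<phi> (u i))"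
proof (induction I rule: infinite_finite_induct)
  case (insert i I)
  have "\<phi> (\<Sum>i\<in>insert i I. a i \<cdot>\<^sub>v u i) = \<phi> (a i \<cdot>\<^sub>v u i + (\<Sum>i\<in>I. a i \<cdot>\<^sub>v u i))"
    by (simp only: sum.insert[OF insert(1,2)])
  also have "\<dots> = \<phi> (a i \<cdot>\<^sub>v u i) + \<phi> (\<Sum>i\<in>I. a i \<cdot>\<^sub>v u i)"
    by (rule linear_form_add[OF assms]) (use insert in \<open>auto intro!: tangent_sum_in\<close>)
  also have "\<phi> (a i \<cdot>\<^sub>v u i) = a i * \<phi> (u i)" by (rule linear_form_scale[OF assms]) (use insert in auto)
  also have "\<phi> (\<Sum>i\<in>I. a i \<cdot>\<^sub>v u i) = (\<Sum>i\<in>I. a i * \<phi> (u i))" by (rule insert.IH) (use insert in auto)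
  finally show ?case by (simp only: sum.insert[OF insert(1,2)])
next
  case empty show ?case unfolding sum.empty by (rule linear_form_0[OF assms])
next
  case (infinite I) show ?case unfolding sum.infinite[OF infinite(1)] by (rule linear_form_0[OF assms])
qed

lemma
  assumes "endomorphism p Q"
  shows endo_in: "u \<in> T p \<Longrightarrow> Q u \<in> T p"
    and endo_add: "u \<in> T p \<Longrightarrow> v \<in> T p \<Longrightarrow> Q (u + v) = Q u + Q v"
    and endo_0: "Q 0 = 0"
    and endo_scale: "u \<in> T p \<Longrightarrow> Q (a \<cdot>\<^sub>v u) = a \<cdot>\<^sub>v Q u"
proof -
  have *: "Q (a \<cdot>\<^sub>v u + v) = a \<cdot>\<^sub>v Q u + Q v" if "u \<in> T p" "v \<in> T p" for u v a
    using assms that by (auto simp: endomorphism_def)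
  show add: "Q (u + v) = Q u + Q v" if "u \<in> T p" "v \<in> T p" for u v using *[OF that, of 1] by simp
  have "Q (0 + 0) = Q 0 + Q 0" by (rule add) auto
  then show 0: "Q 0 = 0" by simp
  show "Q (a \<cdot>\<^sub>v u) = a \<cdot>\<^sub>v Q u" if "u \<in> T p" using *[OF that, of 0 a] 0 by simp
  show "Q u \<in> T p" if "u \<in> T p" using assms that by (auto simp: endomorphism_def)
qed

lemma linear_form_endo: "linear_form p \<phi> \<Longrightarrow> endomorphism p Q \<Longrightarrow> linear_form p (\<lambda>v. \<phi> (Q v))"
  unfolding linear_form_def endomorphism_def by simp

lemma endo_compose: "endomorphism p Q \<Longrightarrow> endomorphism p Q' \<Longrightarrow> endomorphism p (\<lambda>v. Q (Q' v))"
  unfolding endomorphism_def by simp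

lemma endo_sum:
  assumes "endomorphism p Q"
  shows "(\<And>i. i \<in> I \<Longrightarrow> u i \<in> T p) \<Longrightarrow> Q (\<Sum>i\<in>I. a i \<cdot>\<^sub>v u i) = (\<Sum>i\<in>I. a i \<cdot>\<^sub>v Q (u i))"
proof (induction I rule: infinite_finite_induct)
  case (insert i I)
  have "Q (\<Sum>i\<in>insert i I. a i \<cdot>\<^sub>v u i) = Q (a i \<cdot>\<^sub>v u i + (\<Sum>i\<in>I. a i \<cdot>\<^sub>v u i))"
    by (simp only: sum.insert[OF insert(1,2)])
  also have "\<dots> = Q (a i \<cdot>\<^sub>v u i) + Q (\<Sum>i\<in>I. a i \<cdot>\<^sub>v u i)"
    by (rule endo_add[OF assms]) (use insert in \<open>auto intro!: tangent_sum_in\<close>)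
  also have "Q (a i \<cdot>\<^sub>v u i) = a i \<cdot>\<^sub>v Q (u i)" by (rule endo_scale[OF assms]) (use insert in auto)
  also have "Q (\<Sum>i\<in>I. a i \<cdot>\<^sub>v u i) = (\<Sum>i\<in>I. a i \<cdot>\<^sub>v Q (u i))" by (rule insert.IH) (use insert in auto)
  finally show ?case by (simp only: sum.insert[OF insert(1,2)])
next
  case empty show ?case unfolding sum.empty by (rule endo_0[OF assms])
next
  case (infinite I) show ?case unfolding sum.infinite[OF infinite(1)] by (rule endo_0[OF assms])
qed

lemma linear_form_g: "w \<in> T p \<Longrightarrow> linear_form p (\<lambda>v. g p v w)"
  unfolding linear_form_def by (simp add: g_add_left g_scale_left)

lemma linear_form_eval: "f \<in> Cinf A \<Longrightarrow> linear_form p (\<lambda>v. v f)"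
  unfolding linear_form_def by simp

lemma linear_form_const_mult: "linear_form p \<phi> \<Longrightarrow> linear_form p (\<lambda>v. a * \<phi> v)"
  unfolding linear_form_def by (simp add: algebra_simps)

text \<open>The metric trace of \<open>Q\<close> in the basis of the Ricci tensor. It is the trace of the endomorphism by the next
lemma.\<close>

definition tr :: "'m \<Rightarrow> ('m tvec \<Rightarrow> 'm tvec) \<Rightarrow> real" where
  "tr p Q = (\<Sum>i<DIM('e). g p (tangent_onb p i) (tangent_onb p i) * g p (Q (tangent_onb p i)) (tangent_onb p i))"

lemma tangent_onb_in: "i < DIM('e) \<Longrightarrow> tangent_onb p i \<in> T p"
  using tangent_onb by (auto simp: orthonormal_basis_def)

text \<open>Any resolution \<open>v = \<Sum>\<^sub>j \<theta>\<^sub>j(v) b\<^sub>j\<close> of the identity computes the trace: expand \<open>Q(e\<^sub>i)\<close> in the \<open>b\<^sub>j\<close>, exchange the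
sums and recognise the expansion of \<open>b\<^sub>j\<close> in the \<open>e\<^sub>i\<close>. The functionals \<open>\<theta>\<^sub>j\<close> need not be given by the metric.\<close>

lemma tr_eq:
  assumes Q: "endomorphism p Q" and \<theta>: "\<And>j. j \<in> J \<Longrightarrow> linear_form p (\<theta> j)" and b: "\<And>j. j \<in> J \<Longrightarrow> b j \<in> T p"
    and rep: "\<And>v. v \<in> T p \<Longrightarrow> v = (\<Sum>j\<in>J. \<theta> j v \<cdot>\<^sub>v b j)"
  shows "tr p Q = (\<Sum>j\<in>J. \<theta> j (Q (b j)))"
proof -
  let ?n = "DIM('e)" and ?e = "tangent_onb p"
  let ?\<epsilon> = "\<lambda>i. g p (?e i) (?e i)"
  have eT: "i \<in> {..<?n} \<Longrightarrow> ?e i \<in> T p" for i using tangent_onb_in by auto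
  have "tr p Q = (\<Sum>i<?n. \<Sum>j\<in>J. (?\<epsilon> i * g p (b j) (?e i)) * \<theta> j (Q (?e i)))"
    unfolding tr_def
  proof (intro sum.cong refl)
    fix i assume i: "i \<in> {..<?n}"
    have Qi: "Q (?e i) \<in> T p" using endo_in[OF Q eT[OF i]] .
    have "g p (Q (?e i)) (?e i) = g p (\<Sum>j\<in>J. \<theta> j (Q (?e i)) \<cdot>\<^sub>v b j) (?e i)"
      by (rule arg_cong[OF rep[OF Qi], of "\<lambda>z. g p z (?e i)"])
    also have "\<dots> = (\<Sum>j\<in>J. \<theta> j (Q (?e i)) * g p (b j) (?e i))"
      by (rule linear_form_sum[OF linear_form_g[OF eT[OF i]]]) (rule b)
    finally show "?\<epsilon> i * g p (Q (?e i)) (?e i) = (\<Sum>j\<in>J. (?\<epsilon> i * g p (b j) (?e i)) * \<theta> j (Q (?e i)))"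
      by (simp add: sum_distrib_left algebra_simps)
  qed
  also have "\<dots> = (\<Sum>j\<in>J. \<Sum>i<?n. (?\<epsilon> i * g p (b j) (?e i)) * \<theta> j (Q (?e i)))" by (rule sum.swap)
  also have "\<dots> = (\<Sum>j\<in>J. \<theta> j (Q (b j)))"
  proof (intro sum.cong refl)
    fix j assume j: "j \<in> J"
    have "\<theta> j (Q (b j)) = \<theta> j (Q (\<Sum>i<?n. (?\<epsilon> i * g p (b j) (?e i)) \<cdot>\<^sub>v ?e i))"
      by (rule arg_cong[OF orthonormal_expansion[OF tangent_onb order_refl b[OF j]], of "\<lambda>z. \<theta> j (Q z)"])
    also have "\<dots> = (\<Sum>i<?n. (?\<epsilon> i * g p (b j) (?e i)) * \<theta> j (Q (?e i)))"
      using linear_form_sum[OF linear_form_endo[OF \<theta>[OF j] Q], of "{..<?n}" ?e] eT by auto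
    finally show "(\<Sum>i<?n. (?\<epsilon> i * g p (b j) (?e i)) * \<theta> j (Q (?e i))) = \<theta> j (Q (b j))" by simp
  qed
  finally show ?thesis .
qed

lemma tr_id: "tr p (\<lambda>v. v) = DIM('e)"
proof -
  have "tr p (\<lambda>v. v) = (\<Sum>i<DIM('e). 1)"
    unfolding tr_def using tangent_onb[of p] by (intro sum.cong) (auto simp: orthonormal_basis_def)
  then show ?thesis by simp
qed

lemma ricci_eq_tr: "ricci A g D p v w = tr p (\<lambda>e. curvature A D p e v w)"
  by (simp add: ricci_def tr_def tangent_onb_def Let_def)

text \<open>The orthonormal family has the same span as \<open>f\<close>; it is shorter than \<open>f\<close> when \<open>f\<close> is linearly dependent.\<close>

lemma gram_schmidt:
  fixes m :: nat
  assumes WT: "W \<subseteq> T p" and Wadd: "\<And>u v a. u \<in> W \<Longrightarrow> v \<in> W \<Longrightarrow> a \<cdot>\<^sub>v u + v \<in> W" and W0: "0 \<in> W"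
    and pos: "\<And>v. v \<in> W \<Longrightarrow> v \<noteq> 0 \<Longrightarrow> g p v v > 0"
    and f: "\<And>i. i < m \<Longrightarrow> f i \<in> W"
  shows "\<exists>(k::nat) e. (\<forall>i<k. e i \<in> W) \<and> (\<forall>i<k. g p (e i) (e i) = 1) \<and> (\<forall>i<k. \<forall>j<k. i \<noteq> j \<longrightarrow> g p (e i) (e j) = 0) \<and>
     (\<forall>a. \<exists>a'. (\<Sum>i<m. a i \<cdot>\<^sub>v f i) = (\<Sum>i<k. a' i \<cdot>\<^sub>v e i))"
  using f
proof (induction m)
  case 0 
  show ?case by (intro exI[of _ 0] exI) auto
next
  case (Suc m)
  have fm: "f m \<in> W" "f m \<in> T p" using Suc.prems[of m] WT by auto
  have "\<exists>(k::nat) e. (\<forall>i<k. e i \<in> W) \<and> (\<forall>i<k. g p (e i) (e i) = 1) \<and> (\<forall>i<k. \<forall>j<k. i \<noteq> j \<longrightarrow> g p (e i) (e j) = 0) \<and>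
     (\<forall>a. \<exists>a'. (\<Sum>i<m. a i \<cdot>\<^sub>v f i) = (\<Sum>i<k. a' i \<cdot>\<^sub>v e i))"
    by (rule Suc.IH) (rule Suc.prems, simp)
  then obtain k :: nat and e where E: "(\<forall>i<k. e i \<in> W) \<and> (\<forall>i<k. g p (e i) (e i) = 1) \<and>
     (\<forall>i<k. \<forall>j<k. i \<noteq> j \<longrightarrow> g p (e i) (e j) = 0) \<and>
     (\<forall>a. \<exists>a'. (\<Sum>i<m. a i \<cdot>\<^sub>v f i) = (\<Sum>i<k. a' i \<cdot>\<^sub>v e i))"
    by (elim exE)
  have e: "\<And>i. i < k \<Longrightarrow> e i \<in> W" "\<And>i. i < k \<Longrightarrow> g p (e i) (e i) = 1"
    "\<And>i j. i < k \<Longrightarrow> j < k \<Longrightarrow> i \<noteq> j \<Longrightarrow> g p (e i) (e j) = 0"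
    "\<And>a. \<exists>a'. (\<Sum>i<m. a i \<cdot>\<^sub>v f i) = (\<Sum>i<k. a' i \<cdot>\<^sub>v e i)"
    using E by blast+
  have eT: "e i \<in> T p" if "i < k" for i using e(1)[OF that] WT by auto
  define s where "s = (\<Sum>i<k. g p (f m) (e i) \<cdot>\<^sub>v e i)"
  define r where "r = f m - s"
  have sumW: "n \<le> k \<Longrightarrow> (\<Sum>i<n. a i \<cdot>\<^sub>v e i) \<in> W" for n a
  proof (induction n)
    case 0 show ?case unfolding lessThan_0 sum.empty by (rule W0)
  next
    case (Suc n)
    have "a n \<cdot>\<^sub>v e n + (\<Sum>i<n. a i \<cdot>\<^sub>v e i) \<in> W"
      by (rule Wadd[OF e(1) Suc.IH]) (use Suc.prems in auto)
    then show ?case unfolding sum.lessThan_Suc by (simp only: add.commute)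
  qed
  have sW: "s \<in> W" unfolding s_def by (rule sumW) simp
  then have rW: "r \<in> W" using Wadd[OF sW fm(1), of "-1"] by (simp add: r_def)
  have T: "s \<in> T p" "r \<in> T p" using sW rW WT by auto
  have re: "g p r (e j) = 0" if j: "j < k" for j
  proof -
    have "g p s (e j) = (\<Sum>i<k. g p (f m) (e i) * g p (e i) (e j))"
      unfolding s_def by (rule linear_form_sum[OF linear_form_g[OF eT[OF j]]]) (use eT in auto)
    also have "\<dots> = (\<Sum>i<k. if i = j then g p (f m) (e j) else 0)"
      by (intro sum.cong refl) (use e j in auto)
    also have "\<dots> = g p (f m) (e j)" using j by simp
    finally show ?thesis using fm T eT[OF j] by (simp add: r_def g_diff_left)
  qed
  show ?case
  proof (cases "r = 0")
    case True
    then have fs: "f m = s" by (simp add: r_def)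
    have "\<exists>a'. (\<Sum>i<Suc m. a i \<cdot>\<^sub>v f i) = (\<Sum>i<k. a' i \<cdot>\<^sub>v e i)" for a
    proof -
      obtain a' where a': "(\<Sum>i<m. a i \<cdot>\<^sub>v f i) = (\<Sum>i<k. a' i \<cdot>\<^sub>v e i)" using e(4) by blast
      have "(\<Sum>i<Suc m. a i \<cdot>\<^sub>v f i) = (\<Sum>i<k. a' i \<cdot>\<^sub>v e i) + a m \<cdot>\<^sub>v (\<Sum>i<k. g p (f m) (e i) \<cdot>\<^sub>v e i)"
        using a' fs by (simp add: s_def)
      also have "\<dots> = (\<Sum>i<k. (a' i + a m * g p (f m) (e i)) \<cdot>\<^sub>v e i)"
        by (simp add: vscale_sum vscale_algebra sum.distrib)
      finally show ?thesis by (intro exI)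
    qed
    then show ?thesis using e by (intro exI[of _ k] exI[of _ e]) blast
  next
    case False
    define n where "n = sqrt (g p r r)"
    have n: "n > 0" "n * n = g p r r" using pos[OF rW False] by (auto simp: n_def)
    define e' where "e' i = (if i < k then e i else inverse n \<cdot>\<^sub>v r)" for i
    have ek: "e' k = inverse n \<cdot>\<^sub>v r" "\<And>i. i < k \<Longrightarrow> e' i = e i" by (auto simp: e'_def)
    have "inverse n \<cdot>\<^sub>v r \<in> W" using Wadd[OF rW W0, of "inverse n"] by simp
    then have e'W: "e' i \<in> W" if "i < Suc k" for i using e(1) that by (auto simp: e'_def)
    have kk: "g p (e' k) (e' k) = 1" unfolding ek using T n by (simp add: g_scale_left g_scale_right n(2)[symmetric] field_simps)
    have ki: "g p (e' k) (e' i) = 0" "g p (e' i) (e' k) = 0" if "i < k" for i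
      using that T re[OF that] eT[OF that] g_sym[of r p "e i"] by (simp_all add: ek g_scale_left g_scale_right)
    have "\<exists>a'. (\<Sum>i<Suc m. a i \<cdot>\<^sub>v f i) = (\<Sum>i<Suc k. a' i \<cdot>\<^sub>v e' i)" for a
    proof -
      obtain a' where a': "(\<Sum>i<m. a i \<cdot>\<^sub>v f i) = (\<Sum>i<k. a' i \<cdot>\<^sub>v e i)" using e(4) by blast
      have "f m = s + n \<cdot>\<^sub>v e' k" using n by (simp add: ek r_def)
      then have "a m \<cdot>\<^sub>v f m = a m \<cdot>\<^sub>v (s + n \<cdot>\<^sub>v e' k)" by (rule arg_cong)
      also have "\<dots> = (\<Sum>i<k. (a m * g p (f m) (e i)) \<cdot>\<^sub>v e i) + (a m * n) \<cdot>\<^sub>v e' k"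
        by (simp only: vscale_algebra s_def vscale_sum vscale_simps)
      finally have fm': "a m \<cdot>\<^sub>v f m = (\<Sum>i<k. (a m * g p (f m) (e i)) \<cdot>\<^sub>v e i) + (a m * n) \<cdot>\<^sub>v e' k" .
      have "(\<Sum>i<Suc m. a i \<cdot>\<^sub>v f i) =
          (\<Sum>i<k. (a' i + a m * g p (f m) (e i)) \<cdot>\<^sub>v e i) + (a m * n) \<cdot>\<^sub>v e' k"
        unfolding sum.lessThan_Suc a' fm' by (simp only: vscale_algebra sum.distrib add.assoc)
      also have "\<dots> = (\<Sum>i<Suc k. (if i < k then a' i + a m * g p (f m) (e i) else a m * n) \<cdot>\<^sub>v e' i)"
        by (simp add: ek(2) cong: sum.cong_simp)
      finally show ?thesis by (intro exI)
    qed
    moreover have "g p (e' i) (e' i) = 1" if "i < Suc k" for i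
      using that kk e(2) by (cases "i = k") (auto simp: ek)
    moreover have "g p (e' i) (e' j) = 0" if "i < Suc k" "j < Suc k" "i \<noteq> j" for i j
      using that ki e(3)[of i j] by (cases "i = k"; cases "j = k") (auto simp: ek(2) less_Suc_eq)
    ultimately show ?thesis using e'W by (intro exI[of _ "Suc k"] exI[of _ e']) blast
  qed
qed

text \<open>The orthogonal complement of a timelike vector is spacelike: in a Lorentzian basis \<open>g(v, t) = 0\<close> expresses the product
of the time components by the space components, to which the Cauchy--Schwarz inequality applies.\<close>

lemma timelike_complement_pos:
  assumes t: "t \<in> T p" "g p t t < 0" and v: "v \<in> T p" "g p v t = 0" "v \<noteq> 0"
  shows "g p v v > 0"
proof -
  obtain e where e: "orthonormal_basis (g p) (T p) DIM('e) e" "g p (e 0) (e 0) = -1"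
    "\<And>i. 0 < i \<Longrightarrow> i < DIM('e) \<Longrightarrow> g p (e i) (e i) = 1" by (rule lorentz_basis[of p]) blast
  define n where "n = DIM('e) - 1"
  have n: "DIM('e) = Suc n" by (simp add: n_def)
  define c where "c u i = g p u (e i)" for u i
  have eT: "e i \<in> T p" if "i < Suc n" for i using e(1) that n by (auto simp: orthonormal_basis_def)
  have exp: "u = - c u 0 \<cdot>\<^sub>v e 0 + (\<Sum>i<n. c u (Suc i) \<cdot>\<^sub>v e (Suc i))" if "u \<in> T p" for u
  proof -
    have "u = (\<Sum>i<Suc n. (g p (e i) (e i) * g p u (e i)) \<cdot>\<^sub>v e i)"
      using orthonormal_expansion[OF e(1) order_refl that] unfolding n .
    also have "\<dots> = (g p (e 0) (e 0) * g p u (e 0)) \<cdot>\<^sub>v e 0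
        + (\<Sum>i<n. (g p (e (Suc i)) (e (Suc i)) * g p u (e (Suc i))) \<cdot>\<^sub>v e (Suc i))"
      by (rule sum.lessThan_Suc_shift)
    also have "(\<Sum>i<n. (g p (e (Suc i)) (e (Suc i)) * g p u (e (Suc i))) \<cdot>\<^sub>v e (Suc i)) = (\<Sum>i<n. c u (Suc i) \<cdot>\<^sub>v e (Suc i))"
      using e(3) n by (intro sum.cong) (auto simp: c_def)
    also have "g p (e 0) (e 0) * g p u (e 0) = - c u 0" using e(2) by (simp add: c_def)
    finally show ?thesis .
  qed
  have gexp: "g p u w = - c u 0 * c w 0 + (\<Sum>i<n. c u (Suc i) * c w (Suc i))" if "u \<in> T p" "w \<in> T p" for u w
  proof -
    note l = linear_form_g[OF that(2)]
    have sT: "(\<Sum>i<n. c u (Suc i) \<cdot>\<^sub>v e (Suc i)) \<in> T p" using eT by (intro tangent_sum_in tangent_scale_in) auto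
    have "g p u w = g p (- c u 0 \<cdot>\<^sub>v e 0 + (\<Sum>i<n. c u (Suc i) \<cdot>\<^sub>v e (Suc i))) w"
      by (rule arg_cong[OF exp[OF that(1)], of "\<lambda>z. g p z w"])
    also have "\<dots> = - c u 0 * g p (e 0) w + g p (\<Sum>i<n. c u (Suc i) \<cdot>\<^sub>v e (Suc i)) w"
      using that eT[of 0] sT by (simp add: g_lin)
    also have "g p (\<Sum>i<n. c u (Suc i) \<cdot>\<^sub>v e (Suc i)) w = (\<Sum>i<n. c u (Suc i) * g p (e (Suc i)) w)"
      by (rule linear_form_sum[OF l]) (use eT in auto)
    also have "\<dots> = (\<Sum>i<n. c u (Suc i) * c w (Suc i))"
      by (intro sum.cong) (use g_sym[OF eT that(2)] in \<open>auto simp: c_def\<close>)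
    also have "g p (e 0) w = c w 0" using g_sym[OF eT[of 0] that(2)] by (simp add: c_def)
    finally show ?thesis .
  qed
  define V where "V = (\<Sum>i<n. c v (Suc i) * c v (Suc i))"
  define T2 where "T2 = (\<Sum>i<n. c t (Suc i) * c t (Suc i))"
  have tt: "T2 < c t 0 * c t 0" using gexp[OF t(1) t(1)] t(2) by (simp add: T2_def)
  have vt: "c v 0 * c t 0 = (\<Sum>i<n. c v (Suc i) * c t (Suc i))" using gexp[OF v(1) t(1)] v(2) by simp
  have cs: "(c v 0 * c t 0)\<^sup>2 \<le> V * T2"
    unfolding vt V_def T2_def
    using Cauchy_Schwarz_ineq_sum[of "\<lambda>i. c v (Suc i)" "\<lambda>i. c t (Suc i)" "{..<n}"]
    by (simp add: power2_eq_square)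
  have V0: "V \<ge> 0" "T2 \<ge> 0" by (auto simp: V_def T2_def intro!: sum_nonneg)
  have gvv: "g p v v = V - c v 0 * c v 0" using gexp[OF v(1) v(1)] by (simp add: V_def)
  show ?thesis
  proof (cases "V = 0")
    case True
    then have "(c v 0 * c t 0)\<^sup>2 = 0" using cs by (intro antisym) auto
    moreover have "c t 0 \<noteq> 0" using tt V0 by auto
    ultimately have "c v 0 = 0" by simp
    moreover have "c v (Suc i) = 0" if "i < n" for i
      using True that by (simp add: V_def sum_nonneg_eq_0_iff)
    ultimately have "v = 0" by (subst exp[OF v(1)]) simp
    then show ?thesis using v(3) by simp
  next
    case False
    then have "V * T2 < V * (c t 0 * c t 0)" using V0 tt by simp
    then have "(c v 0 * c v 0) * (c t 0 * c t 0) < V * (c t 0 * c t 0)"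
      using cs by (simp add: power2_eq_square mult_ac)
    moreover have "0 < c t 0 * c t 0" using tt V0 by linarith
    ultimately have "c v 0 * c v 0 < V" using mult_less_cancel_right_pos by blast
    then show ?thesis using gvv by simp
  qed
qed

end

section \<open>Partitions of unity and slice charts\<close>

context manifold begin

lemma Cinf_prod': "(\<And>i. i \<in> I \<Longrightarrow> f i \<in> Cinf A) \<Longrightarrow> (\<lambda>x. \<Prod>i\<in>I. f i x) \<in> Cinf A"
  by (induction I rule: infinite_finite_induct) auto

text \<open>With bump functions \<open>\<beta>\<^sub>k\<close> that are \<open>1\<close> on a cover of \<open>S\<close>, put \<open>\<rho>\<^sub>k = \<beta>\<^sub>k \<Prod>\<^sub>j\<^sub><\<^sub>k (1 - \<beta>\<^sub>j)\<close>. The sum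
telescopes to \<open>1 - \<Prod> (1 - \<beta>\<^sub>j)\<close>.\<close>

lemma partition_of_unity:
  assumes S: "compact S" and U: "\<And>p. p \<in> S \<Longrightarrow> open (U p) \<and> p \<in> U p"
  obtains n :: nat and pt \<rho> K where
    "\<And>k. k < n \<Longrightarrow> pt k \<in> S \<and> \<rho> k \<in> Cinf A \<and> compact (K k) \<and> K k \<subseteq> U (pt k)"
    "\<And>k q. k < n \<Longrightarrow> 0 \<le> \<rho> k q" "\<And>k q. k < n \<Longrightarrow> q \<notin> K k \<Longrightarrow> \<rho> k q = 0"
    "\<And>q. q \<in> S \<Longrightarrow> (\<Sum>k<n. \<rho> k q) = 1"
proof -
  have "\<forall>p. \<exists>\<beta> W K. p \<in> S \<longrightarrow> \<beta> \<in> Cinf A \<and> open W \<and> p \<in> W \<and> compact K \<and> K \<subseteq> U p \<and>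
    (\<forall>q. q \<in> W \<longrightarrow> \<beta> q = 1) \<and> (\<forall>q. q \<notin> K \<longrightarrow> \<beta> q = 0) \<and> (\<forall>q. 0 \<le> \<beta> q) \<and> (\<forall>q. \<beta> q \<le> 1)"
  proof
    fix p
    show "\<exists>\<beta> W K. p \<in> S \<longrightarrow> \<beta> \<in> Cinf A \<and> open W \<and> p \<in> W \<and> compact K \<and> K \<subseteq> U p \<and>
      (\<forall>q. q \<in> W \<longrightarrow> \<beta> q = 1) \<and> (\<forall>q. q \<notin> K \<longrightarrow> \<beta> q = 0) \<and> (\<forall>q. 0 \<le> \<beta> q) \<and> (\<forall>q. \<beta> q \<le> 1)"
    proof (cases "p \<in> S")
      case True
      obtain \<beta> W K where "\<beta> \<in> Cinf A" "open W" "p \<in> W" "W \<subseteq> K" "compact K" "K \<subseteq> U p" "\<And>q. q \<in> W \<Longrightarrow> \<beta> q = 1"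
        "\<And>q. q \<notin> K \<Longrightarrow> \<beta> q = 0" "\<And>q. 0 \<le> \<beta> q" "\<And>q. \<beta> q \<le> 1"
        by (rule manifold_bump[of "U p" p]) (use U[OF True] in blast)+
      then show ?thesis by blast
    qed simp
  qed
  then obtain \<beta> :: "'m \<Rightarrow> 'm \<Rightarrow> real" and W K where B: "\<forall>p. p \<in> S \<longrightarrow> \<beta> p \<in> Cinf A \<and> open (W p) \<and> p \<in> W p \<and> compact (K p) \<and> K p \<subseteq> U p \<and>
    (\<forall>q. q \<in> W p \<longrightarrow> \<beta> p q = 1) \<and> (\<forall>q. q \<notin> K p \<longrightarrow> \<beta> p q = 0) \<and> (\<forall>q. 0 \<le> \<beta> p q) \<and> (\<forall>q. \<beta> p q \<le> 1)"
    unfolding choice_iff by (elim exE)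
  have b: "\<And>p. p \<in> S \<Longrightarrow> \<beta> p \<in> Cinf A" "\<And>p. p \<in> S \<Longrightarrow> open (W p)" "\<And>p. p \<in> S \<Longrightarrow> p \<in> W p"
     "\<And>p. p \<in> S \<Longrightarrow> compact (K p)" "\<And>p. p \<in> S \<Longrightarrow> K p \<subseteq> U p" "\<And>p q. p \<in> S \<Longrightarrow> q \<in> W p \<Longrightarrow> \<beta> p q = 1"
     "\<And>p q. p \<in> S \<Longrightarrow> q \<notin> K p \<Longrightarrow> \<beta> p q = 0"
     "\<And>p q. p \<in> S \<Longrightarrow> 0 \<le> \<beta> p q" "\<And>p q. p \<in> S \<Longrightarrow> \<beta> p q \<le> 1"
    using B by simp_all
  have "S \<subseteq> (\<Union>p\<in>S. W p)" using b(3) by auto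
  then obtain C where C: "C \<subseteq> S" "finite C" "S \<subseteq> (\<Union>p\<in>C. W p)"
    using compactE_image[OF S, of S W] b(2) by auto
  obtain pt where pt: "bij_betw pt {..<card C} C"
    using ex_bij_betw_nat_finite[OF C(2)] by (auto simp: atLeast0LessThan)
  define n where "n = card C"
  have ptS: "pt k \<in> S" if "k < n" for k using pt that C(1) by (auto simp: bij_betw_def n_def)
  define \<rho> where "\<rho> k q = \<beta> (pt k) q * (\<Prod>j<k. 1 - \<beta> (pt j) q)" for k q
  have sum: "(\<Sum>k<m. \<rho> k q) = 1 - (\<Prod>j<m. 1 - \<beta> (pt j) q)" for m q
    by (induction m) (auto simp: \<rho>_def algebra_simps)
  show ?thesis
  proof (rule that[of n pt \<rho> "\<lambda>k. K (pt k)"])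
    fix k assume k: "k < n"
    have "\<rho> k \<in> Cinf A" unfolding \<rho>_def[abs_def]
      using k ptS by (intro Cinf_mult' Cinf_prod' Cinf_diff' Cinf_const b(1)) auto
    then show "pt k \<in> S \<and> \<rho> k \<in> Cinf A \<and> compact (K (pt k)) \<and> K (pt k) \<subseteq> U (pt k)"
      using b ptS[OF k] by blast
    fix q
    show "0 \<le> \<rho> k q" unfolding \<rho>_def
      using k ptS b(8,9) by (intro mult_nonneg_nonneg prod_nonneg) auto
    show "\<rho> k q = 0" if "q \<notin> K (pt k)" using b(7)[OF ptS[OF k] that] by (simp add: \<rho>_def)
  next
    fix q assume "q \<in> S"
    then obtain p where p: "p \<in> C" "q \<in> W p" using C(3) by auto
    then obtain k where k: "k < n" "p = pt k" using pt by (auto simp: bij_betw_def n_def)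
    then have "1 - \<beta> (pt k) q = 0" using b(6)[OF ptS[OF k(1)]] p by auto
    then have "(\<Prod>j<n. 1 - \<beta> (pt j) q) = 0" using k by (intro prod_zero) auto
    then show "(\<Sum>k<n. \<rho> k q) = 1" using sum by simp
  qed
qed

text \<open>The condition on charts in the definition of a hypersurface.\<close>

definition slice :: "'m set \<Rightarrow> ('m, 'e) chart \<Rightarrow> 'e \<Rightarrow> bool" where
  "slice S c b \<longleftrightarrow> c \<in> max_atlas A \<and> b \<in> Basis \<and>
     map_chart c ` (dom_chart c \<inter> S) = map_chart c ` dom_chart c \<inter> {x. x \<bullet> b = 0}"

lemma sliceD: "slice S c b \<Longrightarrow> c \<in> max_atlas A" "slice S c b \<Longrightarrow> b \<in> Basis"
  by (auto simp: slice_def)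

lemma slice_iff:
  assumes s: "slice S c b" and q: "q \<in> dom_chart c" shows "q \<in> S \<longleftrightarrow> map_chart c q \<bullet> b = 0"
proof
  assume "q \<in> S"
  then have "map_chart c q \<in> map_chart c ` (dom_chart c \<inter> S)" using q by auto
  then show "map_chart c q \<bullet> b = 0" using s by (auto simp: slice_def)
next
  assume "map_chart c q \<bullet> b = 0"
  then have "map_chart c q \<in> map_chart c ` (dom_chart c \<inter> S)" using s q by (auto simp: slice_def)
  then obtain r where "r \<in> dom_chart c" "r \<in> S" "map_chart c q = map_chart c r" by auto
  then show "q \<in> S" using inv_map_chart[OF sliceD(1)[OF s]] q by metis
qed

lemma hypersurface_slice:
  assumes "hypersurface A S" "p \<in> S"
  obtains c b where "slice S c b" "p \<in> dom_chart c"
  using assms unfolding hypersurface_def slice_def by blast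

lemma tangent_sub_tangent: "v \<in> tangent_sub A S p \<Longrightarrow> v \<in> T p"
  by (simp add: tangent_sub_def)

lemma tangent_sub_0: "0 \<in> tangent_sub A S p"
  by (simp add: tangent_sub_def)

lemma tangent_sub_lin: "u \<in> tangent_sub A S p \<Longrightarrow> v \<in> tangent_sub A S p \<Longrightarrow> a \<cdot>\<^sub>v u + v \<in> tangent_sub A S p"
  by (simp add: tangent_sub_def)

lemma tangent_sub_scale: "u \<in> tangent_sub A S p \<Longrightarrow> a \<cdot>\<^sub>v u \<in> tangent_sub A S p"
  using tangent_sub_lin[OF _ tangent_sub_0, of u S p a] by simp

lemma tangent_sub_add: "u \<in> tangent_sub A S p \<Longrightarrow> v \<in> tangent_sub A S p \<Longrightarrow> u + v \<in> tangent_sub A S p"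
  using tangent_sub_lin[of u S p v 1] by simp

lemma tangent_sub_sum: "(\<And>i. i \<in> I \<Longrightarrow> F i \<in> tangent_sub A S p) \<Longrightarrow> (\<Sum>i\<in>I. F i) \<in> tangent_sub A S p"
  by (induction I rule: infinite_finite_induct) (simp_all add: tangent_sub_0 tangent_sub_add)

text \<open>Differentiate along a straight line in the hyperplane, on which the function vanishes.\<close>

lemma pd_tangent_sub:
  assumes s: "slice S c b" and q: "q \<in> dom_chart c" "q \<in> S" and w: "w \<bullet> b = 0"
  shows "pd c w q \<in> tangent_sub A S q"
  unfolding tangent_sub_def
proof (intro CollectI conjI ballI impI)
  note c = sliceD(1)[OF s]
  show "pd c w q \<in> T q" by (rule pd_tangent[OF c q(1)])
  fix f assume f: "f \<in> Cinf A" "\<forall>q\<in>S. f q = 0"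
  let ?y = "map_chart c q" and ?f = "f \<circ> inv_chart c"
  have l: "((\<lambda>t. ?y + t *\<^sub>R w) has_derivative (\<lambda>t. t *\<^sub>R w)) (at 0)"
    by (auto intro!: derivative_eq_intros)
  have d: "((\<lambda>t. ?f (?y + t *\<^sub>R w)) has_derivative (\<lambda>t. pd c (t *\<^sub>R w) q f)) (at 0)"
    using diff_chain_at[OF l, of ?f "\<lambda>w. pd c w q f"] pd_has_derivative[OF f(1) c q(1)] by (simp add: o_def)
  let ?N = "(\<lambda>t. ?y + t *\<^sub>R w) -` (map_chart c ` dom_chart c)"
  have "open ?N"
    by (intro open_vimage open_image_chart[OF c] continuous_intros)
  moreover have "?f (?y + t *\<^sub>R w) = 0" if t: "t \<in> ?N" for t
  proof -
    have "(?y + t *\<^sub>R w) \<bullet> b = 0" using slice_iff[OF s q(1)] q(2) w by (simp add: inner_add_left)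
    then have "inv_chart c (?y + t *\<^sub>R w) \<in> S"
      using slice_iff[OF s, of "inv_chart c (?y + t *\<^sub>R w)"] t inv_chart_in[OF c] map_inv_chart[OF c] by auto
    then show ?thesis using f by simp
  qed
  ultimately have "((\<lambda>t. 0::real) has_derivative (\<lambda>t. pd c (t *\<^sub>R w) q f)) (at 0)"
    by (intro has_derivative_transform_within_open[OF d, of ?N]) (use q in auto)
  then have "(\<lambda>t. pd c (t *\<^sub>R w) q f) = (\<lambda>t. 0)"
    using has_derivative_unique has_derivative_const by blast
  then have "pd c (1 *\<^sub>R w) q f = 0" by meson
  then show "pd c w q f = 0" by simp
qed

end

context lorentz begin

lemma tangent_sub_iff:
  assumes s: "slice S c b" and lf: "local_frame c V x F" and q: "q \<in> V" "q \<in> S" and v: "v \<in> T q"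
  shows "v \<in> tangent_sub A S q \<longleftrightarrow> v (x b) = 0"
proof
  assume "v \<in> tangent_sub A S q"
  then show "v (x b) = 0"
  proof (rule tangent_sub_eq_0[OF _ q(2) local_frame_Cinf[OF lf] local_frame_chart(2)[OF lf] q(1)])
    fix r assume "r \<in> V" "r \<in> S"
    then show "x b r = 0"
      using slice_iff[OF s, of r] local_frame_chart(4)[OF lf] local_frame_x[OF lf] by auto
  qed
next
  assume 0: "v (x b) = 0"
  have "v (x i) \<cdot>\<^sub>v pd c i q \<in> tangent_sub A S q" if i: "i \<in> Basis" for i
  proof (cases "i = b")
    case True then show ?thesis using 0 tangent_sub_0 by simp
  next
    case False
    then have "i \<bullet> b = 0" using i sliceD(2)[OF s] by (simp add: inner_Basis)
    then show ?thesis
      by (intro tangent_sub_scale pd_tangent_sub[OF s] local_frame_chart(4)[OF lf] q)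
  qed
  then show "v \<in> tangent_sub A S q"
    using tangent_sub_sum[of Basis "\<lambda>i. v (x i) \<cdot>\<^sub>v pd c i q" S q] tangent_expansion[OF lf q(1) v] by simp
qed

lemma tangent_sub_expansion:
  assumes s: "slice S c b" and lf: "local_frame c V x F" and q: "q \<in> V" "q \<in> S" and v: "v \<in> tangent_sub A S q"
  shows "v = (\<Sum>i\<in>Basis - {b}. v (x i) \<cdot>\<^sub>v pd c i q)"
proof -
  have vT: "v \<in> T q" using v by (rule tangent_sub_tangent)
  have "v = v (x b) \<cdot>\<^sub>v pd c b q + (\<Sum>i\<in>Basis - {b}. v (x i) \<cdot>\<^sub>v pd c i q)"
    using tangent_expansion[OF lf q(1) vT] sum.remove[OF finite_Basis sliceD(2)[OF s], of "\<lambda>i. v (x i) \<cdot>\<^sub>v pd c i q"]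
    by argo
  then show ?thesis using tangent_sub_iff[OF s lf q vT] v by simp
qed

lemma tangent_sub_pdE:
  assumes s: "slice S c b" and lf: "local_frame c V x F" and q: "q \<in> V" "q \<in> S" and v: "v \<in> tangent_sub A S q"
  obtains w where "v = pd c w q" "w \<bullet> b = 0"
proof -
  note lc = local_frame_chart(1)[OF lf] local_frame_chart(4)[OF lf q(1)]
  obtain w where w: "v = pd c w q" using tangent_eq_pd[OF lc tangent_sub_tangent[OF v]] by blast
  have "w \<bullet> b = 0"
    using tangent_sub_iff[OF s lf q tangent_sub_tangent[OF v]] v w local_frame_pd_x[OF lf q(1), of w b] by simp
  then show ?thesis using that w by blast
qed

text \<open>Components along \<open>S\<close> have local smooth extensions by definition; the local extensions of the field are glued with a
partition of unity on \<open>S\<close>.\<close>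

lemma vector_field_sub_extends:
  assumes S: "compact S" and X: "X \<in> vector_fields_sub A S"
  shows "\<exists>Y\<in>VF. \<forall>q\<in>S. Y q = X q"
proof -
  have "\<forall>p. \<exists>U Y. p \<in> S \<longrightarrow> open U \<and> p \<in> U \<and> Y \<in> VF \<and> (\<forall>q\<in>U \<inter> S. Y q = X q)"
  proof
    fix p
    show "\<exists>U Y. p \<in> S \<longrightarrow> open U \<and> p \<in> U \<and> Y \<in> VF \<and> (\<forall>q\<in>U \<inter> S. Y q = X q)"
    proof (cases "p \<in> S")
      case p: True
      obtain c where c: "c \<in> max_atlas A" "p \<in> dom_chart c" using atlas_covers[of p] atlas_le_max_atlas by metis
      obtain V x F where lf: "local_frame c V x F" "p \<in> V" using local_frame_exists[OF c, of UNIV] by auto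
      have "\<forall>i. \<exists>U f. open U \<and> p \<in> U \<and> f \<in> Cinf A \<and> (\<forall>q\<in>U \<inter> S. X q (x i) = f q)"
        using X local_frame_Cinf[OF lf(1)] p unfolding vector_fields_sub_def smooth_along_def act_def by fast
      then obtain U f where U: "\<And>i. open (U i)" "\<And>i. p \<in> U i" and f: "\<And>i. f i \<in> Cinf A"
        "\<And>i q. q \<in> U i \<Longrightarrow> q \<in> S \<Longrightarrow> X q (x i) = f i q" by (metis IntI)
      define Y where "Y = (\<Sum>i\<in>Basis. f i \<cdot>\<^sub>f F i)"
      let ?U = "V \<inter> (\<Inter>i\<in>Basis. U i)"
      have "open ?U" using U local_frame_chart(2)[OF lf(1)] by (intro open_Int open_INT finite_Basis) auto
      moreover have "Y q = X q" if q: "q \<in> ?U" "q \<in> S" for q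
      proof -
        have "Y q = (\<Sum>i\<in>Basis. f i q \<cdot>\<^sub>v F i q)" by (simp add: Y_def sum_fun_apply)
        also have "\<dots> = (\<Sum>i\<in>Basis. X q (x i) \<cdot>\<^sub>v pd c i q)"
          using q f(2) local_frame_F[OF lf(1)] by (intro sum.cong) auto
        also have "\<dots> = X q"
          using X q by (intro tangent_expansion[OF lf(1), symmetric] tangent_sub_tangent[where S=S])
            (auto simp: vector_fields_sub_def)
        finally show ?thesis .
      qed
      moreover have "Y \<in> VF" unfolding Y_def by (intro VF_sum VF_fscale f local_frame_VF[OF lf(1)])
      ultimately show ?thesis using lf(2) U by (intro exI[of _ ?U] exI[of _ Y]) auto
    qed simp
  qed
  then obtain U Y where U: "\<And>p. p \<in> S \<Longrightarrow> open (U p) \<and> p \<in> U p" and Y: "\<And>p. p \<in> S \<Longrightarrow> Y p \<in> VF"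
    "\<And>p q. p \<in> S \<Longrightarrow> q \<in> U p \<Longrightarrow> q \<in> S \<Longrightarrow> Y p q = X q"
    by (metis IntI)
  obtain n :: nat and pt \<rho> K where
    P: "\<And>k. k < n \<Longrightarrow> pt k \<in> S \<and> \<rho> k \<in> Cinf A \<and> compact (K k) \<and> K k \<subseteq> U (pt k)"
    "\<And>k q. k < n \<Longrightarrow> 0 \<le> \<rho> k q" "\<And>k q. k < n \<Longrightarrow> q \<notin> K k \<Longrightarrow> \<rho> k q = 0"
    "\<And>q. q \<in> S \<Longrightarrow> (\<Sum>k<n. \<rho> k q) = 1"
    by (rule partition_of_unity[OF S U]) blast+
  define Z where "Z = (\<Sum>k<n. \<rho> k \<cdot>\<^sub>f Y (pt k))"
  have "Z q = X q" if q: "q \<in> S" for q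
  proof -
    have "Z q = (\<Sum>k<n. \<rho> k q \<cdot>\<^sub>v Y (pt k) q)" by (simp add: Z_def sum_fun_apply)
    also have "\<dots> = (\<Sum>k<n. \<rho> k q \<cdot>\<^sub>v X q)"
    proof (intro sum.cong refl)
      fix k assume "k \<in> {..<n}"
      then have k: "k < n" by simp
      show "\<rho> k q \<cdot>\<^sub>v Y (pt k) q = \<rho> k q \<cdot>\<^sub>v X q"
        using P(1)[OF k] P(3)[OF k] Y(2)[of "pt k" q] q by (cases "q \<in> K k") auto
    qed
    also have "\<dots> = (\<Sum>k<n. \<rho> k q) \<cdot>\<^sub>v X q" by (simp add: fun_eq_iff sum_fun_apply sum_distrib_right)
    finally show ?thesis using P(4)[OF q] by simp
  qed
  moreover have "Z \<in> VF" unfolding Z_def using P(1) Y(1) by (intro VF_sum VF_fscale) auto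
  ultimately show ?thesis by blast
qed

end

section \<open>Geometry of a null hypersurface\<close>

locale null_hypersurface = unit_killing A g D E
  for A :: "('m::{t2_space, second_countable_topology}, 'e::euclidean_space) chart set" and g :: "'m metric"
    and D :: "'m vfield \<Rightarrow> 'm vfield \<Rightarrow> 'm vfield" and E :: "'m vfield" +
  fixes S :: "'m set" and \<xi> :: "'m vfield"
  assumes null: "lightlike_hypersurface A g S" and compact_S: "compact S"
    and \<xi>_field: "lightlike_field_sub A g S \<xi>"
    and \<xi>_norm: "\<And>p. p \<in> S \<Longrightarrow> g p (\<xi> p) (E p) = 1 / sqrt 2"
begin

text \<open>A global extension of \<open>\<xi>\<close>; covariant derivatives along \<open>S\<close> do not depend on it.\<close>

definition "\<Xi> = (SOME X. X \<in> VF \<and> (\<forall>q\<in>S. X q = \<xi> q))"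

lemma \<Xi>_VF [simp, intro]: "\<Xi> \<in> VF" and \<Xi>_eq: "q \<in> S \<Longrightarrow> \<Xi> q = \<xi> q"
proof -
  have "\<exists>X. X \<in> VF \<and> (\<forall>q\<in>S. X q = \<xi> q)"
    using vector_field_sub_extends[OF compact_S, of \<xi>] \<xi>_field by (auto simp: lightlike_field_sub_def)
  then have "\<Xi> \<in> VF \<and> (\<forall>q\<in>S. \<Xi> q = \<xi> q)" unfolding \<Xi>_def by (rule someI_ex)
  then show "\<Xi> \<in> VF" "q \<in> S \<Longrightarrow> \<Xi> q = \<xi> q" by auto
qed

abbreviation "TS \<equiv> tangent_sub A S"

lemma TS_T: "v \<in> TS p \<Longrightarrow> v \<in> T p" by (rule tangent_sub_tangent)

lemma ET: "E p \<in> T p" and \<Xi>T: "\<Xi> p \<in> T p" by (simp_all add: VF_at)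

lemma slice_at: assumes "p \<in> S" obtains c b V x F where "slice S c b" "local_frame c V x F" "p \<in> V"
proof -
  obtain c b where c: "slice S c b" "p \<in> dom_chart c"
    using hypersurface_slice[OF _ assms] null by (auto simp: lightlike_hypersurface_def)
  obtain V x F where "local_frame c V x F" "p \<in> V" using local_frame_exists[OF sliceD(1)[OF c(1)] c(2), of UNIV] by auto
  then show ?thesis using that c by blast
qed

lemma
  assumes p: "p \<in> S"
  shows \<Xi>_TS: "\<Xi> p \<in> TS p" and \<Xi>_null: "g p (\<Xi> p) (\<Xi> p) = 0"
    and \<Xi>_E: "g p (\<Xi> p) (E p) = 1 / sqrt 2" and E_\<Xi>: "g p (E p) (\<Xi> p) = 1 / sqrt 2"
proof -
  show "\<Xi> p \<in> TS p" "g p (\<Xi> p) (\<Xi> p) = 0" and 1: "g p (\<Xi> p) (E p) = 1 / sqrt 2"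
    using \<xi>_field \<xi>_norm[OF p] p \<Xi>_eq[OF p] by (auto simp: lightlike_field_sub_def vector_fields_sub_def)
  show "g p (E p) (\<Xi> p) = 1 / sqrt 2" using 1 g_sym[OF ET \<Xi>T, of p] by (rule_tac trans)
qed

lemma E_complement_pos: "v \<in> T p \<Longrightarrow> g p v (E p) = 0 \<Longrightarrow> v \<noteq> 0 \<Longrightarrow> g p v v > 0"
  by (rule timelike_complement_pos[OF ET]) auto

text \<open>The degenerate direction \<open>n\<close> of the hypersurface is proportional to \<open>\<xi>\<close>: the combination of the two that is orthogonal
to \<open>E\<close> is null, hence zero. So the tangent space is contained in the orthogonal complement of \<open>\<xi>\<close>, and both are
complementary to \<open>E\<close>.\<close>

lemma TS_iff:
  assumes p: "p \<in> S" and v: "v \<in> T p"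
  shows "v \<in> TS p \<longleftrightarrow> g p v (\<Xi> p) = 0"
proof -
  obtain n where n: "n \<in> TS p" "n \<noteq> 0" "\<And>w. w \<in> TS p \<Longrightarrow> g p n w = 0"
    using null p by (auto simp: lightlike_hypersurface_def)
  note nT = TS_T[OF n(1)] and \<Xi>S = \<Xi>_TS[OF p]
  have nE: "g p n (E p) \<noteq> 0" using E_complement_pos[OF nT _ n(2)] n(3)[OF n(1)] by auto
  define k where "k = g p (\<Xi> p) (E p) / g p n (E p)"
  define u where "u = \<Xi> p - k \<cdot>\<^sub>v n"
  have uT: "u \<in> T p" using nT \<Xi>T by (simp add: u_def)
  have "g p u (E p) = 0" using nE nT \<Xi>T ET by (simp add: u_def g_left k_def)
  moreover have "g p u u = 0"
    using nT \<Xi>T n(3)[OF n(1)] n(3)[OF \<Xi>S] g_sym[OF nT \<Xi>T] \<Xi>_null[OF p]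
    by (simp add: u_def g_left g_right)
  ultimately have "u = 0" using E_complement_pos[OF uT] by auto
  then have \<Xi>n: "\<Xi> p = k \<cdot>\<^sub>v n" by (simp add: u_def)
  have fwd: "g p w (\<Xi> p) = 0" if "w \<in> TS p" for w
    using n(3)[OF that] g_sym[OF nT TS_T[OF that]] TS_T[OF that] nT by (simp add: \<Xi>n g_right)
  obtain c b V x F where sl: "slice S c b" "local_frame c V x F" "p \<in> V" using slice_at[OF p] by metis
  note iff = tangent_sub_iff[OF sl p]
  have Eb: "E p (x b) \<noteq> 0" using iff[OF ET] fwd[of "E p"] E_\<Xi>[OF p] by auto
  define t where "t = v (x b) / E p (x b)"
  have "v - t \<cdot>\<^sub>v E p \<in> TS p" using Eb v ET by (subst iff) (auto simp: t_def)
  then have "g p (v - t \<cdot>\<^sub>v E p) (\<Xi> p) = 0" by (rule fwd)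
  then have "g p v (\<Xi> p) = t / sqrt 2" using v ET \<Xi>T E_\<Xi>[OF p] by (simp add: g_left)
  then show ?thesis using iff[OF v] Eb by (auto simp: t_def)
qed

text \<open>The global field that restricts on \<open>S\<close> to the transversal null field \<open>N\<close>.\<close>

definition "NN = (\<lambda>_. sqrt 2) \<cdot>\<^sub>f E + \<Xi>"

lemma NN_VF [simp, intro]: "NN \<in> VF" unfolding NN_def by (intro VF_add VF_fscale Cinf_const E_VF \<Xi>_VF)

lemma NN_at: "NN p = sqrt 2 \<cdot>\<^sub>v E p + \<Xi> p" by (simp add: NN_def)

lemma NNT: "NN p \<in> T p" by (simp add: VF_at)

lemma g_NN: "v \<in> T p \<Longrightarrow> g p v (NN p) = sqrt 2 * g p v (E p) + g p v (\<Xi> p)"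
  using ET \<Xi>T by (simp add: NN_at g_right)

lemma
  assumes p: "p \<in> S"
  shows \<Xi>_NN: "g p (\<Xi> p) (NN p) = 1" and NN_NN: "g p (NN p) (NN p) = 0"
    and NN_\<Xi>: "g p (NN p) (\<Xi> p) = 1"
proof -
  have s: "sqrt 2 * sqrt 2 = (2::real)" "1 / sqrt 2 = sqrt 2 / (2::real)" by (auto simp: field_simps)
  show 1: "g p (\<Xi> p) (NN p) = 1" using p by (simp add: g_NN[OF \<Xi>T] \<Xi>_E \<Xi>_null)
  show 2: "g p (NN p) (\<Xi> p) = 1" using 1 g_sym[OF \<Xi>T NNT] by simp
  have 3: "g p (NN p) (E p) = - 1 / sqrt 2" using p ET \<Xi>T by (simp add: NN_at g_left \<Xi>_E s)
  show "g p (NN p) (NN p) = 0" by (simp add: g_NN[OF NNT] 2 3)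
qed

lemma symmetric_wrt_eq:
  assumes p: "p \<in> S"
  shows "symmetric_wrt A g E p (- \<xi> p) = NN p"
  unfolding symmetric_wrt_def
proof (rule the_equality)
  let ?y = "- \<Xi> p - (1 / sqrt 2) \<cdot>\<^sub>v E p"
  have s: "2 / sqrt 2 = sqrt (2::real)" by (simp add: real_div_sqrt)
  have "?y \<in> T p" using ET \<Xi>T by simp
  moreover have "g p ?y (E p) = 0" using ET \<Xi>T \<Xi>_E[OF p] by (simp add: g_left)
  moreover have "NN p = (1 / sqrt 2) \<cdot>\<^sub>v E p - ?y"
  proof
    fix f
    have "NN p f = (2 / sqrt 2) * E p f + \<Xi> p f" by (simp add: NN_at s)
    then show "NN p f = ((1 / sqrt 2) \<cdot>\<^sub>v E p - ?y) f" by (simp add: field_simps)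
  qed
  ultimately show "\<exists>a. \<exists>y\<in>T p. g p y (E p) = 0 \<and> - \<xi> p = a \<cdot>\<^sub>v E p + y \<and> NN p = a \<cdot>\<^sub>v E p - y"
    using \<Xi>_eq[OF p] by (intro exI[of _ "1 / sqrt 2"] bexI[of _ ?y]) auto
  fix w assume "\<exists>a. \<exists>y\<in>T p. g p y (E p) = 0 \<and> - \<xi> p = a \<cdot>\<^sub>v E p + y \<and> w = a \<cdot>\<^sub>v E p - y"
  then obtain a y where y: "y \<in> T p" "g p y (E p) = 0" "- \<Xi> p = a \<cdot>\<^sub>v E p + y" "w = a \<cdot>\<^sub>v E p - y"
    using \<Xi>_eq[OF p] by auto
  have "g p (- \<Xi> p) (E p) = - a" unfolding y(3) using y ET by (simp add: g_left)
  then have a: "a = 1 / sqrt 2" using ET \<Xi>T \<Xi>_E[OF p] by (simp add: g_left)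
  have "(- \<Xi> p) f = (a \<cdot>\<^sub>v E p + y) f" for f unfolding y(3) ..
  then have yf: "y f = - \<Xi> p f - a * E p f" for f by (simp add: algebra_simps)
  show "w = NN p"
  proof
    fix f
    have "w f = a * E p f - y f" by (simp add: y(4))
    also have "\<dots> = (2 / sqrt 2) * E p f + \<Xi> p f" by (simp add: yf a field_simps)
    finally show "w f = NN p f" by (simp add: NN_at s)
  qed
qed

subsection \<open>Frames adapted to the null hypersurface\<close>

text \<open>The projection onto the tangent space of \<open>S\<close> along \<open>E\<close>.\<close>

definition "proj p v = v - (sqrt 2 * g p v (\<Xi> p)) \<cdot>\<^sub>v E p"

lemma proj_endo: "endomorphism p (proj p)"
  unfolding endomorphism_def using ET \<Xi>T
  by (auto simp: proj_def g_left algebra_simps fun_eq_iff)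

lemma projT: "v \<in> T p \<Longrightarrow> proj p v \<in> T p" using endo_in[OF proj_endo] .

lemma proj_TS: "p \<in> S \<Longrightarrow> v \<in> T p \<Longrightarrow> proj p v \<in> TS p"
  using ET \<Xi>T by (subst TS_iff[OF _ projT]) (auto simp: proj_def g_left E_\<Xi>)

lemma proj_id: "p \<in> S \<Longrightarrow> v \<in> TS p \<Longrightarrow> proj p v = v"
  using TS_iff[of p v] TS_T by (simp add: proj_def)

lemma proj_E: "p \<in> S \<Longrightarrow> proj p (E p) = 0"
  by (simp add: proj_def E_\<Xi>)

lemma proj_NN: "p \<in> S \<Longrightarrow> proj p (NN p) = \<Xi> p"
  by (simp add: proj_def NN_\<Xi>) (simp add: NN_at)

lemma TS_nondegenerate:
  assumes p: "p \<in> S" and u: "u \<in> T p" and "\<And>z. z \<in> TS p \<Longrightarrow> g p u z = 0" "g p u (E p) = 0"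
  shows "u = 0"
proof (rule g_nondegenerate[OF u])
  fix w assume w: "w \<in> T p"
  have "w = proj p w + (sqrt 2 * g p w (\<Xi> p)) \<cdot>\<^sub>v E p" by (simp add: proj_def)
  then have "g p u w = g p u (proj p w + (sqrt 2 * g p w (\<Xi> p)) \<cdot>\<^sub>v E p)" by (rule arg_cong)
  then show "g p u w = 0" using assms(3)[OF proj_TS[OF p w]] assms(4) u w projT[OF w] ET by (simp add: g_right)
qed

text \<open>The resolution of the identity given by the coordinate vectors tangent to \<open>S\<close> together with \<open>E\<close>.\<close>

lemma tr_slice:
  assumes p: "p \<in> S" and s: "slice S c b" and lf: "local_frame c V x F" "p \<in> V" and Q: "endomorphism p Q"
  shows "tr p Q = (\<Sum>i\<in>Basis - {b}. proj p (Q (pd c i p)) (x i)) + sqrt 2 * g p (Q (E p)) (\<Xi> p)"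
proof -
  define \<theta> where "\<theta> i v = (if i = b then sqrt 2 * g p v (\<Xi> p) else proj p v (x i))" for i v
  define B where "B i = (if i = b then E p else pd c i p)" for i
  have b: "b \<in> Basis" using sliceD(2)[OF s] .
  note pc = local_frame_chart(1)[OF lf(1)] local_frame_chart(4)[OF lf(1,2)]
  have "tr p Q = (\<Sum>i\<in>Basis. \<theta> i (Q (B i)))"
  proof (rule tr_eq[OF Q])
    fix i
    show "linear_form p (\<theta> i)"
      unfolding \<theta>_def[abs_def] using linear_form_endo[OF linear_form_eval[OF local_frame_Cinf[OF lf(1)]] proj_endo]
      by (cases "i = b") (auto intro!: linear_form_const_mult linear_form_g \<Xi>T)
    show "B i \<in> T p" using ET pd_tangent[OF pc] by (simp add: B_def)
  next
    fix v assume v: "v \<in> T p"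
    have "proj p v = (\<Sum>i\<in>Basis - {b}. proj p v (x i) \<cdot>\<^sub>v pd c i p)"
      by (rule tangent_sub_expansion[OF s lf p proj_TS[OF p v]])
    also have "\<dots> = (\<Sum>i\<in>Basis - {b}. \<theta> i v \<cdot>\<^sub>v B i)" by (intro sum.cong) (auto simp: \<theta>_def B_def)
    finally have 1: "proj p v = (\<Sum>i\<in>Basis - {b}. \<theta> i v \<cdot>\<^sub>v B i)" .
    have "v = \<theta> b v \<cdot>\<^sub>v B b + proj p v" by (simp add: proj_def \<theta>_def B_def)
    then have "v = \<theta> b v \<cdot>\<^sub>v B b + (\<Sum>i\<in>Basis - {b}. \<theta> i v \<cdot>\<^sub>v B i)" unfolding 1 .
    then show "v = (\<Sum>i\<in>Basis. \<theta> i v \<cdot>\<^sub>v B i)"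
      unfolding sum.remove[OF finite_Basis b, of "\<lambda>i. \<theta> i v \<cdot>\<^sub>v B i"] .
  qed
  also have "\<dots> = \<theta> b (Q (B b)) + (\<Sum>i\<in>Basis - {b}. \<theta> i (Q (B i)))" by (rule sum.remove[OF finite_Basis b])
  also have "(\<Sum>i\<in>Basis - {b}. \<theta> i (Q (B i))) = (\<Sum>i\<in>Basis - {b}. proj p (Q (pd c i p)) (x i))"
    by (intro sum.cong) (auto simp: \<theta>_def B_def)
  finally show ?thesis by (simp add: \<theta>_def B_def)
qed

abbreviation "scr \<equiv> screen A g E S"

lemma scr_iff: "p \<in> S \<Longrightarrow> v \<in> scr p \<longleftrightarrow> v \<in> T p \<and> g p v (E p) = 0 \<and> g p v (\<Xi> p) = 0"
  using TS_iff[of p v] TS_T[of v p] by (auto simp: screen_def)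

text \<open>The projection onto the screen along \<open>\<xi>\<close> and \<open>N\<close>.\<close>

definition "scrP p v = v - g p v (NN p) \<cdot>\<^sub>v \<Xi> p - g p v (\<Xi> p) \<cdot>\<^sub>v NN p"

lemma scrP_endo: "endomorphism p (scrP p)"
  unfolding endomorphism_def using NNT \<Xi>T
  by (auto simp: scrP_def g_left algebra_simps fun_eq_iff)

lemma scrP_in: assumes p: "p \<in> S" and v: "v \<in> T p" shows "scrP p v \<in> scr p"
proof -
  have PT: "scrP p v \<in> T p" by (rule endo_in[OF scrP_endo v])
  have 1: "g p (scrP p v) (\<Xi> p) = 0" using v NNT \<Xi>T p by (simp add: scrP_def g_left \<Xi>_null NN_\<Xi>)
  have "g p (scrP p v) (NN p) = 0" using v NNT \<Xi>T p by (simp add: scrP_def g_left \<Xi>_NN NN_NN)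
  then have "g p (scrP p v) (E p) = 0" using 1 g_NN[OF PT] by simp
  then show ?thesis using scr_iff[OF p] PT 1 by simp
qed

lemma scr_NN: "p \<in> S \<Longrightarrow> v \<in> scr p \<Longrightarrow> g p v (NN p) = 0"
  using scr_iff g_NN by simp

lemma screen_expansion:
  assumes p: "p \<in> S" and e: "orthonormal_basis (g p) (scr p) k e" and v: "v \<in> T p"
  shows "v = (\<Sum>i<k. g p v (e i) \<cdot>\<^sub>v e i) + g p v (NN p) \<cdot>\<^sub>v \<Xi> p + g p v (\<Xi> p) \<cdot>\<^sub>v NN p"
    and "\<And>i. i < k \<Longrightarrow> g p (e i) (e i) = 1"
proof -
  have eS: "e i \<in> scr p" if "i < k" for i using e that by (auto simp: orthonormal_basis_def)
  have eT: "e i \<in> T p" if "i < k" for i using eS[OF that] scr_iff[OF p] by simp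
  show 1: "g p (e i) (e i) = 1" if i: "i < k" for i
  proof -
    have "g p (e i) (e i) = 1 \<or> g p (e i) (e i) = -1" using e i by (auto simp: orthonormal_basis_def)
    moreover have "g p (e i) (e i) \<ge> 0"
      using E_complement_pos[OF eT[OF i]] eS[OF i] scr_iff[OF p] g_0_left[of 0 p] by (cases "e i = 0") auto
    ultimately show ?thesis by auto
  qed
  have "scrP p v = (\<Sum>i<k. (g p (e i) (e i) * g p (scrP p v) (e i)) \<cdot>\<^sub>v e i)"
    by (rule orthonormal_expansion[OF e _ scrP_in[OF p v]]) (use scr_iff[OF p] in auto)
  also have "\<dots> = (\<Sum>i<k. g p v (e i) \<cdot>\<^sub>v e i)"
  proof (intro sum.cong refl)
    fix i assume "i \<in> {..<k}"
    then have i: "i < k" by simp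
    have "g p (\<Xi> p) (e i) = 0" using g_sym[OF \<Xi>T eT[OF i]] eS[OF i] scr_iff[OF p] by simp
    moreover have "g p (NN p) (e i) = 0" using g_sym[OF NNT eT[OF i]] scr_NN[OF p eS[OF i]] by simp
    ultimately have "g p (scrP p v) (e i) = g p v (e i)"
      using v NNT \<Xi>T eT[OF i] by (simp add: scrP_def g_left)
    then show "(g p (e i) (e i) * g p (scrP p v) (e i)) \<cdot>\<^sub>v e i = g p v (e i) \<cdot>\<^sub>v e i" using 1[OF i] by simp
  qed
  finally have "scrP p v = (\<Sum>i<k. g p v (e i) \<cdot>\<^sub>v e i)" .
  moreover have "v = scrP p v + g p v (NN p) \<cdot>\<^sub>v \<Xi> p + g p v (\<Xi> p) \<cdot>\<^sub>v NN p" by (simp add: scrP_def)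
  ultimately show "v = (\<Sum>i<k. g p v (e i) \<cdot>\<^sub>v e i) + g p v (NN p) \<cdot>\<^sub>v \<Xi> p + g p v (\<Xi> p) \<cdot>\<^sub>v NN p" by argo
qed

text \<open>The resolution of the identity given by an orthonormal basis of the screen together with the dual pair of null vectors
\<open>\<xi>\<close> and \<open>N\<close>, which are stored at the indices \<open>k\<close> and \<open>k + 1\<close>.\<close>

lemma tr_screen:
  assumes p: "p \<in> S" and e: "orthonormal_basis (g p) (scr p) k e" and Q: "endomorphism p Q"
  shows "tr p Q = (\<Sum>i<k. g p (Q (e i)) (e i)) + g p (Q (\<Xi> p)) (NN p) + g p (Q (NN p)) (\<Xi> p)"
proof -
  define d where "d i = (if i = k then NN p else if i = Suc k then \<Xi> p else e i)" for i
  define B where "B i = (if i = k then \<Xi> p else if i = Suc k then NN p else e i)" for i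
  have eT: "e i \<in> T p" if "i < k" for i using e that scr_iff[OF p] by (auto simp: orthonormal_basis_def)
  have "tr p Q = (\<Sum>i<Suc (Suc k). g p (Q (B i)) (d i))"
  proof (rule tr_eq[OF Q])
    fix i assume "i \<in> {..<Suc (Suc k)}"
    then have "d i \<in> T p \<and> B i \<in> T p" using eT NNT \<Xi>T by (auto simp: d_def B_def less_Suc_eq)
    then show "linear_form p (\<lambda>v. g p v (d i))" "B i \<in> T p" using linear_form_g by auto
  next
    fix v assume v: "v \<in> T p"
    have "(\<Sum>i<k. g p v (e i) \<cdot>\<^sub>v e i) = (\<Sum>i<k. g p v (d i) \<cdot>\<^sub>v B i)"
      by (intro sum.cong) (auto simp: d_def B_def)
    then have "v = (\<Sum>i<k. g p v (d i) \<cdot>\<^sub>v B i) + g p v (d k) \<cdot>\<^sub>v B k + g p v (d (Suc k)) \<cdot>\<^sub>v B (Suc k)"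
      using screen_expansion(1)[OF p e v] by (simp only: d_def B_def if_True n_not_Suc_n refl if_False Suc_n_not_n)
    then show "v = (\<Sum>i<Suc (Suc k). g p v (d i) \<cdot>\<^sub>v B i)" unfolding sum.lessThan_Suc .
  qed
  also have "\<dots> = (\<Sum>i<k. g p (Q (B i)) (d i)) + g p (Q (\<Xi> p)) (NN p) + g p (Q (NN p)) (\<Xi> p)"
    by (simp add: d_def B_def)
  also have "(\<Sum>i<k. g p (Q (B i)) (d i)) = (\<Sum>i<k. g p (Q (e i)) (e i))"
    by (intro sum.cong) (auto simp: d_def B_def)
  finally show ?thesis .
qed

text \<open>The basis that is chosen in the definition of the mean curvature.\<close>

definition "scr_onb p = (SOME e. orthonormal_basis (g p) (scr p) (DIM('e) - 2) e)"

text \<open>The projections of a basis of the tangent space span the screen, and Gram--Schmidt makes them an orthonormal basis with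
some number \<open>k\<close> of vectors. The trace of the identity is the dimension, and it is \<open>k + 2\<close> by \<open>tr_screen\<close>.\<close>

lemma scr_onb: assumes p: "p \<in> S" shows "orthonormal_basis (g p) (scr p) (DIM('e) - 2) (scr_onb p)"
proof -
  let ?f = "\<lambda>i. scrP p (tangent_onb p i)"
  have fT: "i \<in> {..<DIM('e)} \<Longrightarrow> tangent_onb p i \<in> T p" for i using tangent_onb_in by auto
  have "\<exists>(k::nat) e. (\<forall>i<k. e i \<in> scr p) \<and> (\<forall>i<k. g p (e i) (e i) = 1) \<and> (\<forall>i<k. \<forall>j<k. i \<noteq> j \<longrightarrow> g p (e i) (e j) = 0) \<and>
     (\<forall>a. \<exists>a'. (\<Sum>i<DIM('e). a i \<cdot>\<^sub>v ?f i) = (\<Sum>i<k. a' i \<cdot>\<^sub>v e i))"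
  proof (rule gram_schmidt)
    show "scr p \<subseteq> T p" "0 \<in> scr p" using scr_iff[OF p] ET \<Xi>T by (auto simp: g_left)
    show "a \<cdot>\<^sub>v u + v \<in> scr p" if "u \<in> scr p" "v \<in> scr p" for u v a
      using that scr_iff[OF p] ET \<Xi>T by (auto simp: g_left)
    show "0 < g p v v" if "v \<in> scr p" "v \<noteq> 0" for v using that scr_iff[OF p] E_complement_pos by auto
    show "?f i \<in> scr p" if "i < DIM('e)" for i using fT that scrP_in[OF p] by auto
  qed
  then obtain k :: nat and e where e: "(\<forall>i<k. e i \<in> scr p) \<and> (\<forall>i<k. g p (e i) (e i) = 1) \<and>
     (\<forall>i<k. \<forall>j<k. i \<noteq> j \<longrightarrow> g p (e i) (e j) = 0) \<and>
     (\<forall>a. \<exists>a'. (\<Sum>i<DIM('e). a i \<cdot>\<^sub>v ?f i) = (\<Sum>i<k. a' i \<cdot>\<^sub>v e i))"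
    by (elim exE)
  have "\<exists>a. v = (\<Sum>i<k. a i \<cdot>\<^sub>v e i)" if v: "v \<in> scr p" for v
  proof -
    have vT: "v \<in> T p" using v scr_iff[OF p] by simp
    define a where "a i = g p (tangent_onb p i) (tangent_onb p i) * g p v (tangent_onb p i)" for i
    have "v = scrP p v" using v scr_iff[OF p] scr_NN[OF p v] by (simp add: scrP_def)
    also have "\<dots> = scrP p (\<Sum>i<DIM('e). a i \<cdot>\<^sub>v tangent_onb p i)"
      unfolding a_def by (rule arg_cong[OF orthonormal_expansion[OF tangent_onb order_refl vT]])
    also have "\<dots> = (\<Sum>i<DIM('e). a i \<cdot>\<^sub>v ?f i)" by (rule endo_sum[OF scrP_endo fT])
    finally show ?thesis using e by metis
  qed
  then have "\<forall>v\<in>scr p. \<exists>a. v = (\<Sum>i<k. a i \<cdot>\<^sub>v e i)" by (rule ballI)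
  then have onb: "orthonormal_basis (g p) (scr p) k e"
    unfolding orthonormal_basis_def using conjunct1[OF e] conjunct1[OF conjunct2[OF e]]
      conjunct1[OF conjunct2[OF conjunct2[OF e]]] by (intro conjI) simp_all
  have "endomorphism p (\<lambda>v. v)" by (simp add: endomorphism_def)
  from tr_screen[OF p onb this] have "real DIM('e) = (\<Sum>i<k. g p (e i) (e i)) + 2"
    using p by (simp add: tr_id \<Xi>_NN NN_\<Xi>)
  also have "(\<Sum>i<k. g p (e i) (e i)) = real k" using e by simp
  finally have "k = DIM('e) - 2" by linarith
  then have "orthonormal_basis (g p) (scr p) (DIM('e) - 2) e" using onb by simp
  then show ?thesis
    unfolding scr_onb_def by (rule someI[where P="orthonormal_basis (g p) (scr p) (DIM('e) - 2)"])
qed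

end

section \<open>Covariant derivatives along the hypersurface\<close>

context connection begin

text \<open>The endomorphism \<open>v \<mapsto> \<nabla>\<^sub>v X\<close> of the tangent space at \<open>p\<close>.\<close>

definition "nab X p v = D (extend_vec A p v) X p"

lemma nab_eq: "V \<in> VF \<Longrightarrow> X \<in> VF \<Longrightarrow> nab X p (V p) = D V X p"
  unfolding nab_def by (rule D_cong_left) (simp_all add: extend_vec VF_at)

lemma nab_endo: assumes X: "X \<in> VF" shows "endomorphism p (nab X p)"
  unfolding endomorphism_def
proof (intro conjI ballI allI)
  fix u assume u: "u \<in> T p"
  show "nab X p u \<in> T p" unfolding nab_def by (rule VF_at[OF D_VF[OF extend_vec(1)[OF u] X]])
  fix v a assume v: "v \<in> T p"
  have uv: "a \<cdot>\<^sub>v u + v \<in> T p" using u v by simp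
  show "nab X p (a \<cdot>\<^sub>v u + v) = a \<cdot>\<^sub>v nab X p u + nab X p v"
    unfolding nab_def
    using D_lin_at[OF extend_vec(1)[OF u] extend_vec(1)[OF v] extend_vec(1)[OF uv] X, of p a 1]
    by (simp add: extend_vec(2)[OF u] extend_vec(2)[OF v] extend_vec(2)[OF uv])
qed

lemmas nabT = endo_in[OF nab_endo]

text \<open>A function that is constant on \<open>S\<close> near \<open>p\<close> has no derivative in directions tangent to \<open>S\<close>.\<close>

lemma D_metric_along:
  assumes V: "V \<in> VF" "V p \<in> tangent_sub A S p" and p: "p \<in> S" and Y: "Y \<in> VF" and Z: "Z \<in> VF"
    and U: "open U" "p \<in> U" "\<And>q. q \<in> U \<Longrightarrow> q \<in> S \<Longrightarrow> g q (Y q) (Z q) = k"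
  shows "g p (D V Y p) (Z p) + g p (Y p) (D V Z p) = 0"
proof -
  have "V p (\<lambda>q. g q (Y q) (Z q)) = V p (\<lambda>_. k)"
    by (rule tangent_sub_cong[OF V(2) p g_Cinf[OF Y Z] Cinf_const U(1,2)]) (rule U(3))
  then show ?thesis using D_metric[OF V(1) Y Z, of p] tangent_of_const[OF VF_at[OF V(1)], of p k] by simp
qed

end

context null_hypersurface begin

text \<open>The rotation of \<open>E\<close> in the direction \<open>\<xi>\<close>; it takes values in the screen.\<close>

definition "W = D \<Xi> E"

lemma W_VF [simp, intro]: "W \<in> VF" by (simp add: W_def)

lemma WT: "W p \<in> T p" by (simp add: VF_at)

lemma nabE_skew: assumes "u \<in> T p" "w \<in> T p" shows "g p (nab E p u) w = - g p u (nab E p w)"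
  using DE_skew[OF extend_vec(1)[OF assms(1)] extend_vec(1)[OF assms(2)], of p]
  by (simp add: nab_def extend_vec(2)[OF assms(1)] extend_vec(2)[OF assms(2)])

lemma nabE_E: assumes "u \<in> T p" shows "g p (nab E p u) (E p) = 0"
  using DE_E[OF extend_vec(1)[OF assms], of p] by (simp add: nab_def)

lemma nabE_\<Xi>: "nab E p (\<Xi> p) = W p"
  unfolding W_def by (rule nab_eq) auto

lemma W_E: "g p (W p) (E p) = 0" unfolding nabE_\<Xi>[symmetric] by (rule nabE_E[OF \<Xi>T])

lemma W_\<Xi>: "g p (W p) (\<Xi> p) = 0"
  using nabE_skew[OF \<Xi>T \<Xi>T, of p] g_sym[OF \<Xi>T WT, of p] by (simp add: nabE_\<Xi>)

lemma W_TS: "p \<in> S \<Longrightarrow> W p \<in> TS p" using TS_iff WT W_\<Xi> by simp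

lemma scr_TS: "v \<in> scr p \<Longrightarrow> v \<in> TS p" by (simp add: screen_def)

context
  fixes p assumes p: "p \<in> S"
begin

lemma nab\<Xi>_\<Xi>: assumes v: "v \<in> TS p" shows "g p (nab \<Xi> p v) (\<Xi> p) = 0"
proof -
  let ?V = "extend_vec A p v"
  have V: "?V \<in> VF" "?V p = v" using extend_vec[OF TS_T[OF v]] by auto
  have "g p (D ?V \<Xi> p) (\<Xi> p) + g p (\<Xi> p) (D ?V \<Xi> p) = 0"
    by (rule D_metric_along[OF V(1) _ p \<Xi>_VF \<Xi>_VF open_UNIV UNIV_I \<Xi>_null]) (use V v in auto)
  then show ?thesis using g_sym[OF \<Xi>T nabT[OF \<Xi>_VF TS_T[OF v]]] by (simp add: nab_def)
qed

lemma nab\<Xi>_TS: "v \<in> TS p \<Longrightarrow> nab \<Xi> p v \<in> TS p"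
  using TS_iff[OF p nabT[OF \<Xi>_VF TS_T]] nab\<Xi>_\<Xi> by simp

lemma nab\<Xi>_E: assumes v: "v \<in> TS p" shows "g p (nab \<Xi> p v) (E p) = g p v (W p)"
proof -
  let ?V = "extend_vec A p v"
  have V: "?V \<in> VF" "?V p = v" using extend_vec[OF TS_T[OF v]] by auto
  have "g p (D ?V \<Xi> p) (E p) + g p (\<Xi> p) (D ?V E p) = 0"
    by (rule D_metric_along[OF V(1) _ p \<Xi>_VF E_VF open_UNIV UNIV_I \<Xi>_E]) (use V v in auto)
  then have "g p (nab \<Xi> p v) (E p) = - g p (\<Xi> p) (nab E p v)" by (simp add: nab_def)
  also have "\<dots> = g p (W p) v" using nabE_skew[OF \<Xi>T TS_T[OF v]] by (simp add: nabE_\<Xi>)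
  finally show ?thesis using g_sym[OF WT TS_T[OF v]] by simp
qed

text \<open>Symmetry of the second fundamental form: extend the two vectors by commuting coordinate fields
  that are tangent to the hypersurface.\<close>

lemma nab\<Xi>_sym: assumes v: "v \<in> TS p" and w: "w \<in> TS p" shows "g p (nab \<Xi> p v) w = g p (nab \<Xi> p w) v"
proof -
  obtain c b V x F where sl: "slice S c b" "local_frame c V x F" "p \<in> V" using slice_at[OF p] by metis
  have "\<exists>v'. v = pd c v' p \<and> v' \<bullet> b = 0" if "v \<in> TS p" for v
    by (rule tangent_sub_pdE[OF sl p that]) blast
  then obtain v' w' where v': "v = pd c v' p" "v' \<bullet> b = 0" and w': "w = pd c w' p" "w' \<bullet> b = 0"
    using v w by metis
  note F = local_frame_VF[OF sl(2)] local_frame_F[OF sl(2)]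
  have FTS: "F u q \<in> TS q" if "u \<bullet> b = 0" "q \<in> V" "q \<in> S" for u q
    using pd_tangent_sub[OF sl(1) local_frame_chart(4)[OF sl(2) that(2)] that(3,1)] F(2)[OF that(2)] by simp
  have *: "g p (D (F u) \<Xi> p) (F z p) = - g p (\<Xi> p) (D (F u) (F z) p)" if "u \<bullet> b = 0" "z \<bullet> b = 0" for u z
  proof -
    have "g q (\<Xi> q) (F z q) = 0" if "q \<in> V" "q \<in> S" for q
      using FTS[OF \<open>z \<bullet> b = 0\<close> that] TS_iff[OF that(2) VF_at[OF F(1)]] g_sym[OF \<Xi>T VF_at[OF F(1)]] by simp
    then have "g p (D (F u) \<Xi> p) (F z p) + g p (\<Xi> p) (D (F u) (F z) p) = 0"
      by (rule D_metric_along[OF F(1) FTS[OF that(1) sl(3) p] p \<Xi>_VF F(1) local_frame_chart(2)[OF sl(2)] sl(3)])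
    then show ?thesis by simp
  qed
  have "lie_bracket (F v') (F w') p = (\<Sum>i\<in>Basis. lie_bracket (F v') (F w') p (x i) \<cdot>\<^sub>v pd c i p)"
    by (rule tangent_expansion[OF sl(2,3) VF_at[OF lie_bracket_VF[OF F(1) F(1)]]])
  also have "\<dots> = 0"
    by (intro sum.neutral ballI) (simp add: local_frame_commute[OF sl(2,3)])
  finally have "lie_bracket (F v') (F w') p = 0" .
  then have "D (F v') (F w') p = D (F w') (F v') p"
    using D_torsion[OF F(1) F(1), of v' w'] by (metis eq_iff_diff_eq_0 minus_apply)
  then have "g p (D (F v') \<Xi> p) (F w' p) = g p (D (F w') \<Xi> p) (F v' p)" using * v' w' by simp
  then show ?thesis
    using nab_eq[OF F(1) \<Xi>_VF, where p=p] F(2)[OF sl(3)] v' w' by simp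
qed

text \<open>\<open>\<xi>\<close> is geodesic: the component of \<open>\<nabla>\<^sub>\<xi> \<xi>\<close> along \<open>\<xi>\<close> is detected by \<open>E\<close> and vanishes because \<open>g(\<xi>, E)\<close> is constant and
\<open>\<nabla>E\<close> is skew.\<close>

lemma nab\<Xi>_at_\<Xi>: "nab \<Xi> p (\<Xi> p) = 0"
proof (rule TS_nondegenerate[OF p nabT[OF \<Xi>_VF \<Xi>T]])
  show "g p (nab \<Xi> p (\<Xi> p)) z = 0" if "z \<in> TS p" for z
    using nab\<Xi>_sym[OF \<Xi>_TS[OF p] that] nab\<Xi>_\<Xi>[OF that] by simp
  show "g p (nab \<Xi> p (\<Xi> p)) (E p) = 0"
    using nab\<Xi>_E[OF \<Xi>_TS[OF p]] g_sym[OF \<Xi>T WT, of p] W_\<Xi> by simp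
qed

end

lemma D_\<Xi>_\<Xi>: "p \<in> S \<Longrightarrow> D \<Xi> \<Xi> p = 0"
  using nab\<Xi>_at_\<Xi> nab_eq[OF \<Xi>_VF \<Xi>_VF] by metis

lemma nabla_along_eq: assumes p: "p \<in> S" and v: "v \<in> TS p" shows "nabla_along A D S p v \<xi> = nab \<Xi> p v"
proof -
  let ?P = "\<lambda>X. X \<in> VF \<and> (\<exists>U. open U \<and> p \<in> U \<and> (\<forall>q\<in>U \<inter> S. X q = \<xi> q))"
  define X where "X = (SOME X. ?P X)"
  have "?P \<Xi>" using \<Xi>_eq by (auto intro!: exI[of _ UNIV])
  then have "?P X" unfolding X_def by (rule someI[where P="?P"])
  then obtain U where X: "X \<in> VF" and U: "open U" "p \<in> U" "\<And>q. q \<in> U \<Longrightarrow> q \<in> S \<Longrightarrow> X q = \<xi> q" by auto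
  have "D (extend_vec A p v) X p = D (extend_vec A p v) \<Xi> p"
    using extend_vec[OF TS_T[OF v]] v X U \<Xi>_eq
    by (intro D_cong_along[OF _ _ p X \<Xi>_VF U(1,2)]) auto
  then show ?thesis by (simp add: nabla_along_def nab_def X_def)
qed

text \<open>The divergence of a field tangent to \<open>S\<close> with respect to the density \<open>|vol(E, \<cdot>, \<dots>, \<cdot>)|\<close> on \<open>S\<close>. The first term is
the trace of the connection on \<open>S\<close> that arises by projection along \<open>E\<close>; the second one is the \<open>E\<close>-component of
\<open>\<nabla>\<^sub>X E\<close>, by which that connection fails to preserve the density.\<close>

definition "divS X p = tr p (\<lambda>v. nab X p (proj p v)) + sqrt 2 * g p (D X E p) (\<Xi> p)"

context
  fixes p assumes p: "p \<in> S"
begin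

lemma scr_in: "i < DIM('e) - 2 \<Longrightarrow> scr_onb p i \<in> scr p" using scr_onb[OF p] by (auto simp: orthonormal_basis_def)

lemma scr_inTS: "i < DIM('e) - 2 \<Longrightarrow> scr_onb p i \<in> TS p" using scr_in scr_TS by blast

lemma scr_inT: "i < DIM('e) - 2 \<Longrightarrow> scr_onb p i \<in> T p" using scr_inTS TS_T by blast

lemma TS_screen_expansion:
  assumes v: "v \<in> TS p"
  shows "v = (\<Sum>i<DIM('e) - 2. g p v (scr_onb p i) \<cdot>\<^sub>v scr_onb p i) + (sqrt 2 * g p v (E p)) \<cdot>\<^sub>v \<Xi> p"
  using screen_expansion(1)[OF p scr_onb[OF p] TS_T[OF v]] TS_iff[OF p TS_T[OF v]] v g_NN[OF TS_T[OF v]]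
  by simp

lemma nab\<Xi>_scr_expansion:
  assumes v: "v \<in> TS p"
  shows "nab \<Xi> p v = (\<Sum>j<DIM('e) - 2. g p (nab \<Xi> p v) (scr_onb p j) \<cdot>\<^sub>v scr_onb p j) + (sqrt 2 * g p v (W p)) \<cdot>\<^sub>v \<Xi> p"
  using TS_screen_expansion[OF nab\<Xi>_TS[OF p v]] nab\<Xi>_E[OF p v] by simp

lemma divS_screen:
  assumes X: "X \<in> VF"
  shows "divS X p = (\<Sum>i<DIM('e) - 2. g p (nab X p (scr_onb p i)) (scr_onb p i)) + g p (D \<Xi> X p) (NN p)
     + g p (D \<Xi> X p) (\<Xi> p) + sqrt 2 * g p (D X E p) (\<Xi> p)"
proof -
  have 1: "tr p (\<lambda>v. nab X p (proj p v)) = (\<Sum>i<DIM('e) - 2. g p (nab X p (proj p (scr_onb p i))) (scr_onb p i))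
     + g p (nab X p (proj p (\<Xi> p))) (NN p) + g p (nab X p (proj p (NN p))) (\<Xi> p)"
    by (rule tr_screen[OF p scr_onb[OF p] endo_compose[OF nab_endo[OF X] proj_endo]])
  have 2: "(\<Sum>i<DIM('e) - 2. g p (nab X p (proj p (scr_onb p i))) (scr_onb p i)) = (\<Sum>i<DIM('e) - 2. g p (nab X p (scr_onb p i)) (scr_onb p i))"
    by (intro sum.cong refl) (simp add: proj_id[OF p scr_inTS])
  show ?thesis
    unfolding divS_def 1 2 proj_id[OF p \<Xi>_TS[OF p]] proj_NN[OF p] nab_eq[OF \<Xi>_VF X] by simp
qed

lemma divS_\<Xi>: "divS \<Xi> p = - mean_curvature A g D E S \<xi> p"
proof -
  have "g p (D \<Xi> E p) (\<Xi> p) = 0" using W_\<Xi> by (simp add: W_def)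
  then have "divS \<Xi> p = (\<Sum>i<DIM('e) - 2. g p (nab \<Xi> p (scr_onb p i)) (scr_onb p i))"
    using p \<Xi>T NNT by (simp add: divS_screen D_\<Xi>_\<Xi> g_0_left)
  also have "\<dots> = (\<Sum>i<DIM('e) - 2. - second_fund A g D S \<xi> p (scr_onb p i) (scr_onb p i))"
    by (intro sum.cong refl) (simp add: second_fund_def nabla_along_eq[OF p scr_inTS])
  finally show ?thesis unfolding mean_curvature_def scr_onb_def Let_def by (simp add: sum_negf)
qed

lemma D_\<Xi>_W_\<Xi>: "g p (D \<Xi> W p) (\<Xi> p) = 0"
  using D_metric_along[OF \<Xi>_VF \<Xi>_TS[OF p] p W_VF \<Xi>_VF open_UNIV UNIV_I W_\<Xi>] WT
  by (simp add: D_\<Xi>_\<Xi>[OF p] g_0_right)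

lemma D_\<Xi>_W_NN: "g p (D \<Xi> W p) (NN p) = - (sqrt 2 * g p (W p) (W p))"
proof -
  have "g p (D \<Xi> W p) (E p) + g p (W p) (D \<Xi> E p) = 0"
    by (rule D_metric_along[OF \<Xi>_VF \<Xi>_TS[OF p] p W_VF E_VF open_UNIV UNIV_I W_E])
  then have "g p (D \<Xi> W p) (E p) = - g p (W p) (W p)" by (simp add: W_def)
  then show ?thesis by (simp add: g_NN VF_at D_\<Xi>_W_\<Xi>)
qed

lemma divS_W: "divS W p = (\<Sum>i<DIM('e) - 2. g p (nab W p (scr_onb p i)) (scr_onb p i)) - 2 * (sqrt 2 * g p (W p) (W p))"
proof -
  have "g p (D W E p) (\<Xi> p) = - g p (W p) (W p)"
    using DE_skew[OF W_VF \<Xi>_VF, of p] by (simp add: W_def)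
  then show ?thesis by (simp add: divS_screen D_\<Xi>_W_\<Xi> D_\<Xi>_W_NN)
qed

abbreviation (input) "h i j \<equiv> g p (nab \<Xi> p (scr_onb p i)) (scr_onb p j)"

lemma h_sym: "i < DIM('e) - 2 \<Longrightarrow> j < DIM('e) - 2 \<Longrightarrow> h i j = h j i"
  by (rule nab\<Xi>_sym[OF p]) (auto intro: scr_inTS)

lemma W_norm: "g p (W p) (W p) = (\<Sum>i<DIM('e) - 2. g p (scr_onb p i) (W p) * g p (scr_onb p i) (W p))"
proof -
  have "W p = (\<Sum>i<DIM('e) - 2. g p (W p) (scr_onb p i) \<cdot>\<^sub>v scr_onb p i)"
    using TS_screen_expansion[OF W_TS[OF p]] W_E[of p] by simp
  then have "g p (W p) (W p) = g p (\<Sum>i<DIM('e) - 2. g p (W p) (scr_onb p i) \<cdot>\<^sub>v scr_onb p i) (W p)"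
    by (rule arg_cong[of _ _ "\<lambda>z. g p z (W p)"])
  also have "\<dots> = (\<Sum>i<DIM('e) - 2. g p (W p) (scr_onb p i) * g p (scr_onb p i) (W p))"
    by (rule linear_form_sum[OF linear_form_g[OF WT]]) (auto intro: scr_inT)
  also have "\<dots> = (\<Sum>i<DIM('e) - 2. g p (scr_onb p i) (W p) * g p (scr_onb p i) (W p))"
    by (intro sum.cong refl) (simp add: g_sym[OF WT scr_inT])
  finally show ?thesis .
qed

text \<open>In \<open>\<nabla>\<^sub>e \<xi> = - \<Sum>\<^sub>j B(e, e\<^sub>j) e\<^sub>j + sqrt 2 g(e, W) \<xi>\<close> the first part does not contribute, since \<open>B\<close> is symmetric and
\<open>\<nabla>E\<close> is skew.\<close>

lemma trace_nabE_nab\<Xi>: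
  "(\<Sum>i<DIM('e) - 2. g p (nab E p (nab \<Xi> p (scr_onb p i))) (scr_onb p i)) = sqrt 2 * g p (W p) (W p)"
proof -
  let ?s = "scr_onb p"
  have lf: "linear_form p (\<lambda>v. g p (nab E p v) (?s i))" if "i < DIM('e) - 2" for i
    by (rule linear_form_endo[OF linear_form_g[OF scr_inT[OF that]] nab_endo[OF E_VF]])
  have 1: "g p (nab E p (nab \<Xi> p (?s i))) (?s i) =
     (\<Sum>j<DIM('e) - 2. h i j * g p (nab E p (?s j)) (?s i)) + sqrt 2 * (g p (?s i) (W p) * g p (?s i) (W p))"
    if i: "i < DIM('e) - 2" for i
  proof -
    let ?\<phi> = "\<lambda>v. g p (nab E p v) (?s i)"
    have sT: "(\<Sum>j<DIM('e) - 2. h i j \<cdot>\<^sub>v ?s j) \<in> T p" by (intro tangent_sum_in tangent_scale_in scr_inT) auto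
    have 1: "?\<phi> (nab \<Xi> p (?s i)) = ?\<phi> ((\<Sum>j<DIM('e) - 2. h i j \<cdot>\<^sub>v ?s j) + (sqrt 2 * g p (?s i) (W p)) \<cdot>\<^sub>v \<Xi> p)"
      by (rule arg_cong[OF nab\<Xi>_scr_expansion[OF scr_inTS[OF i]], of ?\<phi>])
    have 2: "?\<phi> ((\<Sum>j<DIM('e) - 2. h i j \<cdot>\<^sub>v ?s j) + (sqrt 2 * g p (?s i) (W p)) \<cdot>\<^sub>v \<Xi> p) = ?\<phi> (\<Sum>j<DIM('e) - 2. h i j \<cdot>\<^sub>v ?s j) + ?\<phi> ((sqrt 2 * g p (?s i) (W p)) \<cdot>\<^sub>v \<Xi> p)"
      by (rule linear_form_add[OF lf[OF i] sT]) (simp add: \<Xi>T)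
    have 3: "?\<phi> (\<Sum>j<DIM('e) - 2. h i j \<cdot>\<^sub>v ?s j) = (\<Sum>j<DIM('e) - 2. h i j * ?\<phi> (?s j))"
      by (rule linear_form_sum[OF lf[OF i]]) (auto intro: scr_inT)
    have 4: "?\<phi> ((sqrt 2 * g p (?s i) (W p)) \<cdot>\<^sub>v \<Xi> p) = (sqrt 2 * g p (?s i) (W p)) * g p (W p) (?s i)"
      by (subst linear_form_scale[OF lf[OF i] \<Xi>T]) (simp add: nabE_\<Xi>)
    show ?thesis unfolding 1 2 3 4 by (simp add: g_sym[OF WT scr_inT[OF i]])
  qed
  have "(\<Sum>i<DIM('e) - 2. \<Sum>j<DIM('e) - 2. h i j * g p (nab E p (?s j)) (?s i)) =
     (\<Sum>i<DIM('e) - 2. \<Sum>j<DIM('e) - 2. h j i * g p (nab E p (?s i)) (?s j))" by (rule sum.swap)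
  also have "\<dots> = (\<Sum>i<DIM('e) - 2. \<Sum>j<DIM('e) - 2. - (h i j * g p (nab E p (?s j)) (?s i)))"
  proof (intro sum.cong refl)
    fix i j assume "i \<in> {..<DIM('e) - 2}" "j \<in> {..<DIM('e) - 2}"
    then have ij: "i < DIM('e) - 2" "j < DIM('e) - 2" by auto
    have "g p (nab E p (?s i)) (?s j) = - g p (nab E p (?s j)) (?s i)"
      using nabE_skew[OF scr_inT[OF ij(1)] scr_inT[OF ij(2)]]
        g_sym[OF scr_inT[OF ij(1)] nabT[OF E_VF scr_inT[OF ij(2)]]] by simp
    then show "h j i * g p (nab E p (?s i)) (?s j) = - (h i j * g p (nab E p (?s j)) (?s i))"
      using h_sym[OF ij] by simp
  qed
  finally have 0: "(\<Sum>i<DIM('e) - 2. \<Sum>j<DIM('e) - 2. h i j * g p (nab E p (?s j)) (?s i)) = 0"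
    by (simp add: sum_negf)
  have "(\<Sum>i<DIM('e) - 2. g p (nab E p (nab \<Xi> p (?s i))) (?s i)) =
    (\<Sum>i<DIM('e) - 2. (\<Sum>j<DIM('e) - 2. h i j * g p (nab E p (?s j)) (?s i)) + sqrt 2 * (g p (?s i) (W p) * g p (?s i) (W p)))"
    using 1 by (intro sum.cong refl) auto
  also have "\<dots> = sqrt 2 * g p (W p) (W p)"
    by (simp add: sum.distrib 0 W_norm sum_distrib_left)
  finally show ?thesis .
qed

lemma curvature_E: assumes v: "v \<in> T p" and Y: "Y \<in> VF"
  shows "curvature A D p v (E p) (Y p) = nab (D Y E) p v - nab E p (nab Y p v)"
proof -
  let ?V = "extend_vec A p v"
  have V: "?V \<in> VF" "?V p = v" using extend_vec[OF v] by auto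
  have "curvature A D p (?V p) (E p) (Y p) = R ?V E Y p" by (rule curvature_eq[OF V(1) E_VF Y])
  also have "\<dots> = D ?V (D Y E) p - D (D ?V Y) E p" using curvature_killing[OF V(1) Y] by simp
  also have "\<dots> = nab (D Y E) p v - nab E p (nab Y p v)"
    using nab_eq[OF D_VF[OF V(1) Y] E_VF, of p] by (simp add: nab_def)
  finally show ?thesis using V(2) by simp
qed

text \<open>The summand for \<open>\<xi>\<close> equals \<open>g(\<nabla>\<^sub>\<xi> W, N)\<close>, that for \<open>N\<close> vanishes by \<open>curvature_killing_skew\<close>.\<close>

lemma tr_curvature_E:
  "tr p (\<lambda>v. curvature A D p v (E p) (\<Xi> p)) =
    (\<Sum>i<DIM('e) - 2. g p (nab W p (scr_onb p i)) (scr_onb p i)) - 2 * (sqrt 2 * g p (W p) (W p))"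
proof -
  let ?s = "scr_onb p"
  define Q where "Q v = nab W p v - nab E p (nab \<Xi> p v)" for v
  have Q: "endomorphism p Q"
    unfolding endomorphism_def Q_def
    using nab_endo[OF W_VF, of p] endo_compose[OF nab_endo[OF E_VF, of p] nab_endo[OF \<Xi>_VF, of p]]
    unfolding endomorphism_def by (auto simp: algebra_simps vscale_algebra)
  have CQ: "curvature A D p v (E p) (\<Xi> p) = Q v" if "v \<in> T p" for v
    using curvature_E[OF that \<Xi>_VF] by (simp add: Q_def W_def)
  have 1: "tr p (\<lambda>v. curvature A D p v (E p) (\<Xi> p)) = tr p Q"
    unfolding tr_def by (intro sum.cong refl) (simp add: CQ tangent_onb_in)
  have 2: "tr p Q = (\<Sum>i<DIM('e) - 2. g p (Q (?s i)) (?s i)) + g p (Q (\<Xi> p)) (NN p) + g p (Q (NN p)) (\<Xi> p)"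
    by (rule tr_screen[OF p scr_onb[OF p] Q])
  have 3: "(\<Sum>i<DIM('e) - 2. g p (Q (?s i)) (?s i)) =
      (\<Sum>i<DIM('e) - 2. g p (nab W p (?s i)) (?s i)) - (\<Sum>i<DIM('e) - 2. g p (nab E p (nab \<Xi> p (?s i))) (?s i))"
    unfolding sum_subtractf[symmetric] Q_def
    by (intro sum.cong refl g_diff_left nabT W_VF E_VF \<Xi>_VF scr_inT) auto
  have 4: "Q (\<Xi> p) = D \<Xi> W p"
    unfolding Q_def nab\<Xi>_at_\<Xi>[OF p] nab_eq[OF \<Xi>_VF W_VF] endo_0[OF nab_endo[OF E_VF]] by simp
  have "R NN E \<Xi> p = Q (NN p)"
    unfolding Q_def curvature_killing[OF NN_VF \<Xi>_VF] W_def[symmetric] minus_apply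
      nab_eq[OF NN_VF W_VF] nab_eq[OF NN_VF \<Xi>_VF] nab_eq[OF D_VF[OF NN_VF \<Xi>_VF] E_VF] ..
  then have 5: "g p (Q (NN p)) (\<Xi> p) = 0" using curvature_killing_skew[OF NN_VF \<Xi>_VF, of p] by simp
  show ?thesis unfolding 1 2 3 4 5 D_\<Xi>_W_NN trace_nabE_nab\<Xi> by simp
qed

text \<open>Since \<open>N = sqrt 2 E + \<xi>\<close>, only \<open>2 g(R(\<xi>, E) E, \<xi>)\<close> survives in the numerator, and \<open>R(\<xi>, E) E = - \<nabla>\<^sub>W E\<close> because
\<open>E\<close> is geodesic; the denominator is \<open>- g(\<xi>, N)\<^sup>2 = - 1\<close>.\<close>

lemma sectional_eq: "sectional A g D p (\<Xi> p) (NN p) = - (2 * g p (W p) (W p))"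
proof -
  have 1: "R \<Xi> NN NN = (\<lambda>_. 2) \<cdot>\<^sub>f R \<Xi> E E + (\<lambda>_. sqrt 2) \<cdot>\<^sub>f R \<Xi> E \<Xi>"
  proof -
    have s2: "sqrt 2 * sqrt 2 = (2::real)" by simp
    have z: "R \<Xi> \<Xi> NN = 0"
    proof (intro ext)
      fix q f
      have "R \<Xi> \<Xi> NN q f = (- R \<Xi> \<Xi> NN) q f" using R_skew[OF \<Xi>_VF \<Xi>_VF NN_VF] by (rule arg_cong)
      then show "R \<Xi> \<Xi> NN q f = 0 q f" by simp
    qed
    have "R \<Xi> NN NN = - R NN \<Xi> NN" by (rule R_skew) auto
    also have "R NN \<Xi> NN = (\<lambda>_. sqrt 2) \<cdot>\<^sub>f R E \<Xi> NN + R \<Xi> \<Xi> NN"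
      unfolding NN_def[of] by (subst R_add_1) (auto simp: R_scale_1 NN_def[symmetric])
    also have "R E \<Xi> NN = - R \<Xi> E NN" by (rule R_skew) auto
    also have "R \<Xi> E NN = (\<lambda>_. sqrt 2) \<cdot>\<^sub>f R \<Xi> E E + R \<Xi> E \<Xi>"
      unfolding NN_def by (subst R_add_3) (auto simp: R_scale_3)
    finally show ?thesis using z by (simp add: fun_eq_iff algebra_simps)
  qed
  have T: "R \<Xi> E E p \<in> T p" "R \<Xi> E \<Xi> p \<in> T p" by (auto intro!: VF_at R_VF)
  have 2: "R \<Xi> E E = - D W E"
    using curvature_killing[OF \<Xi>_VF E_VF] by (simp add: D_E_E D_0_right W_def)
  have "curvature A D p (\<Xi> p) (NN p) (NN p) = R \<Xi> NN NN p" by (rule curvature_eq) auto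
  then have "g p (curvature A D p (\<Xi> p) (NN p) (NN p)) (\<Xi> p) = 2 * g p (R \<Xi> E E p) (\<Xi> p) + sqrt 2 * g p (R \<Xi> E \<Xi> p) (\<Xi> p)"
    using T \<Xi>T by (simp add: 1 g_left)
  also have "g p (R \<Xi> E \<Xi> p) (\<Xi> p) = 0" by (rule curvature_killing_skew) auto
  also have "g p (R \<Xi> E E p) (\<Xi> p) = g p (W p) (W p)"
    using DE_skew[OF W_VF \<Xi>_VF, of p] by (simp add: 2 g_uminus_left VF_at W_def)
  finally show ?thesis using p by (simp add: sectional_def \<Xi>_null \<Xi>_NN)
qed

end

text \<open>Frame vectors of \<open>tr\<close> are chosen point by point, whereas coordinate vectors extend to fields: in this form the
divergence is a smooth function along \<open>S\<close> that can be compared with derivatives of the density.\<close>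

lemma divS_slice:
  assumes p: "p \<in> S" and sl: "slice S c b" "local_frame c V x F" "p \<in> V" and X: "X \<in> VF"
  shows "divS X p = (\<Sum>i\<in>Basis - {b}. proj p (D (F i) X p) (x i)) + sqrt 2 * g p (D X E p) (\<Xi> p)"
proof -
  note pc = local_frame_chart(1)[OF sl(2)] local_frame_chart(4)[OF sl(2,3)]
  have 1: "tr p (\<lambda>v. nab X p (proj p v)) = (\<Sum>i\<in>Basis - {b}. proj p (nab X p (proj p (pd c i p))) (x i))
     + sqrt 2 * g p (nab X p (proj p (E p))) (\<Xi> p)"
    by (rule tr_slice[OF p sl endo_compose[OF nab_endo[OF X] proj_endo]])
  have 2: "(\<Sum>i\<in>Basis - {b}. proj p (nab X p (proj p (pd c i p))) (x i)) = (\<Sum>i\<in>Basis - {b}. proj p (D (F i) X p) (x i))"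
  proof (intro sum.cong refl)
    fix i assume "i \<in> Basis - {b}"
    then have "i \<bullet> b = 0" using sliceD(2)[OF sl(1)] by (auto simp: inner_Basis)
    then have "pd c i p \<in> TS p" by (rule pd_tangent_sub[OF sl(1) pc(2) p])
    then have "proj p (pd c i p) = F i p" using proj_id[OF p] local_frame_F[OF sl(2,3)] by simp
    then show "proj p (nab X p (proj p (pd c i p))) (x i) = proj p (D (F i) X p) (x i)"
      using nab_eq[OF local_frame_VF[OF sl(2)] X] by simp
  qed
  show ?thesis
    unfolding divS_def 1 2 proj_E[OF p] endo_0[OF nab_endo[OF X]] g_0_left[OF \<Xi>T] by simp
qed

text \<open>Raychaudhuri's equation when \<open>H = 0\<close> on \<open>S\<close>. With \<open>L = \<nabla>\<xi>\<close> on the tangent spaces of \<open>S\<close> and coordinate fields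
\<open>F\<^sub>i\<close> tangent to \<open>S\<close>, the equation \<open>\<nabla>\<^sub>\<xi> \<xi> = 0\<close> gives
\<open>R(F\<^sub>i, \<xi>) \<xi> = - \<nabla>\<^sub>\<xi> (L F\<^sub>i) - L (L F\<^sub>i) + L (\<nabla>\<^sub>\<xi> F\<^sub>i)\<close>. In the trace the first and the last term add up to
\<open>- \<xi> (tr L)\<close>, which vanishes because \<open>tr L = - H\<close>; and \<open>tr (L L) = |B|\<^sup>2\<close>.\<close>

lemma tr_curvature_\<Xi>:
  assumes p: "p \<in> S" and min: "\<And>q. q \<in> S \<Longrightarrow> divS \<Xi> q = 0"
  shows "tr p (\<lambda>v. curvature A D p v (\<Xi> p) (\<Xi> p)) =
    - (\<Sum>i<DIM('e) - 2. \<Sum>j<DIM('e) - 2. (g p (nab \<Xi> p (scr_onb p i)) (scr_onb p j))\<^sup>2)"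
proof -
  obtain c b V x F where sl: "slice S c b" "local_frame c V x F" "p \<in> V" using slice_at[OF p] by metis
  let ?B = "Basis - {b}" and ?L = "nab \<Xi> p"
  note F = local_frame_VF[OF sl(2)] local_frame_F[OF sl(2)] and x = local_frame_Cinf[OF sl(2)]
  note oV = local_frame_chart(2)[OF sl(2)]
  have iB: "i \<bullet> b = 0" if "i \<in> ?B" for i using that sliceD(2)[OF sl(1)] by (auto simp: inner_Basis)
  have FTS: "F i q \<in> TS q" if "i \<in> ?B" "q \<in> V" "q \<in> S" for i q
    using pd_tangent_sub[OF sl(1) local_frame_chart(4)[OF sl(2) that(2)] that(3) iB[OF that(1)]] F(2)[OF that(2)] by simp
  define Y where "Y i = D (F i) \<Xi>" for i
  have Y: "Y i \<in> VF" for i using F(1) by (simp add: Y_def)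
  have YTS: "Y i q \<in> TS q" if "i \<in> ?B" "q \<in> V" "q \<in> S" for i q
    using nab\<Xi>_TS[OF that(3) FTS[OF that]] nab_eq[OF F(1) \<Xi>_VF] by (simp add: Y_def)
  have YL: "Y i p = ?L (F i p)" for i using nab_eq[OF F(1) \<Xi>_VF] by (simp add: Y_def)
  \<comment> \<open>covariant derivatives along \<open>\<Xi>\<close> of fields tangent to the hypersurface are tangent to it\<close>
  have TSD: "D \<Xi> Z p \<in> TS p" if Z: "Z \<in> VF" "\<And>q. q \<in> V \<Longrightarrow> q \<in> S \<Longrightarrow> Z q \<in> TS q" for Z
  proof -
    have "g q (Z q) (\<Xi> q) = 0" if "q \<in> V" "q \<in> S" for q using Z(2)[OF that] TS_iff[OF that(2)] TS_T by blast
    then have "g p (D \<Xi> Z p) (\<Xi> p) + g p (Z p) (D \<Xi> \<Xi> p) = 0"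
      by (rule D_metric_along[OF \<Xi>_VF \<Xi>_TS[OF p] p Z(1) \<Xi>_VF oV sl(3)])
    then have "g p (D \<Xi> Z p) (\<Xi> p) = 0" using Z(1) by (simp add: D_\<Xi>_\<Xi>[OF p] g_0_right VF_at)
    then show ?thesis using TS_iff[OF p] Z(1) by (simp add: VF_at)
  qed
  \<comment> \<open>the matrix of \<open>L\<close>, and below the components of the derivatives \<open>\<nabla>\<^sub>\<xi> F\<^sub>k\<close>\<close>
  define a where "a i k = act (Y i) (x k)" for i k
  have a: "a i k \<in> Cinf A" for i k unfolding a_def by (rule VF_act[OF Y x])
  define d where "d k i = D \<Xi> (F k) p (x i)" for k i
  have R: "R (F i) \<Xi> \<Xi> p = ?L (D \<Xi> (F i) p) - D \<Xi> (Y i) p - ?L (?L (F i p))" if i: "i \<in> ?B" for i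
  proof -
    have "D (F i) (D \<Xi> \<Xi>) p = D (F i) 0 p"
      by (rule D_cong_along[OF F(1) FTS[OF i sl(3) p] p _ _ open_UNIV UNIV_I]) (use D_\<Xi>_\<Xi> in auto)
    then have 1: "D (F i) (D \<Xi> \<Xi>) p = 0" using F(1) by (simp add: D_0_right)
    have br: "lie_bracket (F i) \<Xi> = Y i - D \<Xi> (F i)" using D_torsion[OF F(1) \<Xi>_VF] by (simp add: Y_def)
    have "D (lie_bracket (F i) \<Xi>) \<Xi> p = D (Y i) \<Xi> p - D (D \<Xi> (F i)) \<Xi> p"
      unfolding br using Y F(1) by (simp add: D_diff_left)
    also have "\<dots> = ?L (?L (F i p)) - ?L (D \<Xi> (F i) p)"
      unfolding YL[symmetric] nab_eq[OF Y \<Xi>_VF] nab_eq[OF D_VF[OF \<Xi>_VF F(1)] \<Xi>_VF] ..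
    finally show ?thesis using 1 by (simp add: curvature_field_def Y_def[symmetric])
  qed
  have RTS: "R (F i) \<Xi> \<Xi> p \<in> TS p" if i: "i \<in> ?B" for i
  proof -
    have 1: "?L (D \<Xi> (F i) p) \<in> TS p" by (intro nab\<Xi>_TS[OF p] TSD F(1) FTS[OF i])
    have 2: "D \<Xi> (Y i) p \<in> TS p" by (intro TSD Y YTS[OF i])
    have 3: "?L (?L (F i p)) \<in> TS p" by (intro nab\<Xi>_TS[OF p] FTS[OF i] sl p)
    have eq: "R (F i) \<Xi> \<Xi> p = (-1) \<cdot>\<^sub>v D \<Xi> (Y i) p + ((-1) \<cdot>\<^sub>v ?L (?L (F i p)) + ?L (D \<Xi> (F i) p))"
      unfolding R[OF i] by (simp add: algebra_simps)
    show ?thesis unfolding eq by (rule tangent_sub_lin[OF 2 tangent_sub_lin[OF 3 1]])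
  qed
  have \<delta>: "pd c k p (x i) = (if k = i then 1 else 0)" if "i \<in> Basis" "k \<in> Basis" for i k
    using local_frame_pd_x[OF sl(2,3), of k i] that by (simp add: inner_Basis)
  have \<alpha>: "D \<Xi> (Y i) p (x i) = \<Xi> p (a i i) + (\<Sum>k\<in>?B. a i k p * d k i)" if i: "i \<in> ?B" for i
  proof -
    have "D \<Xi> (Y i) p = D \<Xi> (\<Sum>k\<in>?B. a i k \<cdot>\<^sub>f F k) p"
    proof (rule D_cong_along[OF \<Xi>_VF \<Xi>_TS[OF p] p Y _ oV sl(3)])
      show "(\<Sum>k\<in>?B. a i k \<cdot>\<^sub>f F k) \<in> VF" by (intro VF_sum VF_fscale a F(1))
      fix q assume q: "q \<in> V" "q \<in> S"
      have "Y i q = (\<Sum>k\<in>?B. Y i q (x k) \<cdot>\<^sub>v pd c k q)" by (rule tangent_sub_expansion[OF sl(1,2) q YTS[OF i q]])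
      also have "\<dots> = (\<Sum>k\<in>?B. (a i k \<cdot>\<^sub>f F k) q)" by (intro sum.cong refl) (simp add: a_def act_def F(2)[OF q(1)])
      finally show "Y i q = (\<Sum>k\<in>?B. a i k \<cdot>\<^sub>f F k) q" by (simp only: sum_fun_apply)
    qed
    also have "\<dots> = (\<Sum>k\<in>?B. D \<Xi> (a i k \<cdot>\<^sub>f F k) p)"
      using a F(1) by (subst D_sum_right) (auto simp: sum_fun_apply)
    finally have "D \<Xi> (Y i) p (x i) = (\<Sum>k\<in>?B. D \<Xi> (a i k \<cdot>\<^sub>f F k) p (x i))" by (simp only: sum_fun_apply)
    also have "\<dots> = (\<Sum>k\<in>?B. (if k = i then \<Xi> p (a i i) else 0) + a i k p * d k i)"
    proof (intro sum.cong refl)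
      fix k assume k: "k \<in> ?B"
      show "D \<Xi> (a i k \<cdot>\<^sub>f F k) p (x i) = (if k = i then \<Xi> p (a i i) else 0) + a i k p * d k i"
        using i k \<delta>[of i k] F(1) a by (simp add: D_leibniz F(2)[OF sl(3)] d_def act_def)
    qed
    also have "\<dots> = \<Xi> p (a i i) + (\<Sum>k\<in>?B. a i k p * d k i)"
      using i by (simp add: sum.distrib)
    finally show ?thesis .
  qed
  have \<gamma>: "?L (D \<Xi> (F i) p) (x i) = (\<Sum>k\<in>?B. d i k * a k i p)" if i: "i \<in> ?B" for i
  proof -
    have "D \<Xi> (F i) p = (\<Sum>k\<in>?B. d i k \<cdot>\<^sub>v pd c k p)"
      unfolding d_def by (rule tangent_sub_expansion[OF sl(1,2,3) p]) (intro TSD F(1) FTS[OF i])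
    then have "?L (D \<Xi> (F i) p) (x i) = ?L (\<Sum>k\<in>?B. d i k \<cdot>\<^sub>v pd c k p) (x i)"
      by (rule arg_cong[of _ _ "\<lambda>z. ?L z (x i)"])
    also have "\<dots> = (\<Sum>k\<in>?B. d i k * ?L (pd c k p) (x i))"
      using local_frame_chart[OF sl(2)] sl(3) 
      by (intro linear_form_sum[OF linear_form_endo[OF linear_form_eval[OF x] nab_endo[OF \<Xi>_VF]]] pd_tangent) auto
    also have "\<dots> = (\<Sum>k\<in>?B. d i k * a k i p)"
      by (intro sum.cong refl) (simp add: a_def act_def YL F(2)[OF sl(3)])
    finally show ?thesis .
  qed
  have trace0: "(\<Sum>i\<in>?B. \<Xi> p (a i i)) = 0"
  proof -
    have "(\<Sum>i\<in>?B. a i i q) = 0" if q: "q \<in> V" "q \<in> S" for q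
    proof -
      have "g q (D \<Xi> E q) (\<Xi> q) = 0" using W_\<Xi> by (simp add: W_def)
      then have "divS \<Xi> q = (\<Sum>i\<in>?B. proj q (Y i q) (x i))"
        using divS_slice[OF q(2) sl(1,2) q(1) \<Xi>_VF] by (simp add: Y_def)
      also have "\<dots> = (\<Sum>i\<in>?B. a i i q)"
        by (intro sum.cong refl) (simp add: proj_id[OF q(2) YTS[OF _ q]] a_def act_def)
      finally show ?thesis using min[OF q(2)] by simp
    qed
    then have "\<Xi> p (\<lambda>q. \<Sum>i\<in>?B. a i i q) = 0"
      by (intro tangent_sub_eq_0[OF \<Xi>_TS[OF p] p _ oV sl(3)] Cinf_sum' a)
    then show ?thesis using tangent_sum[OF \<Xi>T[of p], of ?B "\<lambda>i. a i i"] a by simp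
  qed
  have endo2: "endomorphism p (\<lambda>v. ?L (?L (proj p v)))"
    by (rule endo_compose[OF nab_endo[OF \<Xi>_VF] endo_compose[OF nab_endo[OF \<Xi>_VF] proj_endo]])
  have \<beta>: "(\<Sum>i\<in>?B. ?L (?L (F i p)) (x i)) = (\<Sum>i<DIM('e) - 2. \<Sum>j<DIM('e) - 2. (g p (?L (scr_onb p i)) (scr_onb p j))\<^sup>2)"
  proof -
    let ?s = "scr_onb p"
    have "(\<Sum>i\<in>?B. ?L (?L (F i p)) (x i)) = (\<Sum>i\<in>?B. proj p (?L (?L (proj p (pd c i p)))) (x i))"
    proof (intro sum.cong refl)
      fix i assume i: "i \<in> ?B"
      note t = FTS[OF i sl(3) p]
      show "?L (?L (F i p)) (x i) = proj p (?L (?L (proj p (pd c i p)))) (x i)"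
        using proj_id[OF p t] proj_id[OF p nab\<Xi>_TS[OF p nab\<Xi>_TS[OF p t]]] F(2)[OF sl(3)] by simp
    qed
    also have "\<dots> = tr p (\<lambda>v. ?L (?L (proj p v)))"
      using tr_slice[OF p sl endo2] p \<Xi>T by (simp add: proj_E endo_0[OF nab_endo[OF \<Xi>_VF]] g_0_left)
    also have "\<dots> = (\<Sum>i<DIM('e) - 2. g p (?L (?L (proj p (?s i)))) (?s i))"
      using tr_screen[OF p scr_onb[OF p] endo2] p \<Xi>T NNT
      by (simp add: proj_id \<Xi>_TS proj_NN nab\<Xi>_at_\<Xi> endo_0[OF nab_endo[OF \<Xi>_VF]] g_0_left)
    also have "\<dots> = (\<Sum>i<DIM('e) - 2. \<Sum>j<DIM('e) - 2. (g p (?L (?s i)) (?s j))\<^sup>2)"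
    proof (intro sum.cong refl)
      fix i assume "i \<in> {..<DIM('e) - 2}"
      then have i: "i < DIM('e) - 2" by simp
      let ?\<phi> = "\<lambda>v. g p (?L v) (?s i)"
      have lf: "linear_form p ?\<phi>"
        by (rule linear_form_endo[OF linear_form_g[OF scr_inT[OF p i]] nab_endo[OF \<Xi>_VF]])
      have 1: "?\<phi> (?L (?s i)) = ?\<phi> ((\<Sum>j<DIM('e) - 2. g p (?L (?s i)) (?s j) \<cdot>\<^sub>v ?s j) + (sqrt 2 * g p (?s i) (W p)) \<cdot>\<^sub>v \<Xi> p)"
        by (rule arg_cong[OF nab\<Xi>_scr_expansion[OF p scr_inTS[OF p i]], of ?\<phi>])
      have 2: "?\<phi> ((\<Sum>j<DIM('e) - 2. g p (?L (?s i)) (?s j) \<cdot>\<^sub>v ?s j) + (sqrt 2 * g p (?s i) (W p)) \<cdot>\<^sub>v \<Xi> p)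
        = ?\<phi> (\<Sum>j<DIM('e) - 2. g p (?L (?s i)) (?s j) \<cdot>\<^sub>v ?s j) + ?\<phi> ((sqrt 2 * g p (?s i) (W p)) \<cdot>\<^sub>v \<Xi> p)"
        by (rule linear_form_add[OF lf]) (auto intro!: tangent_sum_in scr_inT[OF p] \<Xi>T)
      have 3: "?\<phi> (\<Sum>j<DIM('e) - 2. g p (?L (?s i)) (?s j) \<cdot>\<^sub>v ?s j) = (\<Sum>j<DIM('e) - 2. g p (?L (?s i)) (?s j) * ?\<phi> (?s j))"
        by (rule linear_form_sum[OF lf]) (auto intro: scr_inT[OF p])
      have 4: "(\<Sum>j<DIM('e) - 2. g p (?L (?s i)) (?s j) * ?\<phi> (?s j)) = (\<Sum>j<DIM('e) - 2. (g p (?L (?s i)) (?s j))\<^sup>2)"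
        using h_sym[OF p i] by (intro sum.cong refl) (auto simp: power2_eq_square)
      have 5: "?\<phi> ((sqrt 2 * g p (?s i) (W p)) \<cdot>\<^sub>v \<Xi> p) = 0"
        by (subst linear_form_scale[OF lf \<Xi>T]) (simp add: nab\<Xi>_at_\<Xi>[OF p] g_0_left scr_inT[OF p i])
      have "?\<phi> (?L (?s i)) = (\<Sum>j<DIM('e) - 2. (g p (?L (?s i)) (?s j))\<^sup>2)"
        using 1 2 3 4 5 by linarith
      then show "g p (?L (?L (proj p (?s i)))) (?s i) = (\<Sum>j<DIM('e) - 2. (g p (?L (?s i)) (?s j))\<^sup>2)"
        by (simp add: proj_id[OF p scr_inTS[OF p i]])
    qed
    finally show ?thesis .
  qed
  define Q where "Q v = curvature A D p v (\<Xi> p) (\<Xi> p)" for v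
  have QR: "Q (X p) = R X \<Xi> \<Xi> p" if "X \<in> VF" for X unfolding Q_def by (rule curvature_eq[OF that \<Xi>_VF \<Xi>_VF])
  have Q: "endomorphism p Q"
    unfolding endomorphism_def
  proof (intro conjI ballI allI)
    fix u assume u: "u \<in> T p"
    obtain U where U: "U \<in> VF" "U p = u" using VF_extension_exists[OF u] by blast
    show "Q u \<in> T p" using QR[OF U(1)] U R_VF[OF U(1) \<Xi>_VF \<Xi>_VF] by (simp add: VF_at)
    fix v r assume v: "v \<in> T p"
    obtain Z where Z: "Z \<in> VF" "Z p = v" using VF_extension_exists[OF v] by blast
    have "Q (((\<lambda>_. r) \<cdot>\<^sub>f U + Z) p) = R ((\<lambda>_. r) \<cdot>\<^sub>f U + Z) \<Xi> \<Xi> p"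
      by (rule QR[of "(\<lambda>_. r) \<cdot>\<^sub>f U + Z"]) (intro VF_add VF_fscale Cinf_const U Z)
    also have "R ((\<lambda>_. r) \<cdot>\<^sub>f U + Z) \<Xi> \<Xi> = (\<lambda>_. r) \<cdot>\<^sub>f R U \<Xi> \<Xi> + R Z \<Xi> \<Xi>"
      using U Z by (subst R_add_1) (auto simp: R_scale_1)
    finally have "Q (r \<cdot>\<^sub>v U p + Z p) = r \<cdot>\<^sub>v R U \<Xi> \<Xi> p + R Z \<Xi> \<Xi> p"
      unfolding plus_fun_apply fscale_apply .
    then show "Q (r \<cdot>\<^sub>v u + v) = r \<cdot>\<^sub>v Q u + Q v"
      unfolding QR[OF U(1), symmetric] QR[OF Z(1), symmetric] U(2) Z(2) .
  qed
  have "g p (Q (E p)) (\<Xi> p) = 0"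
    using QR[OF E_VF] R_skew[OF E_VF \<Xi>_VF \<Xi>_VF] curvature_killing_skew[OF \<Xi>_VF \<Xi>_VF, of p] \<Xi>T
    by (simp add: g_uminus_left VF_at R_VF)
  then have "tr p Q = (\<Sum>i\<in>?B. proj p (Q (pd c i p)) (x i))"
    using tr_slice[OF p sl Q] by simp
  also have "\<dots> = (\<Sum>i\<in>?B. ?L (D \<Xi> (F i) p) (x i) - D \<Xi> (Y i) p (x i) - ?L (?L (F i p)) (x i))"
    using QR[OF F(1)] F(2)[OF sl(3)] by (intro sum.cong refl) (simp add: proj_id[OF p RTS], simp add: R)
  also have "\<dots> = (\<Sum>i\<in>?B. ?L (D \<Xi> (F i) p) (x i)) - (\<Sum>i\<in>?B. D \<Xi> (Y i) p (x i)) - (\<Sum>i\<in>?B. ?L (?L (F i p)) (x i))"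
    by (simp only: sum_subtractf)
  also have "(\<Sum>i\<in>?B. D \<Xi> (Y i) p (x i)) = (\<Sum>i\<in>?B. \<Sum>k\<in>?B. a i k p * d k i)"
    using trace0 by (simp add: \<alpha> sum.distrib)
  also have "(\<Sum>i\<in>?B. ?L (D \<Xi> (F i) p) (x i)) = (\<Sum>i\<in>?B. \<Sum>k\<in>?B. d i k * a k i p)"
    by (simp add: \<gamma>)
  also have "\<dots> = (\<Sum>i\<in>?B. \<Sum>k\<in>?B. d k i * a i k p)" by (rule sum.swap)
  finally show ?thesis unfolding \<beta> Q_def by (simp add: mult.commute)
qed

text \<open>Combine the three curvature terms. The term \<open>4 |W|\<^sup>2\<close> that arises from \<open>div W\<close> in place of the screen divergence
cancels one half of the sum of \<open>- 4 |W|\<^sup>2\<close> from the Ricci term and \<open>- 4 |W|\<^sup>2\<close> from the sectional curvature.\<close>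

lemma curvature_condition:
  assumes p: "p \<in> S" and min: "\<And>q. q \<in> S \<Longrightarrow> divS \<Xi> q = 0"
  shows "ricci A g D p (NN p) (\<xi> p) + 2 * sectional A g D p (\<xi> p) (NN p) =
    sqrt 2 * divS W p - (\<Sum>i<DIM('e) - 2. \<Sum>j<DIM('e) - 2. (g p (nab \<Xi> p (scr_onb p i)) (scr_onb p j))\<^sup>2) - 4 * g p (W p) (W p)"
proof -
  have C: "curvature A D p v (NN p) (\<Xi> p) = sqrt 2 \<cdot>\<^sub>v curvature A D p v (E p) (\<Xi> p) + curvature A D p v (\<Xi> p) (\<Xi> p) \<and>
     curvature A D p v (E p) (\<Xi> p) \<in> T p \<and> curvature A D p v (\<Xi> p) (\<Xi> p) \<in> T p"
    if v: "v \<in> T p" for v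
  proof -
    obtain V where V: "V \<in> VF" "V p = v" using VF_extension_exists[OF v] by blast
    have "R V NN \<Xi> = - R NN V \<Xi>" using V by (intro R_skew) auto
    also have "R NN V \<Xi> = (\<lambda>_. sqrt 2) \<cdot>\<^sub>f R E V \<Xi> + R \<Xi> V \<Xi>"
      unfolding NN_def using V by (subst R_add_1) (auto simp: R_scale_1)
    also have "R E V \<Xi> = - R V E \<Xi>" using V by (intro R_skew) auto
    also have "R \<Xi> V \<Xi> = - R V \<Xi> \<Xi>" using V by (intro R_skew) auto
    finally have "R V NN \<Xi> = (\<lambda>_. sqrt 2) \<cdot>\<^sub>f R V E \<Xi> + R V \<Xi> \<Xi>" by (simp add: fun_eq_iff)
    then have "R V NN \<Xi> p = sqrt 2 \<cdot>\<^sub>v R V E \<Xi> p + R V \<Xi> \<Xi> p" by simp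
    then show ?thesis
      using curvature_eq[OF V(1) NN_VF \<Xi>_VF, of p] curvature_eq[OF V(1) E_VF \<Xi>_VF, of p]
        curvature_eq[OF V(1) \<Xi>_VF \<Xi>_VF, of p] V VF_at[OF R_VF[OF V(1) E_VF \<Xi>_VF]] VF_at[OF R_VF[OF V(1) \<Xi>_VF \<Xi>_VF]]
      by simp
  qed
  have "ricci A g D p (NN p) (\<Xi> p) = sqrt 2 * tr p (\<lambda>v. curvature A D p v (E p) (\<Xi> p)) + tr p (\<lambda>v. curvature A D p v (\<Xi> p) (\<Xi> p))"
    unfolding ricci_eq_tr tr_def sum_distrib_left sum.distrib[symmetric]
  proof (intro sum.cong refl)
    fix i assume "i \<in> {..<DIM('e)}"
    then have i: "tangent_onb p i \<in> T p" using tangent_onb_in by simp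
    show "g p (tangent_onb p i) (tangent_onb p i) * g p (curvature A D p (tangent_onb p i) (NN p) (\<Xi> p)) (tangent_onb p i) =
      sqrt 2 * (g p (tangent_onb p i) (tangent_onb p i) * g p (curvature A D p (tangent_onb p i) (E p) (\<Xi> p)) (tangent_onb p i)) +
      g p (tangent_onb p i) (tangent_onb p i) * g p (curvature A D p (tangent_onb p i) (\<Xi> p) (\<Xi> p)) (tangent_onb p i)"
      using C[OF i] i by (simp add: g_left algebra_simps)
  qed
  then show ?thesis
    using sectional_eq[OF p] \<Xi>_eq[OF p] tr_curvature_E[OF p] tr_curvature_\<Xi>[OF p min] divS_W[OF p]
    by (simp add: algebra_simps)
qed

text \<open>\<open>B(\<xi>, \<cdot>) = 0\<close>, so \<open>B\<close> is determined by its values on the screen.\<close>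

lemma totally_geodesic_if:
  assumes "\<And>p i j. p \<in> S \<Longrightarrow> i < DIM('e) - 2 \<Longrightarrow> j < DIM('e) - 2 \<Longrightarrow> g p (nab \<Xi> p (scr_onb p i)) (scr_onb p j) = 0"
  shows "totally_geodesic A g D S \<xi>"
  unfolding totally_geodesic_def
proof (intro ballI)
  fix p v w assume p: "p \<in> S" and v: "v \<in> TS p" and w: "w \<in> TS p"
  let ?s = "scr_onb p"
  have \<Xi>w: "g p (\<Xi> p) w = 0" using TS_iff[OF p TS_T[OF w]] w g_sym[OF \<Xi>T TS_T[OF w]] by simp
  have s0: "g p (nab \<Xi> p (?s i)) w = 0" if i: "i < DIM('e) - 2" for i
  proof -
    have "nab \<Xi> p (?s i) = (\<Sum>j<DIM('e) - 2. g p (nab \<Xi> p (?s i)) (?s j) \<cdot>\<^sub>v ?s j) + (sqrt 2 * g p (?s i) (W p)) \<cdot>\<^sub>v \<Xi> p"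
      by (rule nab\<Xi>_scr_expansion[OF p scr_inTS[OF p i]])
    also have "(\<Sum>j<DIM('e) - 2. g p (nab \<Xi> p (?s i)) (?s j) \<cdot>\<^sub>v ?s j) = 0"
      using assms[OF p i] by (intro sum.neutral ballI) simp
    finally have "nab \<Xi> p (?s i) = (sqrt 2 * g p (?s i) (W p)) \<cdot>\<^sub>v \<Xi> p" unfolding add_0_left .
    then show ?thesis using \<Xi>w TS_T[OF w] \<Xi>T by (simp add: g_scale_left)
  qed
  let ?\<phi> = "\<lambda>v. g p (nab \<Xi> p v) w"
  have lf: "linear_form p ?\<phi>" by (rule linear_form_endo[OF linear_form_g[OF TS_T[OF w]] nab_endo[OF \<Xi>_VF]])
  have 1: "?\<phi> v = ?\<phi> ((\<Sum>i<DIM('e) - 2. g p v (?s i) \<cdot>\<^sub>v ?s i) + (sqrt 2 * g p v (E p)) \<cdot>\<^sub>v \<Xi> p)"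
    by (rule arg_cong[OF TS_screen_expansion[OF p v], of ?\<phi>])
  have 2: "?\<phi> ((\<Sum>i<DIM('e) - 2. g p v (?s i) \<cdot>\<^sub>v ?s i) + (sqrt 2 * g p v (E p)) \<cdot>\<^sub>v \<Xi> p)
    = ?\<phi> (\<Sum>i<DIM('e) - 2. g p v (?s i) \<cdot>\<^sub>v ?s i) + ?\<phi> ((sqrt 2 * g p v (E p)) \<cdot>\<^sub>v \<Xi> p)"
    by (rule linear_form_add[OF lf]) (auto intro!: tangent_sum_in scr_inT[OF p] \<Xi>T)
  have 3: "?\<phi> (\<Sum>i<DIM('e) - 2. g p v (?s i) \<cdot>\<^sub>v ?s i) = (\<Sum>i<DIM('e) - 2. g p v (?s i) * ?\<phi> (?s i))"
    by (rule linear_form_sum[OF lf]) (auto intro: scr_inT[OF p])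
  have 4: "(\<Sum>i<DIM('e) - 2. g p v (?s i) * ?\<phi> (?s i)) = 0" using s0 by simp
  have 5: "?\<phi> ((sqrt 2 * g p v (E p)) \<cdot>\<^sub>v \<Xi> p) = 0"
    by (subst linear_form_scale[OF lf \<Xi>T]) (simp add: nab\<Xi>_at_\<Xi>[OF p] g_0_left TS_T[OF w])
  have "?\<phi> v = 0" using 1 2 3 4 5 by linarith
  then show "second_fund A g D S \<xi> p v w = 0"
    by (simp add: second_fund_def nabla_along_eq[OF p v])
qed

end

section \<open>Analysis in coordinates\<close>

text \<open>The standard basis as a type, to index the rows and columns of determinants. The order is an arbitrary one.\<close>

typedef (overloaded) ('e::euclidean_space) axis_index = "Basis :: 'e set"
  morphisms axis_vec Axis_index
  using nonempty_Basis by blast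

lemma axis_vec_Basis [simp]: "axis_vec i \<in> Basis" by (rule axis_vec)

instance axis_index :: (euclidean_space) finite
proof
  have "(UNIV :: 'a axis_index set) = Axis_index ` Basis"
    by (rule type_definition.Abs_image[OF type_definition_axis_index, symmetric])
  then show "finite (UNIV :: 'a axis_index set)" using finite_imageI[OF finite_Basis] by metis
qed

instantiation axis_index :: (euclidean_space) wellorder
begin

definition "axis_number = (SOME f :: 'a axis_index \<Rightarrow> nat. inj f)"

lemma inj_axis_number: "inj (axis_number :: 'a axis_index \<Rightarrow> nat)"
proof -
  have "\<exists>f :: 'a axis_index \<Rightarrow> nat. inj f"
    using finite_imp_inj_to_nat_seg[OF finite_class.finite_UNIV] by blast
  then show ?thesis unfolding axis_number_def by (rule someI_ex)
qed

definition "i \<le> j \<longleftrightarrow> axis_number i \<le> axis_number j"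
definition "i < j \<longleftrightarrow> axis_number i < axis_number j"

instance
proof
  fix P :: "'a axis_index \<Rightarrow> bool" and a :: "'a axis_index"
  assume step: "\<And>x. (\<And>y. y < x \<Longrightarrow> P y) \<Longrightarrow> P x"
  show "P a"
    by (induction a rule: measure_induct_rule[of axis_number]) (rule step, simp add: less_axis_index_def)
qed (auto simp: less_eq_axis_index_def less_axis_index_def dest: injD[OF inj_axis_number])

end

text \<open>\<open>emb\<close> and \<open>coord\<close> are the mutually inverse isometries given by the standard basis.\<close>

definition emb :: "real ^ ('e::euclidean_space axis_index) \<Rightarrow> 'e" where
  "emb x = (\<Sum>i\<in>UNIV. x $ i *\<^sub>R axis_vec i)"

definition coord :: "'e::euclidean_space \<Rightarrow> real ^ ('e axis_index)" where
  "coord y = (\<chi> i. y \<bullet> axis_vec i)"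

lemma sum_axis_vec: "(\<Sum>i\<in>UNIV. f (axis_vec i)) = (\<Sum>b\<in>(Basis :: 'e::euclidean_space set). f b)"
  by (rule sum.reindex_bij_witness[of _ Axis_index axis_vec]) (auto simp: axis_vec_inverse Axis_index_inverse)

lemma axis_vec_inner: "axis_vec i \<bullet> axis_vec j = (if i = j then 1 else 0)"
  by (simp add: inner_Basis axis_vec_inject)

lemma coord_emb [simp]: "coord (emb x) = x"
  by (simp add: vec_eq_iff coord_def emb_def inner_sum_left axis_vec_inner sum.delta if_distrib cong: if_cong)

lemma emb_coord [simp]: "emb (coord y) = y"
  unfolding emb_def coord_def using sum_axis_vec[of "\<lambda>b. (y \<bullet> b) *\<^sub>R b"] by (simp add: euclidean_representation)

lemma linear_emb: "linear emb"
  by (rule linearI) (simp_all add: emb_def scaleR_add_left sum.distrib scaleR_sum_right)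

lemma linear_coord: "linear coord"
  by (rule linearI) (simp_all add: coord_def vec_eq_iff inner_add_left)

lemma emb_axis [simp]: "emb (axis i 1) = axis_vec i"
proof -
  have "coord (axis_vec i) = axis i 1" by (simp add: coord_def vec_eq_iff axis_def axis_vec_inner)
  then show ?thesis by (metis emb_coord)
qed

lemmas bounded_linear_emb = linear_emb[unfolded linear_conv_bounded_linear]
lemmas bounded_linear_coord = linear_coord[unfolded linear_conv_bounded_linear]

lemma continuous_on_emb [continuous_intros]: "continuous_on U f \<Longrightarrow> continuous_on U (\<lambda>x. emb (f x))"
  and continuous_on_coord [continuous_intros]: "continuous_on U h \<Longrightarrow> continuous_on U (\<lambda>x. coord (h x))"
  using bounded_linear.continuous_on[OF bounded_linear_emb] bounded_linear.continuous_on[OF bounded_linear_coord] by auto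

subsection \<open>Jacobi's formula\<close>

text \<open>In the Leibniz formula only the identity contributes: any other permutation moves at least two points, so that every
summand of the product rule keeps an off-diagonal entry of the identity matrix.\<close>

lemma det_derivative_at_identity:
  fixes M :: "real \<Rightarrow> real^'n^'n" and B :: "real^'n^'n"
  assumes M: "\<And>i j. ((\<lambda>t. M t $ i $ j) has_real_derivative B $ i $ j) (at 0)" and M0: "M 0 = mat 1"
  shows "((\<lambda>t. det (M t)) has_real_derivative trace B) (at 0)"
proof -
  let ?P = "{p. p permutes (UNIV :: 'n set)}"
  let ?d = "\<lambda>p. \<Sum>i\<in>UNIV. B $ i $ p i * (\<Prod>j\<in>UNIV - {i}. M 0 $ j $ p j)"
  have "((\<lambda>t. \<Sum>p\<in>?P. of_int (sign p) * (\<Prod>i\<in>UNIV. M t $ i $ p i)) has_real_derivative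
     (\<Sum>p\<in>?P. of_int (sign p) * ?d p)) (at 0)"
    by (intro DERIV_sum DERIV_cmult has_field_derivative_prod M)
  moreover have "(\<Sum>p\<in>?P. of_int (sign p) * ?d p) = (\<Sum>p\<in>?P. if p = id then trace B else 0)"
  proof (intro sum.cong refl)
    fix p assume p: "p \<in> ?P"
    show "of_int (sign p) * ?d p = (if p = id then trace B else 0)"
    proof (cases "p = id")
      case True then show ?thesis by (simp add: M0 mat_def trace_def)
    next
      case False
      have "(\<Prod>j\<in>UNIV - {i}. M 0 $ j $ p j) = 0" for i
      proof -
        obtain k where k: "p k \<noteq> k" using False by (auto simp: fun_eq_iff)
        have "p (p k) \<noteq> p k" using k permutes_inj[of p UNIV] p by (auto dest: injD)
        then obtain j where "j \<noteq> i" "p j \<noteq> j" using k by metis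
        then show ?thesis by (intro prod_zero) (auto simp: M0 mat_def intro!: bexI[of _ j])
      qed
      then have "?d p = 0" by (simp only: mult_zero_right sum.neutral_const)
      then show ?thesis using False by simp
    qed
  qed
  moreover have "\<dots> = trace B" by (simp add: permutes_id finite_permutations)
  ultimately show ?thesis by (simp add: det_def)
qed

text \<open>Gram matrices have derivatives of this form: if \<open>f\<^sub>i' = \<Sum>\<^sub>k C\<^sub>k\<^sub>i f\<^sub>k\<close>, then \<open>G' = C\<^sup>T G + G C\<close>. Multiplication by the
inverse of \<open>G 0\<close> reduces to the derivative at the identity, and the trace is cyclic.\<close>

lemma det_derivative_gram:
  fixes G :: "real \<Rightarrow> real^'n^'n" and C :: "real^'n^'n"
  assumes G: "\<And>i j. ((\<lambda>t. G t $ i $ j) has_real_derivative (transpose C ** G 0 + G 0 ** C) $ i $ j) (at 0)"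
    and nz: "det (G 0) \<noteq> 0"
  shows "((\<lambda>t. det (G t)) has_real_derivative 2 * trace C * det (G 0)) (at 0)"
proof -
  have "invertible (G 0)" using nz by (simp add: invertible_det_nz)
  then obtain I where I: "G 0 ** I = mat 1" "I ** G 0 = mat 1" by (auto simp: invertible_def)
  define H where "H = transpose C ** G 0 + G 0 ** C"
  have "((\<lambda>t. (I ** G t) $ i $ j) has_real_derivative (I ** H) $ i $ j) (at 0)" for i j
    unfolding matrix_matrix_mult_def using G by (auto intro!: DERIV_sum DERIV_cmult simp: H_def)
  then have "((\<lambda>t. det (I ** G t)) has_real_derivative trace (I ** H)) (at 0)"
    by (rule det_derivative_at_identity) (rule I)
  then have "((\<lambda>t. det (G 0) * (det (I ** G t))) has_real_derivative det (G 0) * trace (I ** H)) (at 0)"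
    by (rule DERIV_cmult)
  moreover have "det (G 0) * det (I ** G t) = det (G t)" for t
  proof -
    have "det (G 0) * det I = 1" using I(1) by (metis det_I det_mul)
    then show ?thesis by (simp add: det_mul mult.assoc[symmetric])
  qed
  moreover have "trace (I ** H) = 2 * trace C"
  proof -
    have "trace (I ** H) = trace (I ** (transpose C ** G 0)) + trace (I ** (G 0 ** C))"
      by (simp add: H_def matrix_add_ldistrib trace_add)
    also have "trace (I ** (transpose C ** G 0)) = trace ((transpose C ** G 0) ** I)" by (rule trace_mul_sym)
    also have "(transpose C ** G 0) ** I = transpose C" by (simp add: matrix_mul_assoc[symmetric] I)
    also have "trace (transpose C) = trace C" by (simp add: trace_def transpose_def)
    also have "I ** (G 0 ** C) = C" by (simp add: matrix_mul_assoc I)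
    finally show ?thesis by simp
  qed
  ultimately show ?thesis by (simp add: mult.commute mult.left_commute)
qed

lemma sqrt_abs_det_derivative:
  fixes G :: "real \<Rightarrow> real^'n^'n" and C :: "real^'n^'n"
  assumes G: "\<And>i j. ((\<lambda>t. G t $ i $ j) has_real_derivative (transpose C ** G 0 + G 0 ** C) $ i $ j) (at 0)"
    and nz: "det (G 0) \<noteq> 0"
  shows "((\<lambda>t. sqrt \<bar>det (G t)\<bar>) has_real_derivative trace C * sqrt \<bar>det (G 0)\<bar>) (at 0)"
proof -
  let ?d = "det (G 0)"
  note d = det_derivative_gram[OF G nz]
  have "((\<lambda>t. sqrt ((det (G t))\<^sup>2)) has_real_derivative
      inverse (sqrt (?d\<^sup>2)) / 2 * (2 * ?d * (2 * trace C * ?d))) (at 0)"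
    by (rule DERIV_chain2[OF DERIV_real_sqrt]) (use nz in \<open>auto intro!: derivative_eq_intros d\<close>)
  moreover have "inverse (sqrt (?d\<^sup>2)) / 2 * (2 * ?d * (2 * trace C * ?d)) = sgn ?d * (2 * trace C * ?d)"
    using nz by (auto simp: sgn_if)
  ultimately have "((\<lambda>t. sqrt ((det (G t))\<^sup>2)) has_real_derivative sgn ?d * (2 * trace C * ?d)) (at 0)"
    by (rule DERIV_cong)
  then have "((\<lambda>t. \<bar>det (G t)\<bar>) has_real_derivative sgn ?d * (2 * trace C * ?d)) (at 0)"
    unfolding real_sqrt_abs .
  then have "((\<lambda>t. sqrt \<bar>det (G t)\<bar>) has_real_derivative inverse (sqrt \<bar>?d\<bar>) / 2 * (sgn ?d * (2 * trace C * ?d))) (at 0)"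
    by (rule DERIV_chain2[OF DERIV_real_sqrt, rotated]) (use nz in auto)
  moreover have "inverse (sqrt \<bar>?d\<bar>) / 2 * (sgn ?d * (2 * trace C * ?d)) = trace C * sqrt \<bar>?d\<bar>"
  proof -
    have 1: "sgn ?d * ?d = sqrt \<bar>?d\<bar> * sqrt \<bar>?d\<bar>" by (auto simp: sgn_if)
    have "inverse (sqrt \<bar>?d\<bar>) / 2 * (sgn ?d * (2 * trace C * ?d)) =
      inverse (sqrt \<bar>?d\<bar>) * (sgn ?d * ?d) * trace C" by algebra
    also have "\<dots> = trace C * ((inverse (sqrt \<bar>?d\<bar>) * sqrt \<bar>?d\<bar>) * sqrt \<bar>?d\<bar>)"
      unfolding 1 by algebra
    finally have "inverse (sqrt \<bar>?d\<bar>) / 2 * (sgn ?d * (2 * trace C * ?d)) =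
      trace C * ((inverse (sqrt \<bar>?d\<bar>) * sqrt \<bar>?d\<bar>) * sqrt \<bar>?d\<bar>)" .
    then show ?thesis using nz by simp
  qed
  ultimately show ?thesis by (rule DERIV_cong)
qed

subsection \<open>Integration by parts and change of variables\<close>

text \<open>The integral is translation invariant, so differentiating under the integral sign gives zero.\<close>

lemma integral_directional_derivative:
  fixes q q' :: "'a::euclidean_space \<Rightarrow> real"
  assumes q: "continuous_on UNIV q" and q': "continuous_on UNIV q'"
    and der: "\<And>x. ((\<lambda>t. q (x + t *\<^sub>R u)) has_real_derivative q' x) (at 0)"
    and C: "bounded C" "\<And>x. x \<notin> C \<Longrightarrow> q x = 0" "\<And>x. x \<notin> C \<Longrightarrow> q' x = 0"
  shows "integral UNIV q' = 0"
proof -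
  obtain a b where ab: "C \<subseteq> cbox a b" using bounded_subset_cbox_symmetric[OF C(1)] by metis
  have "bounded ((\<lambda>(x, t). x - t *\<^sub>R u) ` (cbox a b \<times> {-1..1}))"
    by (intro compact_imp_bounded compact_continuous_image compact_Times compact_cbox compact_Icc)
      (auto intro!: continuous_intros simp: split_beta)
  then obtain a' b' where ab': "(\<lambda>(x, t). x - t *\<^sub>R u) ` (cbox a b \<times> {-1..1}) \<subseteq> cbox a' b'"
    using bounded_subset_cbox_symmetric by metis
  have sub: "cbox a b \<subseteq> cbox (a' + t *\<^sub>R u) (b' + t *\<^sub>R u)" if "t \<in> {-1..1}" for t
  proof
    fix x assume "x \<in> cbox a b"
    then have "x - t *\<^sub>R u \<in> cbox a' b'" using ab' that by force
    then show "x \<in> cbox (a' + t *\<^sub>R u) (b' + t *\<^sub>R u)" by (auto simp: mem_box inner_add_left inner_diff_left algebra_simps)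
  qed
  have out: "q x = 0" "q' x = 0" if "x \<notin> cbox a b" for x using that ab C by auto
  define J where "J = integral (cbox a b) q"
  have qJ: "(q has_integral J) (cbox a b)"
    unfolding J_def by (intro integrable_integral integrable_continuous continuous_on_subset[OF q]) auto
  have const: "integral (cbox a' b') (\<lambda>x. q (x + t *\<^sub>R u)) = J" if t: "t \<in> {-1..1}" for t
  proof -
    have "(q has_integral J) (cbox (a' + t *\<^sub>R u) (b' + t *\<^sub>R u))"
      by (rule has_integral_on_superset[OF qJ _ sub[OF t]]) (use out in auto)
    then have "((q \<circ> (+) (t *\<^sub>R u)) has_integral J) (cbox a' b')" by (simp add: has_integral_shift_cbox_iff)
    then show ?thesis by (simp add: o_def add.commute integral_unique)
  qed
  have cont: "continuous_on U (\<lambda>z. q (f z))" "continuous_on U (\<lambda>z. q' (f z))" if "continuous_on U f" for U and f :: "'z::topological_space \<Rightarrow> 'a"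
    using continuous_on_compose2[OF q that] continuous_on_compose2[OF q' that] by auto
  have d: "((\<lambda>t. q (x + t *\<^sub>R u)) has_vector_derivative q' (x + t *\<^sub>R u)) (at t within {-1..1})" for t x
  proof -
    have "((\<lambda>s. q (x + t *\<^sub>R u + s *\<^sub>R u)) has_real_derivative q' (x + t *\<^sub>R u)) (at (t - t))"
      using der[of "x + t *\<^sub>R u"] by simp
    then have "((\<lambda>s. q (x + t *\<^sub>R u + (s - t) *\<^sub>R u)) has_real_derivative q' (x + t *\<^sub>R u)) (at t)"
      using DERIV_chain2[of "\<lambda>s. q (x + t *\<^sub>R u + s *\<^sub>R u)" _ "\<lambda>s. s - t" t 1 UNIV]
      by (simp add: DERIV_diff[OF DERIV_ident DERIV_const, simplified])
    then show ?thesis by (auto simp: algebra_simps has_real_derivative_iff_has_vector_derivative intro: has_vector_derivative_at_within)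
  qed
  have "((\<lambda>t. integral (cbox a' b') (\<lambda>x. q (x + t *\<^sub>R u))) has_vector_derivative
     integral (cbox a' b') (\<lambda>x. q' (x + 0 *\<^sub>R u))) (at 0 within {-1..1})"
    by (rule leibniz_rule_vector_derivative[OF d])
      (auto intro!: integrable_continuous cont continuous_intros simp: split_beta)
  then have "((\<lambda>t. J) has_vector_derivative integral (cbox a' b') q') (at 0 within {-1..1})"
    unfolding scaleR_zero_left add_0_right
    by (rule has_vector_derivative_transform[rotated 2]) (use const in auto)
  moreover have "((\<lambda>t. J) has_vector_derivative 0) (at 0 within {-1..1})" by simp
  ultimately have "integral (cbox a' b') q' = 0"
    by (rule vector_derivative_unique_within[rotated]) (simp add: trivial_limit_within)
  moreover have "integral (cbox a' b') q' = integral UNIV q'"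
  proof (rule integral_unique[symmetric], rule has_integral_on_superset)
    show "(q' has_integral integral (cbox a' b') q') (cbox a' b')"
      by (intro integrable_integral integrable_continuous continuous_on_subset[OF q']) auto
    show "q' x = 0" if "x \<notin> cbox a' b'" for x using that sub[of 0] out by auto
  qed auto
  ultimately show ?thesis by simp
qed

lemma integral_change_of_variables_scalar:
  fixes f :: "real^'n::{finite,wellorder} \<Rightarrow> real" and h :: "real^'n::_ \<Rightarrow> real^'n::_"
  assumes "S \<in> sets lebesgue" "\<And>x. x \<in> S \<Longrightarrow> (h has_derivative h' x) (at x within S)" "inj_on h S"
    and f: "f absolutely_integrable_on (h ` S)"
  shows "integral (h ` S) f = integral S (\<lambda>x. \<bar>det (matrix (h' x))\<bar> * f (h x))"
proof -
  have "(\<lambda>x. vec (f x) :: real^1) absolutely_integrable_on (h ` S)"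
    using f by (simp add: absolutely_integrable_on_1_iff)
  then have "integral (h ` S) (\<lambda>x. vec (f x) :: real^1) = integral S (\<lambda>x. \<bar>det (matrix (h' x))\<bar> *\<^sub>R vec (f (h x)))"
    by (intro integral_change_of_variables[OF assms(1-3)]) auto
  then show ?thesis by (simp add: integral_on_1_eq)
qed

lemma continuous_compact_support_absolutely_integrable:
  fixes f :: "'a::euclidean_space \<Rightarrow> real"
  assumes f: "continuous_on UNIV f" and C: "bounded C" "\<And>x. x \<notin> C \<Longrightarrow> f x = 0"
  shows "f absolutely_integrable_on UNIV" "f integrable_on UNIV"
proof -
  obtain a b where ab: "C \<subseteq> cbox a b" using bounded_subset_cbox_symmetric[OF C(1)] by metis
  have "f absolutely_integrable_on cbox a b"
    by (intro absolutely_integrable_continuous continuous_on_subset[OF f]) auto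
  then have "(\<lambda>x. if x \<in> cbox a b then f x else 0) absolutely_integrable_on UNIV"
    by (simp add: absolutely_integrable_restrict_UNIV)
  moreover have "(\<lambda>x. if x \<in> cbox a b then f x else 0) = f" using ab C(2) by (auto simp: fun_eq_iff)
  ultimately show "f absolutely_integrable_on UNIV" by simp
  then show "f integrable_on UNIV" by (simp add: absolutely_integrable_on_def)
qed

lemma continuous_nonneg_integral_0:
  fixes f :: "'a::euclidean_space \<Rightarrow> real"
  assumes f: "continuous_on UNIV f" and C: "bounded C" "\<And>x. x \<notin> C \<Longrightarrow> f x = 0"
    and nn: "\<And>x. 0 \<le> f x" and 0: "integral UNIV f = 0"
  shows "f x = 0"
proof -
  have "bounded (C \<union> {x})" using C(1) by simp
  then obtain a where a: "C \<union> {x} \<subseteq> box (-a) a" using bounded_subset_box_symmetric by metis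
  then have x: "x \<in> box (-a) a" by auto
  have int: "f integrable_on cbox (-a) a" by (intro integrable_continuous continuous_on_subset[OF f]) auto
  have "(f has_integral integral (cbox (-a) a) f) UNIV"
    by (rule has_integral_on_superset[OF integrable_integral[OF int]])
      (use a C(2) box_subset_cbox[of "-a" a] in auto)
  then have "integral (cbox (-a) a) f = 0" using 0 by (simp add: integral_unique)
  then have "(f has_integral 0) (cbox (-a) a)" using integrable_integral[OF int] by simp
  then show ?thesis
    by (rule has_integral_0_cbox_imp_0[rotated 2]) 
      (use x nn box_subset_cbox[of "-a" a] continuous_on_subset[OF f] in auto)
qed

section \<open>The divergence theorem on a compact null hypersurface\<close>

text \<open>The projection onto the hyperplane \<open>{y. y \<bullet> b = 0}\<close> of a slice chart.\<close>

definition sl_proj :: "'e::euclidean_space \<Rightarrow> 'e \<Rightarrow> 'e" where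
  "sl_proj b y = y - (y \<bullet> b) *\<^sub>R b"

lemma sl_proj_inner: "b \<in> Basis \<Longrightarrow> sl_proj b y \<bullet> b = 0"
  by (simp add: sl_proj_def inner_diff_left)

lemma sl_proj_id: "y \<bullet> b = 0 \<Longrightarrow> sl_proj b y = y"
  by (simp add: sl_proj_def)

lemma sl_proj_add: "b \<in> Basis \<Longrightarrow> y \<bullet> b = 0 \<Longrightarrow> sl_proj b (y + t *\<^sub>R b) = y"
  by (simp add: sl_proj_def inner_add_left)

lemma bounded_linear_sl_proj: "bounded_linear (sl_proj b)"
proof -
  have "linear (sl_proj b)" by (rule linearI) (simp_all add: sl_proj_def algebra_simps inner_add_left)
  then show ?thesis by (simp add: linear_conv_bounded_linear)
qed

lemma continuous_on_sl_proj [continuous_intros]: "continuous_on U f \<Longrightarrow> continuous_on U (\<lambda>x. sl_proj b (f x))"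
  using bounded_linear.continuous_on[OF bounded_linear_sl_proj] .

text \<open>A weight for the coordinate transversal to the hyperplane. Instead of integrating over the hyperplane, functions on it
are extended constantly in the direction \<open>b\<close>, multiplied by this weight and integrated over the whole space. All
transition maps preserve the transversal coordinate.\<close>

definition tent :: "real \<Rightarrow> real" where "tent s = max 0 (1 - \<bar>s\<bar>)"

lemma continuous_on_tent [continuous_intros]: "continuous_on U f \<Longrightarrow> continuous_on U (\<lambda>x. tent (f x))"
  unfolding tent_def by (intro continuous_intros)

lemma tent_nonneg: "0 \<le> tent s" and tent_0: "tent 0 = 1" and tent_outside: "tent s \<noteq> 0 \<Longrightarrow> s \<in> {-1..1}"
  by (auto simp: tent_def)

context manifold begin

lemma curve_derivative:
  assumes f: "f \<in> Cinf A" and c: "c \<in> max_atlas A" "p \<in> dom_chart c"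
  shows "((\<lambda>t. f (inv_chart c (map_chart c p + t *\<^sub>R j))) has_real_derivative pd c j p f) (at 0)"
proof -
  have l: "((\<lambda>t. map_chart c p + t *\<^sub>R j) has_derivative (\<lambda>t. t *\<^sub>R j)) (at 0)"
    by (auto intro!: derivative_eq_intros)
  have "((\<lambda>t. (f \<circ> inv_chart c) (map_chart c p + t *\<^sub>R j)) has_derivative (\<lambda>t. pd c (t *\<^sub>R j) p f)) (at 0)"
    using diff_chain_at[OF l, of "f \<circ> inv_chart c" "\<lambda>w. pd c w p f"] pd_has_derivative[OF f c] by (simp add: o_def)
  moreover have "(\<lambda>t. pd c (t *\<^sub>R j) p f) = (*) (pd c j p f)"
    by (simp add: pd_scale[OF c] fun_eq_iff)
  ultimately show ?thesis by (simp add: has_field_derivative_def)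
qed

text \<open>The point of the hypersurface below \<open>x\<close>; it is meaningful on the set \<open>pdom\<close> of those \<open>x\<close> whose projection lies in
the image of the chart.\<close>

definition param :: "('m, 'e) chart \<Rightarrow> 'e \<Rightarrow> real ^ 'e axis_index \<Rightarrow> 'm" where
  "param c b x = inv_chart c (sl_proj b (emb x))"

definition pdom :: "('m, 'e) chart \<Rightarrow> 'e \<Rightarrow> (real ^ 'e axis_index) set" where
  "pdom c b = {x. sl_proj b (emb x) \<in> map_chart c ` dom_chart c}"

context
  fixes S c b assumes s: "slice S c b"
begin

lemma open_pdom: "open (pdom c b)"
proof -
  have "pdom c b = (\<lambda>x. sl_proj b (emb x)) -` (map_chart c ` dom_chart c)" by (auto simp: pdom_def)
  then show ?thesis
    by (simp add: open_vimage[OF open_image_chart[OF sliceD(1)[OF s]]] continuous_intros continuous_on_id)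
qed

lemma param_dom: "x \<in> pdom c b \<Longrightarrow> param c b x \<in> dom_chart c"
  using inv_chart_in[OF sliceD(1)[OF s]] by (simp add: pdom_def param_def)

lemma map_param: "x \<in> pdom c b \<Longrightarrow> map_chart c (param c b x) = sl_proj b (emb x)"
  using map_inv_chart[OF sliceD(1)[OF s]] by (simp add: pdom_def param_def)

lemma param_S: "x \<in> pdom c b \<Longrightarrow> param c b x \<in> S"
  using slice_iff[OF s param_dom] map_param sl_proj_inner[OF sliceD(2)[OF s]] by simp

lemma continuous_on_param: "continuous_on (pdom c b) (param c b)"
  unfolding param_def
  by (rule continuous_on_compose2[OF continuous_inv_chart[OF sliceD(1)[OF s]]])
    (auto simp: pdom_def intro!: continuous_intros continuous_on_id)

lemma param_coord:
  assumes "q \<in> S" "q \<in> dom_chart c"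
  shows "coord (map_chart c q + t *\<^sub>R b) \<in> pdom c b" "param c b (coord (map_chart c q + t *\<^sub>R b)) = q"
    "emb (coord (map_chart c q + t *\<^sub>R b)) \<bullet> b = t"
proof -
  have "map_chart c q \<bullet> b = 0" using slice_iff[OF s] assms by simp
  then have 1: "sl_proj b (map_chart c q + t *\<^sub>R b) = map_chart c q" by (rule sl_proj_add[OF sliceD(2)[OF s]])
  then show "coord (map_chart c q + t *\<^sub>R b) \<in> pdom c b" using assms by (simp add: pdom_def)
  show "param c b (coord (map_chart c q + t *\<^sub>R b)) = q" using assms 1 sliceD(1)[OF s] by (simp add: param_def)
  show "emb (coord (map_chart c q + t *\<^sub>R b)) \<bullet> b = t"
    using \<open>map_chart c q \<bullet> b = 0\<close> sliceD(2)[OF s] by (simp add: inner_add_left)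
qed

lemma coord_param: "x \<in> pdom c b \<Longrightarrow> coord (map_chart c (param c b x) + (emb x \<bullet> b) *\<^sub>R b) = x"
  by (simp add: map_param sl_proj_def)

end

end

context null_hypersurface begin

text \<open>The coordinate vectors tangent to the hypersurface, completed by \<open>E\<close> in the transversal slot. The Gram determinant of
this frame is the square of the density \<open>|vol(E, \<cdot>, \<dots>, \<cdot>)|\<close> up to sign, in the coordinates of the chart.\<close>

definition "frame c b i q = (if i = b then E q else pd c i q)"

definition "gram c b q = (\<chi> i j. g q (frame c b (axis_vec i) q) (frame c b (axis_vec j) q))"

definition "dens c b q = sqrt \<bar>det (gram c b q)\<bar>"

lemma frame_T: "c \<in> max_atlas A \<Longrightarrow> q \<in> dom_chart c \<Longrightarrow> frame c b i q \<in> T q"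
  using ET pd_tangent by (simp add: frame_def)

lemma frame_expansion:
  assumes p: "p \<in> S" and s: "slice S c b" and lf: "local_frame c V x F" "p \<in> V" and v: "v \<in> T p"
  shows "v = (\<Sum>i\<in>Basis. (if i = b then sqrt 2 * g p v (\<Xi> p) else proj p v (x i)) \<cdot>\<^sub>v frame c b i p)"
proof -
  define \<theta> where "\<theta> i = (if i = b then sqrt 2 * g p v (\<Xi> p) else proj p v (x i))" for i
  have "proj p v = (\<Sum>i\<in>Basis - {b}. proj p v (x i) \<cdot>\<^sub>v pd c i p)"
    by (rule tangent_sub_expansion[OF s lf p proj_TS[OF p v]])
  also have "\<dots> = (\<Sum>i\<in>Basis - {b}. \<theta> i \<cdot>\<^sub>v frame c b i p)" by (intro sum.cong) (auto simp: frame_def \<theta>_def)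
  finally have 1: "proj p v = (\<Sum>i\<in>Basis - {b}. \<theta> i \<cdot>\<^sub>v frame c b i p)" .
  have "v = \<theta> b \<cdot>\<^sub>v frame c b b p + proj p v" by (simp add: proj_def frame_def \<theta>_def)
  then have "v = \<theta> b \<cdot>\<^sub>v frame c b b p + (\<Sum>i\<in>Basis - {b}. \<theta> i \<cdot>\<^sub>v frame c b i p)" unfolding 1 .
  then have "v = (\<Sum>i\<in>Basis. \<theta> i \<cdot>\<^sub>v frame c b i p)"
    unfolding sum.remove[OF finite_Basis sliceD(2)[OF s], of "\<lambda>i. \<theta> i \<cdot>\<^sub>v frame c b i p"] .
  then show ?thesis unfolding \<theta>_def .
qed

lemma frame_independent:
  assumes p: "p \<in> S" and s: "slice S c b" and pc: "p \<in> dom_chart c"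
    and 0: "(\<Sum>i\<in>Basis. a i \<cdot>\<^sub>v frame c b i p) = 0" and k: "k \<in> Basis"
  shows "a k = 0"
proof -
  note c = sliceD(1)[OF s] and b = sliceD(2)[OF s]
  obtain V x F where lf: "local_frame c V x F" "p \<in> V" using local_frame_exists[OF c pc, of UNIV] by auto
  have iB: "i \<bullet> b = 0" if "i \<in> Basis - {b}" for i using that b by (auto simp: inner_Basis)
  have "g p (\<Sum>i\<in>Basis. a i \<cdot>\<^sub>v frame c b i p) (\<Xi> p) = (\<Sum>i\<in>Basis. a i * g p (frame c b i p) (\<Xi> p))"
    by (rule linear_form_sum[OF linear_form_g[OF \<Xi>T]]) (rule frame_T[OF c pc])
  also have "\<dots> = (\<Sum>i\<in>Basis. if i = b then a b * (1 / sqrt 2) else 0)"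
  proof (intro sum.cong refl)
    fix i assume i: "i \<in> (Basis :: 'e set)"
    show "a i * g p (frame c b i p) (\<Xi> p) = (if i = b then a b * (1 / sqrt 2) else 0)"
      using TS_iff[OF p pd_tangent[OF c pc]] pd_tangent_sub[OF s pc p iB, of i] i E_\<Xi>[OF p] by (auto simp: frame_def)
  qed
  also have "\<dots> = a b * (1 / sqrt 2)" using b by simp
  finally have ab: "a b = 0" using 0 g_0_left[OF \<Xi>T[of p]] by simp
  show ?thesis
  proof (cases "k = b")
    case False
    have "(\<Sum>i\<in>Basis. a i \<cdot>\<^sub>v frame c b i p) (x k) = (\<Sum>i\<in>Basis. a i * frame c b i p (x k))"
      by (simp add: sum_fun_apply)
    also have "\<dots> = (\<Sum>i\<in>Basis. if i = k then a k else 0)"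
      using ab False k local_frame_pd_x[OF lf] by (intro sum.cong refl) (auto simp: frame_def inner_Basis)
    also have "\<dots> = a k" using k by simp
    finally show ?thesis using 0 by simp
  qed (use ab in simp)
qed

text \<open>A vector in the kernel of the Gram matrix yields a combination of the frame that is orthogonal to all tangent vectors.\<close>

lemma gram_nondegenerate:
  assumes p: "p \<in> S" and s: "slice S c b" and pc: "p \<in> dom_chart c"
  shows "det (gram c b p) \<noteq> 0"
proof -
  note c = sliceD(1)[OF s]
  obtain V x F where lf: "local_frame c V x F" "p \<in> V" using local_frame_exists[OF c pc, of UNIV] by auto
  let ?f = "\<lambda>i. frame c b i p"
  have fT: "?f i \<in> T p" for i by (rule frame_T[OF c pc])
  have "z = 0" if z: "gram c b p *v z = 0" for z
  proof -
    define a where "a i = z $ Axis_index i" for i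
    define u where "u = (\<Sum>i\<in>Basis. a i \<cdot>\<^sub>v ?f i)"
    have uT: "u \<in> T p" unfolding u_def by (intro tangent_sum_in tangent_scale_in fT)
    have az: "a (axis_vec i) = z $ i" for i by (simp add: a_def axis_vec_inverse)
    have ui: "g p (?f i) u = 0" if i: "i \<in> Basis" for i
    proof -
      have "g p u (?f i) = (\<Sum>j\<in>Basis. a j * g p (?f j) (?f i))"
        unfolding u_def by (rule linear_form_sum[OF linear_form_g[OF fT] fT])
      also have "\<dots> = (\<Sum>j\<in>UNIV. z $ j * g p (?f (axis_vec j)) (?f i))"
        unfolding sum_axis_vec[symmetric] az ..
      also have "\<dots> = (gram c b p *v z) $ (Axis_index i)"
        unfolding matrix_vector_mult_def gram_def using i
        by (simp add: Axis_index_inverse g_sym[OF fT fT, of i] mult.commute)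
      finally show ?thesis using z g_sym[OF uT fT] by simp
    qed
    have "g p u v = 0" if v: "v \<in> T p" for v
    proof -
      let ?\<theta> = "\<lambda>i. if i = b then sqrt 2 * g p v (\<Xi> p) else proj p v (x i)"
      have "g p v u = g p (\<Sum>i\<in>Basis. ?\<theta> i \<cdot>\<^sub>v ?f i) u"
        by (rule arg_cong[OF frame_expansion[OF p s lf v], of "\<lambda>z. g p z u"])
      also have "\<dots> = (\<Sum>i\<in>Basis. ?\<theta> i * g p (?f i) u)"
        by (rule linear_form_sum[OF linear_form_g[OF uT] fT])
      also have "\<dots> = 0" using ui by simp
      finally show ?thesis using g_sym[OF uT v] by simp
    qed
    then have "u = 0" by (rule g_nondegenerate[OF uT])
    then have "a i = 0" if "i \<in> Basis" for i
      unfolding u_def by (rule frame_independent[OF p s pc _ that])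
    then show "z = 0" using az axis_vec_Basis by (metis vec_eq_iff zero_index)
  qed
  then have "\<exists>B. B ** gram c b p = mat 1" by (subst matrix_left_invertible_ker) auto
  then have "invertible (gram c b p)" using matrix_left_right_inverse by (auto simp: invertible_def)
  then show ?thesis by (simp add: invertible_det_nz)
qed

lemma dens_pos: "p \<in> S \<Longrightarrow> slice S c b \<Longrightarrow> p \<in> dom_chart c \<Longrightarrow> 0 < dens c b p"
  using gram_nondegenerate by (simp add: dens_def)

text \<open>The frame near a point, as restrictions of global fields.\<close>

definition "Fr F b i = (if i = b then E else F i)"

lemma Fr_VF: "local_frame c V x F \<Longrightarrow> Fr F b i \<in> VF"
  using local_frame_VF by (simp add: Fr_def)

lemma frame_Fr: "local_frame c V x F \<Longrightarrow> q \<in> V \<Longrightarrow> frame c b i q = Fr F b i q"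
  using local_frame_F by (simp add: Fr_def frame_def)

lemma continuous_on_dens:
  assumes c: "c \<in> max_atlas A"
  shows "continuous_on (dom_chart c) (dens c b)"
proof -
  have "isCont (dens c b) p" if p: "p \<in> dom_chart c" for p
  proof -
    obtain V x F where lf: "local_frame c V x F" "p \<in> V" using local_frame_exists[OF c p, of UNIV] by auto
    define h where "h q = sqrt \<bar>\<Sum>\<sigma>\<in>{\<sigma>. \<sigma> permutes UNIV}. of_int (sign \<sigma>) *
      (\<Prod>i\<in>UNIV. g q (Fr F b (axis_vec i) q) (Fr F b (axis_vec (\<sigma> i)) q))\<bar>" for q
    have "continuous_on V h" unfolding h_def
      by (intro continuous_intros Cinf_continuous_on g_Cinf Fr_VF[OF lf(1)])
    moreover have "dens c b q = h q" if "q \<in> V" for q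
      unfolding dens_def gram_def det_def h_def using frame_Fr[OF lf(1) that] by simp
    ultimately have "continuous_on V (dens c b)" by (simp cong: continuous_on_cong)
    then show ?thesis using lf local_frame_chart(2)[OF lf(1)] by (simp add: continuous_on_eq_continuous_at)
  qed
  then show ?thesis by (simp add: continuous_at_imp_continuous_on)
qed

text \<open>The covariant derivatives of the frame fields in the direction \<open>F j\<close> have a coefficient matrix \<open>C\<close> in the frame, and
Jacobi's formula gives \<open>trace C\<close> as the logarithmic derivative of the density. As coordinate fields commute, this
trace is the divergence of \<open>F j\<close>.\<close>

lemma dens_derivative:
  assumes p: "p \<in> S" and s: "slice S c b" and lf: "local_frame c V x F" "p \<in> V" and j: "j \<in> Basis"
  shows "((\<lambda>t. dens c b (inv_chart c (map_chart c p + t *\<^sub>R j))) has_real_derivative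
     ((\<Sum>i\<in>Basis - {b}. proj p (D (F j) (F i) p) (x i)) + sqrt 2 * g p (D (F j) E p) (\<Xi> p)) * dens c b p) (at 0)"
proof -
  note c = sliceD(1)[OF s] and pc = local_frame_chart(4)[OF lf]
  let ?\<theta> = "\<lambda>i v. if i = b then sqrt 2 * g p v (\<Xi> p) else proj p v (x i)"
  let ?Fr = "Fr F b"
  note FV = Fr_VF[OF lf(1), of b] and Fj = local_frame_VF[OF lf(1), of j]
  define C where "C = (\<chi> k i. ?\<theta> (axis_vec k) (D (F j) (?Fr (axis_vec i)) p))"
  define G where "G t = gram c b (inv_chart c (map_chart c p + t *\<^sub>R j))" for t
  have G0: "G 0 = gram c b p" using inv_map_chart[OF c pc] by (simp add: G_def)
  have fT: "frame c b i p \<in> T p" for i by (rule frame_T[OF c pc])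
  have exp: "g p (D (F j) (?Fr (axis_vec i)) p) (frame c b (axis_vec k) p) = (transpose C ** gram c b p) $ i $ k" for i k
  proof -
    let ?v = "D (F j) (?Fr (axis_vec i)) p"
    have vT: "?v \<in> T p" by (rule VF_at[OF D_VF[OF Fj FV]])
    have "g p ?v (frame c b (axis_vec k) p) = g p (\<Sum>l\<in>Basis. ?\<theta> l ?v \<cdot>\<^sub>v frame c b l p) (frame c b (axis_vec k) p)"
      by (rule arg_cong[OF frame_expansion[OF p s lf vT], of "\<lambda>z. g p z (frame c b (axis_vec k) p)"])
    also have "\<dots> = (\<Sum>l\<in>Basis. ?\<theta> l ?v * g p (frame c b l p) (frame c b (axis_vec k) p))"
      by (rule linear_form_sum[OF linear_form_g[OF fT] fT])
    also have "\<dots> = (\<Sum>l\<in>UNIV. ?\<theta> (axis_vec l) ?v * g p (frame c b (axis_vec l) p) (frame c b (axis_vec k) p))"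
      by (rule sum_axis_vec[symmetric])
    finally show ?thesis by (simp add: matrix_matrix_mult_def transpose_def C_def gram_def)
  qed
  have gs: "transpose (gram c b p) = gram c b p"
    using g_sym[OF fT fT] by (simp add: transpose_def gram_def vec_eq_iff)
  have "((\<lambda>t. G t $ i $ k) has_real_derivative (transpose C ** G 0 + G 0 ** C) $ i $ k) (at 0)" for i k
  proof -
    let ?\<phi> = "\<lambda>q. g q (?Fr (axis_vec i) q) (?Fr (axis_vec k) q)"
    have "((\<lambda>t. ?\<phi> (inv_chart c (map_chart c p + t *\<^sub>R j))) has_real_derivative pd c j p ?\<phi>) (at 0)"
      by (rule curve_derivative[OF g_Cinf[OF FV FV] c pc])
    moreover have "pd c j p ?\<phi> = (transpose C ** G 0 + G 0 ** C) $ i $ k"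
    proof -
      have "pd c j p ?\<phi> = F j p ?\<phi>" using local_frame_F[OF lf] by simp
      also have "\<dots> = g p (D (F j) (?Fr (axis_vec i)) p) (frame c b (axis_vec k) p)
          + g p (frame c b (axis_vec i) p) (D (F j) (?Fr (axis_vec k)) p)"
        using D_metric[OF Fj FV FV, of p] frame_Fr[OF lf] by simp
      also have "g p (frame c b (axis_vec i) p) (D (F j) (?Fr (axis_vec k)) p)
          = g p (D (F j) (?Fr (axis_vec k)) p) (frame c b (axis_vec i) p)"
        by (rule g_sym[OF fT VF_at[OF D_VF[OF Fj FV]]])
      also have "\<dots> = transpose (transpose C ** gram c b p) $ i $ k" by (simp add: exp transpose_def)
      also have "transpose (transpose C ** gram c b p) = gram c b p ** C"
        by (simp add: matrix_transpose_mul gs)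
      finally show ?thesis by (simp add: exp G0)
    qed
    moreover have "\<exists>W. open W \<and> 0 \<in> W \<and> (\<forall>t\<in>W. ?\<phi> (inv_chart c (map_chart c p + t *\<^sub>R j)) = G t $ i $ k)"
    proof -
      let ?W = "(\<lambda>t. map_chart c p + t *\<^sub>R j) -` (map_chart c ` (dom_chart c \<inter> V))"
      have "open ?W" by (intro open_vimage open_chart_image c local_frame_chart(2)[OF lf(1)] continuous_intros)
      moreover have "inv_chart c (map_chart c p + t *\<^sub>R j) \<in> V" if "t \<in> ?W" for t
        using that c by auto
      ultimately show ?thesis using lf pc frame_Fr[OF lf(1)] 
        by (intro exI[of _ ?W]) (auto simp: G_def gram_def)
    qed
    ultimately show ?thesis
      by (metis (no_types, lifting) has_field_derivative_transform_within_open)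
  qed
  then have "((\<lambda>t. sqrt \<bar>det (G t)\<bar>) has_real_derivative trace C * sqrt \<bar>det (G 0)\<bar>) (at 0)"
    by (rule sqrt_abs_det_derivative) (simp add: G0 gram_nondegenerate[OF p s pc])
  moreover have "trace C = (\<Sum>i\<in>Basis - {b}. proj p (D (F j) (F i) p) (x i)) + sqrt 2 * g p (D (F j) E p) (\<Xi> p)"
  proof -
    have "trace C = (\<Sum>i\<in>UNIV. ?\<theta> (axis_vec i) (D (F j) (?Fr (axis_vec i)) p))" by (simp add: trace_def C_def)
    also have "\<dots> = (\<Sum>i\<in>Basis. ?\<theta> i (D (F j) (?Fr i) p))"
      by (rule sum_axis_vec[of "\<lambda>i. ?\<theta> i (D (F j) (?Fr i) p)"])
    also have "\<dots> = ?\<theta> b (D (F j) (?Fr b) p) + (\<Sum>i\<in>Basis - {b}. ?\<theta> i (D (F j) (?Fr i) p))"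
      by (rule sum.remove[OF finite_Basis sliceD(2)[OF s]])
    also have "(\<Sum>i\<in>Basis - {b}. ?\<theta> i (D (F j) (?Fr i) p)) = (\<Sum>i\<in>Basis - {b}. proj p (D (F j) (F i) p) (x i))"
      by (intro sum.cong refl) (auto simp: Fr_def)
    finally show ?thesis by (simp add: Fr_def)
  qed
  ultimately show ?thesis unfolding G0 by (simp add: G_def dens_def)
qed

lemma transition_derivative:
  assumes c: "c \<in> max_atlas A" and d: "d \<in> max_atlas A" and q: "q \<in> dom_chart c" "q \<in> dom_chart d"
  obtains \<psi>' where "((map_chart d \<circ> inv_chart c) has_derivative \<psi>') (at (map_chart c q))"
    "\<And>w. pd c w q = pd d (\<psi>' w) q"
proof -
  let ?y = "map_chart c q" and ?\<psi> = "map_chart d \<circ> inv_chart c"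
  let ?U = "map_chart c ` (dom_chart c \<inter> dom_chart d)"
  have sm: "smooth_on ?U ?\<psi>"
    by (rule smooth_in_chartD[OF smooth_in_map_chart[OF d] open_dom_chart[OF d] c])
  have oU: "open ?U" by (rule open_chart_image[OF c open_dom_chart[OF d]])
  have yU: "?y \<in> ?U" using q by auto
  have der: "(?\<psi> has_derivative frechet_derivative ?\<psi> (at ?y)) (at ?y)" (is "(_ has_derivative ?D) _")
    by (rule smooth_on_has_derivative[OF sm yU])
  have "pd c w q f = pd d (?D w) q f" for w f
  proof (cases "f \<in> Cinf A")
    case True
    have "((f \<circ> inv_chart d) has_derivative (\<lambda>w. pd d w q f)) (at (?\<psi> ?y))"
      using pd_has_derivative[OF True d q(2)] c q by simp
    then have "(((f \<circ> inv_chart d) \<circ> ?\<psi>) has_derivative ((\<lambda>w. pd d w q f) \<circ> ?D)) (at ?y)"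
      by (rule diff_chain_at[OF der])
    then have "((f \<circ> inv_chart c) has_derivative ((\<lambda>w. pd d w q f) \<circ> ?D)) (at ?y)"
      by (rule has_derivative_transform_within_open[OF _ oU yU]) (use c d in auto)
    then show ?thesis using pd_eqI[OF True c q(1)] by fastforce
  qed (simp add: pd_def)
  then show ?thesis using that[OF der] by (simp add: fun_eq_iff)
qed

text \<open>The matrix on the right is the derivative of the transition map of the thickened hypersurfaces. It also expresses the
frame of one chart by that of the other, because \<open>E\<close> is the transversal vector of both.\<close>

lemma dens_transition:
  assumes s: "slice S c b" and s': "slice S d b'" and q: "q \<in> S" "q \<in> dom_chart c" "q \<in> dom_chart d"
    and \<psi>: "((map_chart d \<circ> inv_chart c) has_derivative \<psi>') (at (map_chart c q))" "\<And>w. pd c w q = pd d (\<psi>' w) q"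
  shows "dens c b q = \<bar>det (matrix (\<lambda>x. coord (\<psi>' (sl_proj b (emb x)) + (emb x \<bullet> b) *\<^sub>R b')))\<bar> * dens d b' q"
proof -
  note c = sliceD(1)[OF s] and d = sliceD(1)[OF s'] and b = sliceD(2)[OF s] and b' = sliceD(2)[OF s']
  define P where "P w = \<psi>' (sl_proj b w) + (w \<bullet> b) *\<^sub>R b'" for w
  define M where "M = matrix (\<lambda>x. coord (P (emb x)))"
  have Mki: "M $ k $ i = P (axis_vec i) \<bullet> axis_vec k" for k i
    by (simp add: M_def matrix_def coord_def)
  have lin0: "\<psi>' 0 = 0" using has_derivative_linear[OF \<psi>(1)] by (rule linear_0)
  have fr: "frame c b i q = (\<Sum>k\<in>Basis. (P i \<bullet> k) \<cdot>\<^sub>v frame d b' k q)" if i: "i \<in> Basis" for i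
  proof (cases "i = b")
    case True
    have "P i = b'" using True b lin0 by (simp add: P_def sl_proj_def)
    then have "(\<Sum>k\<in>Basis. (P i \<bullet> k) \<cdot>\<^sub>v frame d b' k q) = (\<Sum>k\<in>Basis. if k = b' then frame d b' b' q else 0)"
      using b' by (intro sum.cong refl) (auto simp: inner_Basis)
    also have "\<dots> = frame d b' b' q" by (simp only: sum.delta[OF finite_Basis] b' if_True)
    finally show ?thesis using True by (simp add: frame_def)
  next
    case False
    then have ib: "i \<bullet> b = 0" using i b by (auto simp: inner_Basis)
    then have Pi: "P i = \<psi>' i" by (simp add: P_def sl_proj_id)
    obtain V x F where lf: "local_frame d V x F" "q \<in> V" using local_frame_exists[OF d q(3), of UNIV] by auto
    have "pd d (\<psi>' i) q \<in> TS q" using pd_tangent_sub[OF s q(2,1) ib] \<psi>(2) by simp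
    then have z: "P i \<bullet> b' = 0"
      using tangent_sub_iff[OF s' lf q(1) pd_tangent[OF d q(3)]] local_frame_pd_x[OF lf] Pi by simp
    have "frame c b i q = pd d (P i) q" using False \<psi>(2) Pi by (simp add: frame_def)
    also have "\<dots> = pd d (\<Sum>k\<in>Basis. (P i \<bullet> k) *\<^sub>R k) q" by (simp add: euclidean_representation)
    also have "\<dots> = (\<Sum>k\<in>Basis. (P i \<bullet> k) \<cdot>\<^sub>v pd d k q)" by (rule pd_sum[OF d q(3)])
    also have "\<dots> = (\<Sum>k\<in>Basis. (P i \<bullet> k) \<cdot>\<^sub>v frame d b' k q)"
      using z by (intro sum.cong refl) (auto simp: frame_def)
    finally show ?thesis .
  qed
  have fT: "frame d b' k q \<in> T q" "frame c b k q \<in> T q" for k by (auto intro: frame_T[OF d q(3)] frame_T[OF c q(2)])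
  have e1: "g q (frame c b (axis_vec i) q) w = (\<Sum>k\<in>UNIV. M $ k $ i * g q (frame d b' (axis_vec k) q) w)"
    if w: "w \<in> T q" for i w
  proof -
    have "g q (frame c b (axis_vec i) q) w = (\<Sum>k\<in>Basis. (P (axis_vec i) \<bullet> k) * g q (frame d b' k q) w)"
      unfolding fr[OF axis_vec_Basis] by (rule linear_form_sum[OF linear_form_g[OF w] fT(1)])
    also have "\<dots> = (\<Sum>k\<in>UNIV. (P (axis_vec i) \<bullet> axis_vec k) * g q (frame d b' (axis_vec k) q) w)"
      by (rule sum_axis_vec[symmetric])
    finally show ?thesis by (simp add: Mki)
  qed
  have "gram c b q $ i $ j = (transpose M ** (gram d b' q ** M)) $ i $ j" for i j
  proof -
    have "gram c b q $ i $ j = (\<Sum>k\<in>UNIV. M $ k $ i * g q (frame d b' (axis_vec k) q) (frame c b (axis_vec j) q))"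
      using e1[OF fT(2)] by (simp add: gram_def)
    also have "\<dots> = (\<Sum>k\<in>UNIV. M $ k $ i * (\<Sum>l\<in>UNIV. g q (frame d b' (axis_vec k) q) (frame d b' (axis_vec l) q) * M $ l $ j))"
    proof (intro sum.cong refl arg_cong2[where f="(*)"])
      fix k
      have "g q (frame d b' (axis_vec k) q) (frame c b (axis_vec j) q) = g q (frame c b (axis_vec j) q) (frame d b' (axis_vec k) q)"
        by (rule g_sym[OF fT(1,2)])
      also have "\<dots> = (\<Sum>l\<in>UNIV. M $ l $ j * g q (frame d b' (axis_vec l) q) (frame d b' (axis_vec k) q))"
        by (rule e1[OF fT(1)])
      finally show "g q (frame d b' (axis_vec k) q) (frame c b (axis_vec j) q) =
          (\<Sum>l\<in>UNIV. g q (frame d b' (axis_vec k) q) (frame d b' (axis_vec l) q) * M $ l $ j)"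
        using g_sym[OF fT(1) fT(1)] by (simp add: mult.commute)
    qed
    finally show ?thesis by (simp add: matrix_matrix_mult_def transpose_def gram_def)
  qed
  then have "gram c b q = transpose M ** (gram d b' q ** M)" by (simp add: vec_eq_iff)
  then have "det (gram c b q) = (det M)\<^sup>2 * det (gram d b' q)"
    by (simp add: det_mul power2_eq_square)
  then have "dens c b q = \<bar>det M\<bar> * dens d b' q"
    by (simp add: dens_def abs_mult real_sqrt_mult)
  then show ?thesis by (simp add: M_def P_def)
qed

end

context null_hypersurface begin

subsection \<open>The integral of functions supported in a slice chart\<close>

definition integrand :: "('m, 'e) chart \<Rightarrow> 'e \<Rightarrow> ('m \<Rightarrow> real) \<Rightarrow> real ^ 'e axis_index \<Rightarrow> real" where
  "integrand c b F x = (if x \<in> pdom c b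
     then tent (emb x \<bullet> b) * (F (param c b x) * dens c b (param c b x)) else 0)"

definition "chart_integral c b F = integral UNIV (integrand c b F)"

text \<open>The part of the slab over \<open>K\<close> where the weight can be nonzero.\<close>

definition "support_box c b K = (\<lambda>(y, t). coord (y + t *\<^sub>R b)) ` (map_chart c ` (K \<inter> S) \<times> {-1..1})"

context
  fixes c b K assumes s: "slice S c b" and K: "compact K" "K \<subseteq> dom_chart c"
begin

lemma compact_support_box: "compact (support_box c b K)"
proof -
  have "compact (K \<inter> S)" using K(1) compact_S compact_imp_closed by blast
  then have "compact (map_chart c ` (K \<inter> S))"
    using K(2) by (intro compact_continuous_image continuous_on_subset[OF continuous_map_chart[OF sliceD(1)[OF s]]]) auto
  then have "compact (map_chart c ` (K \<inter> S) \<times> {-1..1::real})" by (intro compact_Times) auto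
  then show ?thesis unfolding support_box_def
    by (intro compact_continuous_image) (auto intro!: continuous_intros simp: split_beta)
qed

lemma support_box_pdom: "support_box c b K \<subseteq> pdom c b"
  unfolding support_box_def using param_coord(1)[OF s] K(2) by auto

lemma integrand_outside:
  assumes F: "\<And>q. q \<in> S \<Longrightarrow> q \<notin> K \<Longrightarrow> F q = 0" and x: "x \<notin> support_box c b K"
  shows "integrand c b F x = 0"
proof (rule ccontr)
  assume nz: "integrand c b F x \<noteq> 0"
  then have xd: "x \<in> pdom c b" and t: "tent (emb x \<bullet> b) \<noteq> 0" and Fx: "F (param c b x) \<noteq> 0"
    by (auto simp: integrand_def split: if_splits)
  have "param c b x \<in> K \<inter> S" using F[OF param_S[OF s xd]] Fx param_S[OF s xd] by auto
  then have "coord (map_chart c (param c b x) + (emb x \<bullet> b) *\<^sub>R b) \<in> support_box c b K"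
    unfolding support_box_def using tent_outside[OF t]
    by (intro image_eqI[of _ _ "(map_chart c (param c b x), emb x \<bullet> b)"]) auto
  then show False using x coord_param[OF s xd] by simp
qed

lemma continuous_on_integrand:
  assumes cont: "continuous_on S F" and F: "\<And>q. q \<in> S \<Longrightarrow> q \<notin> K \<Longrightarrow> F q = 0"
  shows "continuous_on UNIV (integrand c b F)"
proof -
  have par: "continuous_on (pdom c b) (param c b)" by (rule continuous_on_param[OF s])
  have 1: "continuous_on (pdom c b) (\<lambda>x. tent (emb x \<bullet> b) * (F (param c b x) * dens c b (param c b x)))"
    by (intro continuous_intros continuous_on_id continuous_on_compose2[OF cont par]
        continuous_on_compose2[OF continuous_on_dens[OF sliceD(1)[OF s]] par])
      (auto intro: param_S[OF s] param_dom[OF s])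
  have 2: "continuous_on (pdom c b) (integrand c b F)"
    by (rule continuous_on_eq[OF 1]) (simp add: integrand_def)
  have 3: "continuous_on (- support_box c b K) (integrand c b F)"
    by (rule continuous_on_eq[OF continuous_on_const[of _ 0]]) (use integrand_outside[OF F] in auto)
  have "pdom c b \<union> - support_box c b K = UNIV" using support_box_pdom by auto
  then show ?thesis
    using continuous_on_open_Un[OF open_pdom[OF s] _ 2 3] compact_imp_closed[OF compact_support_box] by auto
qed

lemma integrand_integrable:
  assumes "continuous_on S F" "\<And>q. q \<in> S \<Longrightarrow> q \<notin> K \<Longrightarrow> F q = 0"
  shows "integrand c b F absolutely_integrable_on UNIV" "integrand c b F integrable_on UNIV"
  using continuous_compact_support_absolutely_integrable[OF continuous_on_integrand[OF assms]
      compact_imp_bounded[OF compact_support_box] integrand_outside[OF assms(2)]] by auto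

lemma chart_integral_nonneg_0:
  assumes "continuous_on S F" "\<And>q. q \<in> S \<Longrightarrow> q \<notin> K \<Longrightarrow> F q = 0"
    and nn: "\<And>q. q \<in> S \<Longrightarrow> 0 \<le> F q" and 0: "chart_integral c b F = 0" and q: "q \<in> S"
  shows "F q = 0"
proof (cases "q \<in> dom_chart c")
  case True
  let ?x = "coord (map_chart c q + 0 *\<^sub>R b)"
  have "integrand c b F ?x = 0"
  proof (rule continuous_nonneg_integral_0[OF continuous_on_integrand[OF assms(1,2)]
      compact_imp_bounded[OF compact_support_box] integrand_outside[OF assms(2)]])
    show "0 \<le> integrand c b F x" for x
      using nn[OF param_S[OF s]] dens_pos[OF param_S[OF s] s param_dom[OF s]]
      by (auto simp: integrand_def tent_nonneg less_imp_le intro!: mult_nonneg_nonneg)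
    show "integral UNIV (integrand c b F) = 0" using 0 by (simp add: chart_integral_def)
  qed
  then show ?thesis
    using param_coord[OF s q True, of 0] dens_pos[OF q s True] by (simp add: integrand_def tent_0)
qed (use assms K q in auto)

end

lemma chart_integral_cong:
  assumes "slice S c b" "\<And>q. q \<in> S \<Longrightarrow> F q = F' q"
  shows "chart_integral c b F = chart_integral c b F'"
proof -
  have "integrand c b F = integrand c b F'"
    using assms(2)[OF param_S[OF assms(1)]] by (auto simp: integrand_def fun_eq_iff)
  then show ?thesis by (simp add: chart_integral_def)
qed

lemma chart_integral_sum:
  assumes s: "slice S c b" and K: "compact K" "K \<subseteq> dom_chart c" and "finite I"
    and "\<And>i. i \<in> I \<Longrightarrow> continuous_on S (F i)" "\<And>i q. i \<in> I \<Longrightarrow> q \<in> S \<Longrightarrow> q \<notin> K \<Longrightarrow> F i q = 0"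
  shows "chart_integral c b (\<lambda>q. \<Sum>i\<in>I. F i q) = (\<Sum>i\<in>I. chart_integral c b (F i))"
proof -
  have "integrand c b (\<lambda>q. \<Sum>i\<in>I. F i q) = (\<lambda>x. \<Sum>i\<in>I. integrand c b (F i) x)"
    by (auto simp: integrand_def fun_eq_iff sum_distrib_left sum_distrib_right)
  moreover have "integrand c b (F i) integrable_on UNIV" if "i \<in> I" for i
    using that assms(5,6) by (intro integrand_integrable[OF s K]) auto
  ultimately show ?thesis unfolding chart_integral_def using assms(4) by (simp add: integral_sum)
qed

lemma chart_integral_diff:
  assumes s: "slice S c b" and K: "compact K" "K \<subseteq> dom_chart c"
    and F: "continuous_on S F" "\<And>q. q \<in> S \<Longrightarrow> q \<notin> K \<Longrightarrow> F q = 0"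
    and F': "continuous_on S F'" "\<And>q. q \<in> S \<Longrightarrow> q \<notin> K \<Longrightarrow> F' q = 0"
  shows "chart_integral c b (\<lambda>q. F q - F' q) = chart_integral c b F - chart_integral c b F'"
proof -
  have "integrand c b (\<lambda>q. F q - F' q) = (\<lambda>x. integrand c b F x - integrand c b F' x)"
    by (auto simp: integrand_def fun_eq_iff algebra_simps)
  then show ?thesis unfolding chart_integral_def
    using integrand_integrable(2)[OF s K F] integrand_integrable(2)[OF s K F']
    by (simp add: Henstock_Kurzweil_Integration.integral_diff)
qed

text \<open>The thickened transition map \<open>\<Phi>\<close> applies the transition map to the point of \<open>S\<close> and keeps the transversal coordinate.
Its Jacobian determinant is the quotient of the two densities.\<close>

lemma chart_integral_change:
  assumes s: "slice S c b" and s': "slice S d b'"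
    and K: "compact K" "K \<subseteq> dom_chart c" "K \<subseteq> dom_chart d"
    and F: "continuous_on S F" "\<And>q. q \<in> S \<Longrightarrow> q \<notin> K \<Longrightarrow> F q = 0"
  shows "chart_integral c b F = chart_integral d b' F"
proof -
  define U where "U c b d = {x \<in> pdom c b. param c b x \<in> dom_chart d}" for c d :: "('m, 'e) chart" and b
  define \<Phi> where "\<Phi> c b d b' x = coord (map_chart d (param c b x) + (emb x \<bullet> b) *\<^sub>R b')"
    for c d :: "('m, 'e) chart" and b b' x
  have \<Phi>: "\<Phi> c b d b' x \<in> U d b' c \<and> param d b' (\<Phi> c b d b' x) = param c b x \<and> emb (\<Phi> c b d b' x) \<bullet> b' = emb x \<bullet> b
      \<and> \<Phi> d b' c b (\<Phi> c b d b' x) = x"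
    if s: "slice S c b" and s': "slice S d b'" and x: "x \<in> U c b d" for c d b b' x
  proof -
    have xd: "x \<in> pdom c b" "param c b x \<in> dom_chart d" using x by (auto simp: U_def)
    note pc = param_coord[OF s' param_S[OF s xd(1)] xd(2), of "emb x \<bullet> b"]
    have "\<Phi> d b' c b (\<Phi> c b d b' x) = x"
      using coord_param[OF s xd(1)] pc(3) unfolding \<Phi>_def pc(2) by simp
    then show ?thesis using pc param_dom[OF s xd(1)] by (simp add: U_def \<Phi>_def)
  qed
  have restr: "chart_integral c b F = integral (U c b d) (integrand c b F) \<and> integrand c b F absolutely_integrable_on U c b d
     \<and> open (U c b d)"
    if s: "slice S c b" and K: "K \<subseteq> dom_chart c" "K \<subseteq> dom_chart d" and d: "d \<in> max_atlas A" for c d b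
  proof -
    have "U c b d = pdom c b \<inter> param c b -` dom_chart d" by (auto simp: U_def)
    then have o: "open (U c b d)"
      using continuous_open_preimage[OF continuous_on_param[OF s] open_pdom[OF s] open_dom_chart[OF d]] by simp
    have "support_box c b K \<subseteq> U c b d"
      using param_coord(1,2)[OF s] subsetD[OF K(1)] subsetD[OF K(2)] by (auto simp: support_box_def U_def)
    then have 0: "integrand c b F x = 0" if "x \<notin> U c b d" for x
      using integrand_outside[OF s assms(3) K(1), of F x] F(2) that by auto
    have "integrand c b F absolutely_integrable_on U c b d"
      using integrand_integrable(1)[OF s assms(3) K(1) F]
      by (rule set_integrable_subset) (use o in auto)
    moreover have "integral UNIV (integrand c b F) = integral (U c b d) (integrand c b F)"
    proof -
      have "integrand c b F = (\<lambda>x. if x \<in> U c b d then integrand c b F x else 0)" using 0 by auto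
      then show ?thesis using integral_restrict_UNIV[of "U c b d" "integrand c b F"] by metis
    qed
    ultimately show ?thesis using o by (simp add: chart_integral_def)
  qed
  note c = sliceD(1)[OF s] and d = sliceD(1)[OF s']
  let ?U = "U c b d" and ?\<Phi> = "\<Phi> c b d b'"
  have img: "?\<Phi> ` ?U = U d b' c"
  proof
    show "?\<Phi> ` ?U \<subseteq> U d b' c" using \<Phi>[OF s s'] by auto
    show "U d b' c \<subseteq> ?\<Phi> ` ?U"
    proof
      fix z assume z: "z \<in> U d b' c"
      then have "z = ?\<Phi> (\<Phi> d b' c b z)" "\<Phi> d b' c b z \<in> ?U" using \<Phi>[OF s' s z] by auto
      then show "z \<in> ?\<Phi> ` ?U" by blast
    qed
  qed
  have inj: "inj_on ?\<Phi> ?U" by (rule inj_on_inverseI[of _ "\<Phi> d b' c b"]) (use \<Phi>[OF s s'] in auto)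
  define \<psi>' where "\<psi>' q = (SOME \<psi>'. ((map_chart d \<circ> inv_chart c) has_derivative \<psi>') (at (map_chart c q)) \<and>
    (\<forall>w. pd c w q = pd d (\<psi>' w) q))" for q
  have \<psi>: "((map_chart d \<circ> inv_chart c) has_derivative \<psi>' q) (at (map_chart c q)) \<and> (\<forall>w. pd c w q = pd d (\<psi>' q w) q)"
    if q: "q \<in> dom_chart c" "q \<in> dom_chart d" for q
  proof -
    have "\<exists>\<psi>'. ((map_chart d \<circ> inv_chart c) has_derivative \<psi>') (at (map_chart c q)) \<and> (\<forall>w. pd c w q = pd d (\<psi>' w) q)"
      by (rule transition_derivative[OF c d q]) blast
    then show ?thesis unfolding \<psi>'_def by (rule someI_ex)
  qed
  define \<Phi>' where "\<Phi>' x = (\<lambda>z. coord (\<psi>' (param c b x) (sl_proj b (emb z)) + (emb z \<bullet> b) *\<^sub>R b'))" for x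
  have der: "(?\<Phi> has_derivative \<Phi>' x) (at x within ?U)" if x: "x \<in> ?U" for x
  proof -
    have xd: "x \<in> pdom c b" "param c b x \<in> dom_chart d" using x by (auto simp: U_def)
    have 1: "((\<lambda>z. sl_proj b (emb z)) has_derivative (\<lambda>z. sl_proj b (emb z))) (at x)"
      by (intro bounded_linear_imp_has_derivative bounded_linear_compose[OF bounded_linear_sl_proj bounded_linear_emb])
    have "((\<lambda>z. (map_chart d \<circ> inv_chart c) (sl_proj b (emb z))) has_derivative
        (\<lambda>z. \<psi>' (param c b x) (sl_proj b (emb z)))) (at x)"
      using diff_chain_at[OF 1, of "map_chart d \<circ> inv_chart c" "\<psi>' (param c b x)"] \<psi>[OF param_dom[OF s xd(1)] xd(2)]
        map_param[OF s xd(1)] by (simp add: o_def)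
    moreover have "((\<lambda>z. (emb z \<bullet> b) *\<^sub>R b') has_derivative (\<lambda>z. (emb z \<bullet> b) *\<^sub>R b')) (at x)"
      by (intro bounded_linear_imp_has_derivative bounded_linear_scaleR_const
          bounded_linear_compose[OF bounded_linear_inner_left bounded_linear_emb])
    ultimately have "((\<lambda>z. map_chart d (param c b z) + (emb z \<bullet> b) *\<^sub>R b') has_derivative
        (\<lambda>z. \<psi>' (param c b x) (sl_proj b (emb z)) + (emb z \<bullet> b) *\<^sub>R b')) (at x)"
      by (simp add: param_def has_derivative_add)
    then have "((\<lambda>z. coord (map_chart d (param c b z) + (emb z \<bullet> b) *\<^sub>R b')) has_derivative
        (\<lambda>z. coord (\<psi>' (param c b x) (sl_proj b (emb z)) + (emb z \<bullet> b) *\<^sub>R b'))) (at x)"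
      by (rule bounded_linear.has_derivative[OF bounded_linear_coord])
    then show ?thesis unfolding \<Phi>_def \<Phi>'_def by (rule has_derivative_at_withinI)
  qed
  have "chart_integral d b' F = integral (?\<Phi> ` ?U) (integrand d b' F)"
    unfolding img using restr[OF s' K(3,2) c] by simp
  also have "\<dots> = integral ?U (\<lambda>x. \<bar>det (matrix (\<Phi>' x))\<bar> * integrand d b' F (?\<Phi> x))"
  proof (rule integral_change_of_variables_scalar[OF _ der inj])
    show "?U \<in> sets lebesgue" using restr[OF s K(2,3) d] by (simp add: borel_open)
    show "integrand d b' F absolutely_integrable_on ?\<Phi> ` ?U" unfolding img using restr[OF s' K(3,2) c] by blast
  qed
  also have "\<dots> = integral ?U (integrand c b F)"
  proof (rule integral_cong)
    fix x assume x: "x \<in> ?U"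
    then have xd: "x \<in> pdom c b" "param c b x \<in> dom_chart d" by (auto simp: U_def)
    note \<psi>x = \<psi>[OF param_dom[OF s xd(1)] xd(2)]
    have "\<bar>det (matrix (\<Phi>' x))\<bar> * dens d b' (param c b x) = dens c b (param c b x)"
      unfolding \<Phi>'_def
      by (rule dens_transition[OF s s' param_S[OF s xd(1)] param_dom[OF s xd(1)] xd(2), symmetric])
        (use \<psi>x in blast)+
    moreover have "?\<Phi> x \<in> pdom d b'" using \<Phi>[OF s s' x] by (simp add: U_def)
    ultimately show "\<bar>det (matrix (\<Phi>' x))\<bar> * integrand d b' F (?\<Phi> x) = integrand c b F x"
      using \<Phi>[OF s s' x] xd by (simp add: integrand_def mult_ac)
  qed
  also have "\<dots> = chart_integral c b F" using restr[OF s K(2,3) d] by simp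
  finally show ?thesis ..
qed

subsection \<open>Divergences integrate to zero\<close>

text \<open>The divergence at a point of \<open>S\<close> only involves derivatives in directions tangent to \<open>S\<close>.\<close>

lemma divS_cong:
  assumes p: "p \<in> S" and X: "X \<in> VF" "Y \<in> VF" and eq: "\<And>q. q \<in> S \<Longrightarrow> X q = Y q"
  shows "divS X p = divS Y p"
proof -
  obtain c b V x F where sl: "slice S c b" "local_frame c V x F" "p \<in> V" using slice_at[OF p] by metis
  note F = local_frame_VF[OF sl(2)]
  have "D (F i) X p = D (F i) Y p" if "i \<in> Basis - {b}" for i
  proof -
    have "i \<bullet> b = 0" using that sliceD(2)[OF sl(1)] by (auto simp: inner_Basis)
    then have "F i p \<in> TS p"
      using pd_tangent_sub[OF sl(1) local_frame_chart(4)[OF sl(2,3)] p] local_frame_F[OF sl(2,3)] by simp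
    then show ?thesis by (rule D_cong_along[OF F _ p X open_UNIV UNIV_I]) (rule eq)
  qed
  moreover have "D X E p = D Y E p" using X eq[OF p] by (intro D_cong_left) auto
  ultimately show ?thesis
    by (simp add: divS_slice[OF p sl X(1)] divS_slice[OF p sl X(2)])
qed

lemma divS_add:
  assumes p: "p \<in> S" and X: "X \<in> VF" "Y \<in> VF"
  shows "divS (X + Y) p = divS X p + divS Y p"
proof -
  obtain c b V x F where sl: "slice S c b" "local_frame c V x F" "p \<in> V" using slice_at[OF p] by metis
  note F = local_frame_VF[OF sl(2)]
  have 1: "proj p (D (F i) (X + Y) p) (x i) = proj p (D (F i) X p) (x i) + proj p (D (F i) Y p) (x i)" for i
    using endo_add[OF proj_endo VF_at[OF D_VF[OF F X(1)]] VF_at[OF D_VF[OF F X(2)]]] F X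
    by (simp add: D_add_right)
  have 2: "g p (D (X + Y) E p) (\<Xi> p) = g p (D X E p) (\<Xi> p) + g p (D Y E p) (\<Xi> p)"
    using X \<Xi>T by (simp add: D_add_left g_add_left VF_at)
  show ?thesis unfolding divS_slice[OF p sl X(1)] divS_slice[OF p sl X(2)] divS_slice[OF p sl VF_add[OF X]] 1 2
    by (simp add: sum.distrib algebra_simps)
qed

lemma divS_0: "p \<in> S \<Longrightarrow> divS 0 p = 0"
  using divS_add[of p 0 0] by simp

lemma divS_sum: "p \<in> S \<Longrightarrow> (\<And>i. i \<in> I \<Longrightarrow> Z i \<in> VF) \<Longrightarrow> divS (\<Sum>i\<in>I. Z i) p = (\<Sum>i\<in>I. divS (Z i) p)"
  by (induction I rule: infinite_finite_induct) (simp_all add: divS_0 divS_add VF_sum)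

lemma divS_fscale:
  assumes p: "p \<in> S" and X: "X \<in> VF" "X p \<in> TS p" and f: "f \<in> Cinf A"
  shows "divS (f \<cdot>\<^sub>f X) p = f p * divS X p + X p f"
proof -
  obtain c b V x F where sl: "slice S c b" "local_frame c V x F" "p \<in> V" using slice_at[OF p] by metis
  note F = local_frame_VF[OF sl(2)]
  have DT: "D (F i) X p \<in> T p" for i by (rule VF_at[OF D_VF[OF F X(1)]])
  have 1: "proj p (D (F i) (f \<cdot>\<^sub>f X) p) (x i) = X p (x i) * pd c i p f + f p * proj p (D (F i) X p) (x i)" for i
  proof -
    have "D (F i) (f \<cdot>\<^sub>f X) p = F i p f \<cdot>\<^sub>v X p + f p \<cdot>\<^sub>v D (F i) X p"
      using F X f by (simp add: D_leibniz act_def)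
    then have "proj p (D (F i) (f \<cdot>\<^sub>f X) p) = F i p f \<cdot>\<^sub>v proj p (X p) + f p \<cdot>\<^sub>v proj p (D (F i) X p)"
      using endo_add[OF proj_endo] endo_scale[OF proj_endo] DT TS_T[OF X(2)] by simp
    then show ?thesis by (simp add: proj_id[OF p X(2)] local_frame_F[OF sl(2,3)])
  qed
  have "X p f = (\<Sum>i\<in>Basis - {b}. X p (x i) \<cdot>\<^sub>v pd c i p) f"
    by (rule arg_cong[OF tangent_sub_expansion[OF sl p X(2)], of "\<lambda>v. v f"])
  then have 2: "X p f = (\<Sum>i\<in>Basis - {b}. X p (x i) * pd c i p f)" by (simp add: sum_fun_apply)
  have 3: "g p (D (f \<cdot>\<^sub>f X) E p) (\<Xi> p) = f p * g p (D X E p) (\<Xi> p)"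
    using X f \<Xi>T by (simp add: D_fscale_left g_scale_left VF_at)
  show ?thesis
    unfolding divS_slice[OF p sl X(1)] divS_slice[OF p sl VF_fscale[OF f X(1)]] 1 2 3
    by (simp add: sum.distrib sum_distrib_left algebra_simps)
qed

text \<open>Near every point of \<open>S\<close> the coordinate expression of the divergence is the restriction of a smooth function.\<close>

lemma continuous_on_divS: assumes X: "X \<in> VF" shows "continuous_on S (divS X)"
proof -
  have "continuous (at p within S) (divS X)" if p: "p \<in> S" for p
  proof -
    obtain c b V x F where sl: "slice S c b" "local_frame c V x F" "p \<in> V" using slice_at[OF p] by metis
    note F = local_frame_VF[OF sl(2)] and o = local_frame_chart(2)[OF sl(2)]
    define h where "h q = (\<Sum>i\<in>Basis - {b}. D (F i) X q (x i) - sqrt 2 * g q (D (F i) X q) (\<Xi> q) * E q (x i))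
       + sqrt 2 * g q (D X E q) (\<Xi> q)" for q
    have "h \<in> Cinf A"
    proof -
      have "(\<lambda>q. D (F i) X q (x i) - sqrt 2 * g q (D (F i) X q) (\<Xi> q) * E q (x i)) \<in> Cinf A" for i
        by (rule Cinf_diff'[OF VF_act'[OF D_VF[OF F X] local_frame_Cinf[OF sl(2)]]
              Cinf_mult'[OF Cinf_scale[OF g_Cinf[OF D_VF[OF F X] \<Xi>_VF]] VF_act'[OF E_VF local_frame_Cinf[OF sl(2)]]]])
      then show ?thesis unfolding h_def[abs_def]
        by (rule Cinf_add'[OF Cinf_sum' Cinf_scale[OF g_Cinf[OF D_VF[OF X E_VF] \<Xi>_VF]]])
    qed
    moreover have "divS X q = h q" if "q \<in> S \<inter> V" for q
      using divS_slice[OF _ sl(1,2) _ X, of q] that by (simp add: h_def proj_def)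
    ultimately have "continuous_on (S \<inter> V) (divS X)"
      using Cinf_continuous_on[of h "S \<inter> V"] by (subst continuous_on_cong[OF refl, of _ _ h]) auto
    then have "continuous (at p within S \<inter> V) (divS X)"
      using p sl(3) by (simp add: continuous_on_eq_continuous_within)
    moreover have "at p within S \<inter> V = at p within S"
      by (rule at_within_nhd[OF sl(3) o]) auto
    ultimately show ?thesis by (simp add: continuous_within)
  qed
  then show ?thesis by (simp add: continuous_on_eq_continuous_within)
qed

lemma divS_outside:
  assumes K: "closed K" and Z: "Z \<in> VF" "\<And>q. q \<notin> K \<Longrightarrow> Z q = 0" and q: "q \<in> S" "q \<notin> K"
  shows "divS Z q = 0"
proof -
  obtain c b V x F where sl: "slice S c b" "local_frame c V x F" "q \<in> V" using slice_at[OF q(1)] by metis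
  have o: "open (- K)" using K by (rule open_Compl)
  have qK: "q \<in> - K" using q(2) by simp
  have Z0: "Z r = 0 r" if "r \<in> - K" for r using Z(2) that by simp
  have DX: "D X Z q = 0" if X: "X \<in> VF" for X
  proof -
    have "D X Z q = D X 0 q"
      by (rule D_cong_along[OF X tangent_sub_UNIV[OF VF_at[OF X]] UNIV_I Z(1) VF_0 o qK]) (rule Z0)
    then show ?thesis by (simp only: D_0_right[OF X] zero_fun_apply)
  qed
  have "D Z E q = D 0 E q" by (rule D_cong_left[OF Z(1) VF_0 E_VF Z0[OF qK]])
  then have DZ: "D Z E q = 0" by (simp only: D_0_left[OF E_VF] zero_fun_apply)
  show ?thesis
    unfolding divS_slice[OF q(1) sl Z(1)] DX[OF local_frame_VF[OF sl(2)]] DZ endo_0[OF proj_endo] g_0_left[OF \<Xi>T]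
    by simp
qed

text \<open>For \<open>Z = f \<partial>\<^sub>j\<close> the divergence times the density is the derivative of \<open>f\<close> times the density in the direction \<open>j\<close>,
which is parallel to the hyperplane, so that the weight is not differentiated.\<close>

lemma chart_integral_coordinate:
  assumes s: "slice S c b" and K: "compact K" "K \<subseteq> dom_chart c" and f: "f \<in> Cinf A" "\<And>q. q \<notin> K \<Longrightarrow> f q = 0"
    and j: "j \<in> Basis - {b}"
    and Z: "Z \<in> VF" "\<And>q. q \<in> dom_chart c \<Longrightarrow> Z q = f q \<cdot>\<^sub>v pd c j q" "\<And>q. q \<notin> K \<Longrightarrow> Z q = 0"
  shows "chart_integral c b (divS Z) = 0"
proof -
  note c = sliceD(1)[OF s] and b = sliceD(2)[OF s]
  have jb: "j \<bullet> b = 0" using j b by (auto simp: inner_Basis)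
  let ?u = "axis (Axis_index j) 1 :: real ^ 'e axis_index"
  have u: "emb ?u = j" using j by (simp add: Axis_index_inverse)
  let ?C = "support_box c b K"
  have div0: "divS Z q = 0" if q: "q \<in> S" "q \<notin> K" for q
    by (rule divS_outside[OF compact_imp_closed[OF K(1)] Z(1,3) q])
  have cont: "continuous_on S (divS Z)" by (rule continuous_on_divS[OF Z(1)])
  have contf: "continuous_on S f" by (rule Cinf_continuous_on[OF f(1)])
  have "integral UNIV (integrand c b (divS Z)) = 0"
  proof (rule integral_directional_derivative[where q="integrand c b f" and u="?u" and C="?C"])
    show "continuous_on UNIV (integrand c b f)" by (rule continuous_on_integrand[OF s K contf]) (rule f(2))
    show "continuous_on UNIV (integrand c b (divS Z))" by (rule continuous_on_integrand[OF s K cont div0])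
    show "bounded ?C" by (rule compact_imp_bounded[OF compact_support_box[OF s K]])
    show "integrand c b f x = 0" if "x \<notin> ?C" for x by (rule integrand_outside[OF s K f(2) that])
    show "integrand c b (divS Z) x = 0" if "x \<notin> ?C" for x by (rule integrand_outside[OF s K div0 that])
    fix x
    show "((\<lambda>t. integrand c b f (x + t *\<^sub>R ?u)) has_real_derivative integrand c b (divS Z) x) (at 0)"
    proof (cases "x \<in> pdom c b")
      case True
      define p where "p = param c b x"
      have p: "p \<in> S" "p \<in> dom_chart c" "map_chart c p = sl_proj b (emb x)"
        using param_S[OF s True] param_dom[OF s True] map_param[OF s True] by (auto simp: p_def)
      obtain V y F where lf: "local_frame c V y F" "p \<in> V" using local_frame_exists[OF c p(2), of UNIV] by auto
      note F = local_frame_VF[OF lf(1)]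
      let ?\<gamma> = "\<lambda>t. inv_chart c (map_chart c p + t *\<^sub>R j)"
      have \<gamma>0: "?\<gamma> 0 = p" using p(2) c by simp
      have e: "emb (x + t *\<^sub>R ?u) = emb x + t *\<^sub>R j" for t
        using linear_add[OF linear_emb] linear_scale[OF linear_emb] u by metis
      have ep: "sl_proj b (emb (x + t *\<^sub>R ?u)) = map_chart c p + t *\<^sub>R j" "emb (x + t *\<^sub>R ?u) \<bullet> b = emb x \<bullet> b" for t
        using p(3) jb by (simp_all add: e sl_proj_def inner_add_left algebra_simps)
      define \<tau> where "\<tau> = (\<Sum>i\<in>Basis - {b}. proj p (D (F j) (F i) p) (y i)) + sqrt 2 * g p (D (F j) E p) (\<Xi> p)"
      have d1: "((\<lambda>t. f (?\<gamma> t)) has_real_derivative pd c j p f) (at 0)" by (rule curve_derivative[OF f(1) c p(2)])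
      have d2: "((\<lambda>t. dens c b (?\<gamma> t)) has_real_derivative \<tau> * dens c b p) (at 0)"
        unfolding \<tau>_def by (rule dens_derivative[OF p(1) s lf]) (use j in auto)
      have div: "divS Z p = pd c j p f + f p * \<tau>"
      proof -
        have FTS: "F j p \<in> TS p" using pd_tangent_sub[OF s p(2,1) jb] local_frame_F[OF lf] by simp
        have "divS (f \<cdot>\<^sub>f F j) p = f p * divS (F j) p + F j p f" by (rule divS_fscale[OF p(1) F FTS f(1)])
        moreover have "divS (F j) p = \<tau>"
        proof -
          have "D (F i) (F j) p = D (F j) (F i) p" for i
          proof -
            have "lie_bracket (F i) (F j) p = (\<Sum>k\<in>Basis. lie_bracket (F i) (F j) p (y k) \<cdot>\<^sub>v pd c k p)"
              by (rule tangent_expansion[OF lf VF_at[OF lie_bracket_VF[OF F F]]])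
            also have "\<dots> = 0" by (intro sum.neutral ballI) (simp add: local_frame_commute[OF lf])
            finally show ?thesis using D_torsion[OF F F, of i j] by (metis eq_iff_diff_eq_0 minus_apply)
          qed
          then show ?thesis unfolding divS_slice[OF p(1) s lf F] \<tau>_def by simp
        qed
        moreover have "divS Z p = divS (f \<cdot>\<^sub>f F j) p"
        proof -
          have Zeq: "Z q = (f \<cdot>\<^sub>f F j) q" if "q \<in> V" for q
            using Z(2)[OF local_frame_chart(4)[OF lf(1) that]] local_frame_F[OF lf(1) that] by simp
          have fF: "f \<cdot>\<^sub>f F j \<in> VF" using f(1) F by simp
          have "D (F i) Z p = D (F i) (f \<cdot>\<^sub>f F j) p" for i
            by (rule D_cong_along[OF F tangent_sub_UNIV[OF VF_at[OF F]] UNIV_I Z(1) fF local_frame_chart(2)[OF lf(1)] lf(2)])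
              (rule Zeq)
          moreover have "D Z E p = D (f \<cdot>\<^sub>f F j) E p" by (rule D_cong_left[OF Z(1) fF E_VF Zeq[OF lf(2)]])
          ultimately show ?thesis unfolding divS_slice[OF p(1) s lf Z(1)] divS_slice[OF p(1) s lf fF] by simp
        qed
        ultimately show ?thesis using local_frame_F[OF lf] by simp
      qed
      have "((\<lambda>t. tent (emb x \<bullet> b) * (f (?\<gamma> t) * dens c b (?\<gamma> t))) has_real_derivative
          tent (emb x \<bullet> b) * (divS Z p * dens c b p)) (at 0)"
        using DERIV_cmult[OF DERIV_mult'[OF d1 d2], of "tent (emb x \<bullet> b)"] unfolding div \<gamma>0 
        by (simp add: algebra_simps)
      moreover have "open ((\<lambda>t. x + t *\<^sub>R ?u) -` pdom c b)"
        by (intro open_vimage open_pdom[OF s] continuous_intros)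
      ultimately have "((\<lambda>t. integrand c b f (x + t *\<^sub>R ?u)) has_real_derivative
          tent (emb x \<bullet> b) * (divS Z p * dens c b p)) (at 0)"
        by (rule has_field_derivative_transform_within_open)
          (use True ep in \<open>auto simp: integrand_def param_def\<close>)
      then show ?thesis using True by (simp add: integrand_def p_def)
    next
      case False
      have o: "open ((\<lambda>t. x + t *\<^sub>R ?u) -` (- ?C))"
        using compact_imp_closed[OF compact_support_box[OF s K]]
        by (intro open_vimage continuous_intros) auto
      have "((\<lambda>t. 0) has_real_derivative 0) (at (0::real))" by simp
      then have "((\<lambda>t. integrand c b f (x + t *\<^sub>R ?u)) has_real_derivative 0) (at 0)"
        by (rule has_field_derivative_transform_within_open[OF _ o])
          (use False support_box_pdom[OF s K] integrand_outside[OF s K f(2)] in auto)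
      then show ?thesis using False by (simp add: integrand_def)
    qed
  qed
  then show ?thesis by (simp add: chart_integral_def)
qed

text \<open>Along \<open>S\<close> the component of the field transversal to the hyperplane vanishes, so the field is a sum of multiples of
the coordinate fields \<open>\<partial>\<^sub>j\<close> with \<open>j \<noteq> b\<close>, each with compact support in the chart.\<close>

lemma chart_integral_divS:
  assumes s: "slice S c b" and K: "compact K" "K \<subseteq> dom_chart c" and \<rho>: "\<rho> \<in> Cinf A" "\<And>q. q \<notin> K \<Longrightarrow> \<rho> q = 0"
    and X: "X \<in> VF" "\<And>q. q \<in> S \<Longrightarrow> X q \<in> TS q"
  shows "chart_integral c b (divS (\<rho> \<cdot>\<^sub>f X)) = 0"
proof -
  note c = sliceD(1)[OF s] and b = sliceD(2)[OF s]
  have o: "open (dom_chart c)" by (rule open_dom_chart[OF c])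
  have "\<forall>q. \<exists>w. q \<in> dom_chart c \<longrightarrow> X q = pd c w q" using tangent_eq_pd[OF c _ VF_at[OF X(1)]] by blast
  then obtain w where w: "\<And>q. q \<in> dom_chart c \<Longrightarrow> X q = pd c (w q) q" by metis
  define a where "a j q = (if q \<in> dom_chart c then \<rho> q * (w q \<bullet> j) else 0)" for j q
  have a0: "a j q = 0" if "q \<notin> K" for j q using \<rho>(2)[OF that] by (simp add: a_def)
  have sm: "smooth_in (dom_chart c) (\<lambda>q. w q \<bullet> j)" for j
  proof (rule smooth_in_local)
    fix q assume q: "q \<in> dom_chart c"
    obtain V x F where lf: "local_frame c V x F" "q \<in> V" using local_frame_exists[OF c q, of UNIV] by auto
    have "smooth_in V (\<lambda>q. X q (x j))"
      using VF_act'[OF X(1) local_frame_Cinf[OF lf(1)]] by (auto simp: Cinf_iff_smooth_in intro: smooth_in_subset[of UNIV])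
    then have "smooth_in V (\<lambda>q. w q \<bullet> j)"
      by (rule smooth_in_cong[OF local_frame_chart(2)[OF lf(1)], rotated])
        (simp add: w[OF local_frame_chart(4)[OF lf(1)]] local_frame_pd_x[OF lf(1)])
    then show "\<exists>V. open V \<and> q \<in> V \<and> smooth_in V (\<lambda>q. w q \<bullet> j)"
      using lf local_frame_chart(2)[OF lf(1)] by blast
  qed
  have aC: "a j \<in> Cinf A" for j
  proof (rule Cinf_extend_by_0[OF o compact_imp_closed[OF K(1)] K(2)])
    have "smooth_in (dom_chart c) (\<lambda>q. \<rho> q * (w q \<bullet> j))"
      using \<rho>(1) by (intro smooth_in_mult o sm) (auto simp: Cinf_iff_smooth_in intro: smooth_in_subset[of UNIV])
    then show "smooth_in (dom_chart c) (a j)" by (rule smooth_in_cong[OF o, rotated]) (simp add: a_def)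
  qed (rule a0)
  define Z where "Z j q = (if q \<in> dom_chart c then a j q \<cdot>\<^sub>v pd c j q else 0)" for j q
  have Z: "Z j \<in> VF" for j
    unfolding Z_def[abs_def]
    by (rule extend_VF_by_0[OF o K _ _ aC a0]) (auto intro: pd_tangent[OF c] pd_smooth_in[OF c])
  have Z0: "Z j q = 0" if "q \<notin> K" for j q using a0[OF that] by (simp add: Z_def)
  have "chart_integral c b (divS (Z j)) = 0" if j: "j \<in> Basis - {b}" for j
    by (rule chart_integral_coordinate[OF s K aC a0 j Z _ Z0]) (auto simp: Z_def)
  then have sum0: "(\<Sum>j\<in>Basis - {b}. chart_integral c b (divS (Z j))) = 0" by simp
  have eq: "(\<rho> \<cdot>\<^sub>f X) q = (\<Sum>j\<in>Basis - {b}. Z j) q" if q: "q \<in> S" for q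
  proof (cases "q \<in> dom_chart c")
    case True
    obtain V x F where lf: "local_frame c V x F" "q \<in> V" using local_frame_exists[OF c True, of UNIV] by auto
    have "X q = (\<Sum>j\<in>Basis - {b}. X q (x j) \<cdot>\<^sub>v pd c j q)" by (rule tangent_sub_expansion[OF s lf q X(2)[OF q]])
    then have "\<rho> q \<cdot>\<^sub>v X q = (\<Sum>j\<in>Basis - {b}. \<rho> q \<cdot>\<^sub>v X q (x j) \<cdot>\<^sub>v pd c j q)" by (metis vscale_sum)
    also have "\<dots> = (\<Sum>j\<in>Basis - {b}. Z j q)"
      using True w[OF True] local_frame_pd_x[OF lf] by (intro sum.cong refl) (simp add: Z_def a_def)
    finally show ?thesis by (simp only: fscale_apply sum_fun_apply)
  next
    case False
    then have "\<rho> q = 0" "\<And>j. Z j q = 0" using \<rho>(2) K by (auto simp: Z_def)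
    then show ?thesis by (simp add: sum_fun_apply)
  qed
  have dZ0: "divS (Z j) q = 0" if q: "q \<in> S" "q \<notin> K" for j q
    by (rule divS_outside[OF compact_imp_closed[OF K(1)] Z Z0 q])
  have "chart_integral c b (divS (\<rho> \<cdot>\<^sub>f X)) = chart_integral c b (\<lambda>q. \<Sum>j\<in>Basis - {b}. divS (Z j) q)"
  proof (rule chart_integral_cong[OF s])
    fix q assume q: "q \<in> S"
    have "divS (\<rho> \<cdot>\<^sub>f X) q = divS (\<Sum>j\<in>Basis - {b}. Z j) q"
      by (rule divS_cong[OF q]) (use \<rho> X Z eq in \<open>auto intro: VF_sum\<close>)
    then show "divS (\<rho> \<cdot>\<^sub>f X) q = (\<Sum>j\<in>Basis - {b}. divS (Z j) q)" using divS_sum[OF q, of "Basis - {b}" Z] Z by simp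
  qed
  also have "\<dots> = (\<Sum>j\<in>Basis - {b}. chart_integral c b (divS (Z j)))"
    by (rule chart_integral_sum[OF s K]) (auto intro: continuous_on_divS[OF Z] dZ0)
  finally show ?thesis using sum0 by simp
qed

lemma chart_integral_nonneg:
  assumes s: "slice S c b" and K: "compact K" "K \<subseteq> dom_chart c"
    and F: "continuous_on S F" "\<And>q. q \<in> S \<Longrightarrow> q \<notin> K \<Longrightarrow> F q = 0" and nn: "\<And>q. q \<in> S \<Longrightarrow> 0 \<le> F q"
  shows "0 \<le> chart_integral c b F"
  unfolding chart_integral_def
proof (rule Henstock_Kurzweil_Integration.integral_nonneg[OF integrand_integrable(2)[OF s K F]])
  show "0 \<le> integrand c b F x" for x
    using nn[OF param_S[OF s]] dens_pos[OF param_S[OF s] s param_dom[OF s]]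
    by (auto simp: integrand_def tent_nonneg less_imp_le intro!: mult_nonneg_nonneg)
qed

text \<open>With \<open>\<rho>\<^sub>k div X = div (\<rho>\<^sub>k X) - X(\<rho>\<^sub>k)\<close>, the integrals of the \<open>\<rho>\<^sub>k div X\<close> reduce to those of \<open>\<rho>\<^sub>l X(\<rho>\<^sub>k)\<close>. These may be
computed in the chart \<open>l\<close> instead of \<open>k\<close>, where the sum over \<open>k\<close> vanishes because \<open>\<Sum>\<^sub>k \<rho>\<^sub>k = 1\<close> on \<open>S\<close>. So the
integrals of the nonnegative functions \<open>\<rho>\<^sub>k div X\<close> add up to zero.\<close>

theorem divergence_theorem:
  assumes X: "X \<in> VF" "\<And>q. q \<in> S \<Longrightarrow> X q \<in> TS q" and nn: "\<And>q. q \<in> S \<Longrightarrow> 0 \<le> divS X q" and q0: "q0 \<in> S"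
  shows "divS X q0 = 0"
proof -
  have "\<forall>p. \<exists>c b. p \<in> S \<longrightarrow> slice S c b \<and> p \<in> dom_chart c"
    using hypersurface_slice null unfolding lightlike_hypersurface_def by metis
  then obtain cc bb where cb: "\<And>p. p \<in> S \<Longrightarrow> slice S (cc p) (bb p)" "\<And>p. p \<in> S \<Longrightarrow> p \<in> dom_chart (cc p)"
    by metis
  have U: "open (dom_chart (cc p)) \<and> p \<in> dom_chart (cc p)" if "p \<in> S" for p
    using cb[OF that] open_dom_chart[OF sliceD(1)] by blast
  obtain n :: nat and pt \<rho> K where
    P: "\<And>k. k < n \<Longrightarrow> pt k \<in> S \<and> \<rho> k \<in> Cinf A \<and> compact (K k) \<and> K k \<subseteq> dom_chart (cc (pt k))"
    "\<And>k q. k < n \<Longrightarrow> 0 \<le> \<rho> k q" "\<And>k q. k < n \<Longrightarrow> q \<notin> K k \<Longrightarrow> \<rho> k q = 0"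
    "\<And>q. q \<in> S \<Longrightarrow> (\<Sum>k<n. \<rho> k q) = 1"
    by (rule partition_of_unity[OF compact_S U]) blast+
  define J where "J k = chart_integral (cc (pt k)) (bb (pt k))" for k
  have sl: "slice S (cc (pt k)) (bb (pt k))" if "k < n" for k using cb P(1)[OF that] by blast
  have K: "compact (K k)" "K k \<subseteq> dom_chart (cc (pt k))" and \<rho>: "\<rho> k \<in> Cinf A" if "k < n" for k
    using P(1)[OF that] by auto
  define Y where "Y k q = X q (\<rho> k)" for k q
  have YC: "Y k \<in> Cinf A" if "k < n" for k
    unfolding Y_def[abs_def] by (rule VF_act'[OF X(1) \<rho>[OF that]])
  have Y0: "Y k q = 0" if k: "k < n" "q \<notin> K k" for k q
  proof -
    have "X q (\<rho> k) = X q (\<lambda>_. 0)"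
      by (rule tangent_local[OF VF_at[OF X(1)] \<rho>[OF k(1)] Cinf_const, of "- K k"])
        (use k P(3) compact_imp_closed[OF K(1)[OF k(1)]] in auto)
    then show ?thesis using tangent_of_const[OF VF_at[OF X(1)], of q 0] by (simp add: Y_def)
  qed
  have Ysum: "(\<Sum>k<n. Y k q) = 0" if q: "q \<in> S" for q
  proof -
    have "X q (\<lambda>r. \<Sum>k<n. \<rho> k r) = X q (\<lambda>_. 1)"
      by (rule tangent_sub_cong[OF X(2)[OF q] q Cinf_sum' Cinf_const open_UNIV UNIV_I]) (use \<rho> P(4) in auto)
    then show ?thesis
      using tangent_of_const[OF VF_at[OF X(1)], of q 1] tangent_sum[OF VF_at[OF X(1)], of "{..<n}" \<rho> q] \<rho>
      by (simp add: Y_def)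
  qed
  have c\<rho>: "continuous_on S (\<rho> k)" and cY: "continuous_on S (Y k)" if "k < n" for k
    using Cinf_continuous_on[OF \<rho>[OF that]] Cinf_continuous_on[OF YC[OF that]] by auto
  have cd: "continuous_on S (\<lambda>q. \<rho> k q * divS X q)" if "k < n" for k
    by (intro continuous_intros c\<rho> that continuous_on_divS X)
  have 1: "J k (\<lambda>q. \<rho> k q * divS X q) = - J k (Y k)" if k: "k < n" for k
  proof -
    have fX: "\<rho> k \<cdot>\<^sub>f X \<in> VF" using \<rho>[OF k] X by simp
    have d: "divS (\<rho> k \<cdot>\<^sub>f X) q = \<rho> k q * divS X q + Y k q" if "q \<in> S" for q
      using divS_fscale[OF that X(1) X(2)[OF that] \<rho>[OF k]] by (simp add: Y_def)
    have "J k (\<lambda>q. \<rho> k q * divS X q) = J k (\<lambda>q. divS (\<rho> k \<cdot>\<^sub>f X) q - Y k q)"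
      unfolding J_def by (rule chart_integral_cong[OF sl[OF k]]) (simp add: d)
    also have "\<dots> = J k (divS (\<rho> k \<cdot>\<^sub>f X)) - J k (Y k)"
      unfolding J_def
      by (rule chart_integral_diff[OF sl[OF k] K[OF k] continuous_on_divS[OF fX] _ cY[OF k] Y0[OF k]])
        (use d P(3)[OF k] Y0[OF k] in auto)
    also have "J k (divS (\<rho> k \<cdot>\<^sub>f X)) = 0"
      unfolding J_def by (rule chart_integral_divS[OF sl[OF k] K[OF k] \<rho>[OF k] P(3)[OF k] X])
    finally show ?thesis by simp
  qed
  have 2: "J k (Y k) = (\<Sum>l<n. J l (\<lambda>q. \<rho> l q * Y k q))" if k: "k < n" for k
  proof -
    have "J k (Y k) = J k (\<lambda>q. \<Sum>l<n. \<rho> l q * Y k q)"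
      unfolding J_def by (rule chart_integral_cong[OF sl[OF k]]) (simp add: sum_distrib_right[symmetric] P(4))
    also have "\<dots> = (\<Sum>l<n. J k (\<lambda>q. \<rho> l q * Y k q))"
      unfolding J_def
      by (rule chart_integral_sum[OF sl[OF k] K[OF k]]) (auto intro!: continuous_intros c\<rho> cY k simp: Y0[OF k])
    also have "\<dots> = (\<Sum>l<n. J l (\<lambda>q. \<rho> l q * Y k q))"
    proof (intro sum.cong refl)
      fix l assume "l \<in> {..<n}"
      then have l: "l < n" by simp
      show "J k (\<lambda>q. \<rho> l q * Y k q) = J l (\<lambda>q. \<rho> l q * Y k q)"
        unfolding J_def
      proof (rule chart_integral_change[OF sl[OF k] sl[OF l], of "K k \<inter> K l"])
        show "compact (K k \<inter> K l)" using K(1)[OF k] K(1)[OF l] compact_imp_closed by blast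
        show "continuous_on S (\<lambda>q. \<rho> l q * Y k q)" by (intro continuous_intros c\<rho> cY k l)
        show "\<rho> l q * Y k q = 0" if "q \<notin> K k \<inter> K l" for q
          using that Y0[OF k, of q] P(3)[OF l, of q] by auto
      qed (use K(2)[OF k] K(2)[OF l] in auto)
    qed
    finally show ?thesis .
  qed
  have 3: "(\<Sum>k<n. J l (\<lambda>q. \<rho> l q * Y k q)) = 0" if l: "l < n" for l
  proof -
    have "(\<Sum>k<n. J l (\<lambda>q. \<rho> l q * Y k q)) = J l (\<lambda>q. \<Sum>k<n. \<rho> l q * Y k q)"
      unfolding J_def
      by (rule chart_integral_sum[OF sl[OF l] K[OF l], symmetric]) (auto intro!: continuous_intros c\<rho> cY l simp: P(3)[OF l])
    also have "\<dots> = J l (\<lambda>q. 0)"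
      unfolding J_def by (rule chart_integral_cong[OF sl[OF l]]) (simp add: sum_distrib_left[symmetric] Ysum)
    also have "\<dots> = 0" by (simp add: J_def chart_integral_def integrand_def[abs_def] if_distrib cong: if_cong)
    finally show ?thesis .
  qed
  have "(\<Sum>k<n. J k (\<lambda>q. \<rho> k q * divS X q)) = - (\<Sum>k<n. \<Sum>l<n. J l (\<lambda>q. \<rho> l q * Y k q))"
    by (simp add: 1 2 sum_negf)
  also have "(\<Sum>k<n. \<Sum>l<n. J l (\<lambda>q. \<rho> l q * Y k q)) = (\<Sum>l<n. \<Sum>k<n. J l (\<lambda>q. \<rho> l q * Y k q))" by (rule sum.swap)
  also have "\<dots> = 0" by (simp add: 3)
  finally have tot: "(\<Sum>k<n. J k (\<lambda>q. \<rho> k q * divS X q)) = 0" by simp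
  have out: "\<rho> k q * divS X q = 0" if "k < n" "q \<notin> K k" for k q using P(3)[OF that] by simp
  have pos: "0 \<le> \<rho> k q * divS X q" if "k < n" "q \<in> S" for k q using P(2)[OF that(1)] nn[OF that(2)] by simp
  have "0 \<le> J k (\<lambda>q. \<rho> k q * divS X q)" if "k < n" for k
    unfolding J_def by (rule chart_integral_nonneg[OF sl K cd out pos]) (use that in auto)
  then have J0: "J k (\<lambda>q. \<rho> k q * divS X q) = 0" if "k < n" for k
    using tot sum_nonneg_eq_0_iff[of "{..<n}" "\<lambda>k. J k (\<lambda>q. \<rho> k q * divS X q)"] that by auto
  have "\<rho> k q0 * divS X q0 = 0" if k: "k < n" for k
    by (rule chart_integral_nonneg_0[OF sl[OF k] K[OF k] cd[OF k] out[OF k] pos[OF k] _ q0])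
      (use J0[OF k] in \<open>auto simp: J_def\<close>)
  then have "(\<Sum>k<n. \<rho> k q0 * divS X q0) = 0" by (intro sum.neutral) auto
  then show ?thesis using P(4)[OF q0] by (simp add: sum_distrib_right[symmetric])
qed

subsection \<open>Rigidity\<close>

lemma divS_uminus: "p \<in> S \<Longrightarrow> X \<in> VF \<Longrightarrow> divS (- X) p = - divS X p"
  using divS_add[of p X "- X"] divS_0[of p] by simp

lemma rigidity:
  assumes sign: "(\<forall>p\<in>S. 0 \<le> mean_curvature A g D E S \<xi> p) \<or> (\<forall>p\<in>S. mean_curvature A g D E S \<xi> p \<le> 0)"
    and curv: "\<And>p. p \<in> S \<Longrightarrow> 0 \<le> ricci A g D p (NN p) (\<xi> p) + 2 * sectional A g D p (\<xi> p) (NN p)"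
  shows "totally_geodesic A g D S \<xi>"
proof (rule totally_geodesic_if)
  have min: "divS \<Xi> q = 0" if q: "q \<in> S" for q
    using sign
  proof
    assume H: "\<forall>p\<in>S. 0 \<le> mean_curvature A g D E S \<xi> p"
    have "divS (- \<Xi>) q = 0"
    proof (rule divergence_theorem[OF _ _ _ q])
      show "- \<Xi> \<in> VF" by simp
      show "(- \<Xi>) r \<in> TS r" if "r \<in> S" for r
        using tangent_sub_scale[OF \<Xi>_TS[OF that], of "-1"] by simp
      show "0 \<le> divS (- \<Xi>) r" if "r \<in> S" for r
        using H that by (simp add: divS_uminus divS_\<Xi>)
    qed
    then show ?thesis using q by (simp add: divS_uminus)
  next
    assume H: "\<forall>p\<in>S. mean_curvature A g D E S \<xi> p \<le> 0"
    show ?thesis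
      by (rule divergence_theorem[OF \<Xi>_VF \<Xi>_TS _ q]) (use H in \<open>auto simp: divS_\<Xi>\<close>)
  qed
  let ?h = "\<lambda>p. \<Sum>i<DIM('e) - 2. \<Sum>j<DIM('e) - 2. (g p (nab \<Xi> p (scr_onb p i)) (scr_onb p j))\<^sup>2"
  have h: "0 \<le> ?h p" for p by (intro sum_nonneg) auto
  have W: "0 \<le> g p (W p) (W p)" for p
    using E_complement_pos[OF WT W_E, of p] g_0_left[OF \<Xi>T[of p]] g_0_left[OF tangent_zero_in[of p]] by (cases "W p = 0") auto
  have key: "?h p + 4 * g p (W p) (W p) \<le> sqrt 2 * divS W p" if "p \<in> S" for p
    using curv[OF that] curvature_condition[OF that min] by simp
  have div: "divS W p = 0" if p: "p \<in> S" for p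
  proof (rule divergence_theorem[OF W_VF W_TS _ p])
    fix q assume "q \<in> S"
    then have "0 \<le> sqrt 2 * divS W q" using key[of q] h[of q] W[of q] by linarith
    then show "0 \<le> divS W q" by (simp add: zero_le_mult_iff)
  qed
  fix p i j assume p: "p \<in> S" and ij: "i < DIM('e) - 2" "j < DIM('e) - 2"
  have "?h p = 0" using key[OF p] h[of p] W[of p] div[OF p] by simp
  then have "\<forall>i<DIM('e) - 2. (\<Sum>j<DIM('e) - 2. (g p (nab \<Xi> p (scr_onb p i)) (scr_onb p j))\<^sup>2) = 0"
    by (subst (asm) sum_nonneg_eq_0_iff) (auto intro!: sum_nonneg)
  then have "(\<Sum>j<DIM('e) - 2. (g p (nab \<Xi> p (scr_onb p i)) (scr_onb p j))\<^sup>2) = 0" using ij by blast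
  then show "g p (nab \<Xi> p (scr_onb p i)) (scr_onb p j) = 0"
    using ij by (subst (asm) sum_nonneg_eq_0_iff) auto
qed

end

theorem corollary6p6:
  fixes A :: "('m::{t2_space, second_countable_topology}, 'e::euclidean_space) chart set"
    and g :: "'m metric"
    and D :: "'m vfield \<Rightarrow> 'm vfield \<Rightarrow> 'm vfield"
    and E \<xi> N :: "'m vfield"
    and S :: "'m set"
  assumes "smooth_atlas A"
    and "lorentzian_metric A g"
    and "levi_civita A g D"
    and "timelike_unitary A g E"
    and "killing A g E"
    and "lightlike_hypersurface A g S"
    and "compact S"
    and "lightlike_field_sub A g S \<xi>"
    and "\<forall>p\<in>S. g p (\<xi> p) (E p) = 1 / sqrt 2"
    and "\<forall>p\<in>S. N p = symmetric_wrt A g E p (- \<xi> p)"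
    and "(\<forall>p\<in>S. 0 \<le> mean_curvature A g D E S \<xi> p) \<or>
         (\<forall>p\<in>S. mean_curvature A g D E S \<xi> p \<le> 0)"
    and "\<forall>p\<in>S. 0 \<le> ricci A g D p (N p) (\<xi> p) + 2 * sectional A g D p (\<xi> p) (N p)"
  shows "totally_geodesic A g D S \<xi>"
proof -
  interpret null_hypersurface A g D E S \<xi>
    by unfold_locales (use assms in auto)
  show ?thesis
    by (rule rigidity) (use assms symmetric_wrt_eq in auto)
qed

end
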